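(* There exist absolute constants $c_1, c_2 > 0$ such that the following holds. Let $G = C(m_1, \dots, m_n)$ be a caterpillar with $n \ge 1$ spine vertices and $m = m_1 + \dots + m_n$ leg vertices. Then the diameter $\delta(\mathcal{A}(G))$ of the graph associahedron of $G$, i.e. the maximum rotation distance $d(T_1,T_2)$ over all pairs of search trees $T_1, T_2$ on $G$, satisfies $$c_1\bigl(n + m\,(H(G)+1)\bigr) \;\le\; \delta(\mathcal{A}(G)) \;\le\; c_2\bigl(n + m\,(H(G)+1)\bigr).$$
   Context: For $n \in \mathbb{N}_+$ and $m_1,\dots,m_n \in \mathbb{N}_0$, the caterpillar $C(m_1,\dots,m_n)$ is the tree with spine vertices $s_1,\dots,s_n$ forming a path in this order, and for each $i\in[n]$ and $j\in[m_i]$ a leg vertex $\ell_{i,j}$ adjacent only to $s_i$. Its leg entropy is $H(G) = \sum_{i\in[n],\,m_i>0} \frac{m_i}{m}\log\frac{m}{m_i}$ (logarithm base 2; $H(G)=0$ if $m=0$). A search tree on a connected graph $G$ (STG) is a rooted tree $T$ with $V(T)=V(G)$ such that, if $r$ is the root with children $c_1,\dots,c_k$, then $G\setminus r$ has exactly $k$ connected components $C_1,\dots,C_k$ with $V(T_{c_i}) = V(C_i)$ and $T_{c_i}$ a search tree on $C_i$ for each $i$ (here $T_x$ is the subtree of $T$ consisting of $x$ and its descendants). A rotation of an edge $(p,c)$ of $T$, where $c$ is a child of $p$, produces the STG in which $c$ takes the place of $p$ (becoming a child of the former parent of $p$, or the root if $p$ was the root), $p$ becomes a child of $c$, each child $x$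 of $c$ such that $V(T_x)$ contains a vertex adjacent in $G$ to $p$ becomes a child of $p$, and all other parent–child relations are unchanged. The rotation distance $d(T_1,T_2)$ is the minimum number of rotations transforming $T_1$ into $T_2$.
   Formalization: The lower bound is claimed only for n + m ≥ 2, because for the single-vertex caterpillar (n = 1, m = 0) the diameter is 0 while n + m(H(G)+1) = 1, so no c_1 > 0 works; the upper bound holds for all n ≥ 1. *)

theory Defs
  imports Complex_Main "HOL-Library.Extended_Nat"
begin

text \<open>
  A simple graph is given by a vertex set \<open>V\<close> and a symmetric, irreflexive adjacency relation
  \<open>E\<close>. Induced subgraphs are given by \<open>E\<close> and a smaller vertex set \<open>S\<close>.
\<close>

definition components :: "'a rel \<Rightarrow> 'a set \<Rightarrow> 'a set set" where
  "components E S = S // (E \<inter> S \<times> S)\<^sup>*"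

text \<open>
  A rooted tree on a given vertex set is represented by its set of pairs (parent, child), which
  determines the root. \<open>search_tree_rooted E S r T\<close> says that \<open>T\<close>, with root \<open>r\<close>, is a search tree
  on the subgraph induced by \<open>S\<close>: the functions \<open>\<rho>\<close> and \<open>\<tau>\<close> assign to each component of
  \<open>S - {r}\<close> the corresponding child of \<open>r\<close> and the subtree below that child. Distinct components
  have distinct children because \<open>\<rho> C \<in> C\<close>.
\<close>

inductive search_tree_rooted :: "'a rel \<Rightarrow> 'a set \<Rightarrow> 'a \<Rightarrow> 'a rel \<Rightarrow> bool" for E where
  "r \<in> S \<Longrightarrow>
   (\<And>C. C \<in> components E (S - {r}) \<Longrightarrow> search_tree_rooted E C (\<rho> C) (\<tau> C)) \<Longrightarrow>
   search_tree_rooted E S r (\<Union>C \<in> components E (S - {r}). insert (r, \<rho> C) (\<tau> C))"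

definition search_trees :: "'a set \<Rightarrow> 'a rel \<Rightarrow> 'a rel set" where
  "search_trees V E = {T. \<exists>r. search_tree_rooted E V r T}"

definition subtree_verts :: "'a rel \<Rightarrow> 'a \<Rightarrow> 'a set" where
  "subtree_verts T x = T\<^sup>* `` {x}"

text \<open>\<open>T\<inverse> `` {p}\<close> contains the parent of \<open>p\<close>, and is empty if \<open>p\<close> is the root.\<close>

definition rotate_edge :: "'a rel \<Rightarrow> 'a rel \<Rightarrow> 'a \<Rightarrow> 'a \<Rightarrow> 'a rel" where
  "rotate_edge E T p c =
     (let Q = T\<inverse> `` {p};
          X = {x. (c, x) \<in> T \<and> (\<exists>y \<in> subtree_verts T x. (y, p) \<in> E)}
      in (T - (Q \<times> {p} \<union> {(p, c)} \<union> {c} \<times> X)) \<union> (Q \<times> {c} \<union> {(c, p)} \<union> {p} \<times> X))"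

definition rotation :: "'a rel \<Rightarrow> 'a rel rel" where
  "rotation E = {(T, rotate_edge E T p c) | T p c. (p, c) \<in> T}"

text \<open>The distance is \<open>\<infinity>\<close> if no sequence of rotations leads from \<open>T\<^sub>1\<close> to \<open>T\<^sub>2\<close>.\<close>

definition rotation_distance :: "'a rel \<Rightarrow> 'a rel \<Rightarrow> 'a rel \<Rightarrow> enat" where
  "rotation_distance E T\<^sub>1 T\<^sub>2 = (INF k \<in> {k. (T\<^sub>1, T\<^sub>2) \<in> rotation E ^^ k}. enat k)"

definition assoc_diameter :: "'a set \<Rightarrow> 'a rel \<Rightarrow> enat" where
  "assoc_diameter V E =
     (SUP T\<^sub>1 \<in> search_trees V E. SUP T\<^sub>2 \<in> search_trees V E. rotation_distance E T\<^sub>1 T\<^sub>2)"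

text \<open>
  The caterpillar \<open>C(m\<^sub>1, \<dots>, m\<^sub>n)\<close> is given by \<open>n\<close> and a function \<open>m\<close> of which only the values on
  \<open>{1..n}\<close> are used.
\<close>

datatype cat_vertex = Spine nat | Leg nat nat

definition cat_verts :: "nat \<Rightarrow> (nat \<Rightarrow> nat) \<Rightarrow> cat_vertex set" where
  "cat_verts n m = {Spine i | i. i \<in> {1..n}} \<union> {Leg i j | i j. i \<in> {1..n} \<and> j \<in> {1..m i}}"

definition cat_arcs :: "nat \<Rightarrow> (nat \<Rightarrow> nat) \<Rightarrow> cat_vertex rel" where
  "cat_arcs n m = {(Spine i, Spine (i + 1)) | i. i \<in> {1..<n}} \<union>
                  {(Spine i, Leg i j) | i j. i \<in> {1..n} \<and> j \<in> {1..m i}}"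

definition cat_adj :: "nat \<Rightarrow> (nat \<Rightarrow> nat) \<Rightarrow> cat_vertex rel" where
  "cat_adj n m = cat_arcs n m \<union> (cat_arcs n m)\<inverse>"

definition num_legs :: "nat \<Rightarrow> (nat \<Rightarrow> nat) \<Rightarrow> nat" where
  "num_legs n m = (\<Sum>i\<in>{1..n}. m i)"

definition leg_entropy :: "nat \<Rightarrow> (nat \<Rightarrow> nat) \<Rightarrow> real" where
  "leg_entropy n m =
     (\<Sum>i \<in> {i \<in> {1..n}. m i > 0}.
        real (m i) / real (num_legs n m) * log 2 (real (num_legs n m) / real (m i)))"

abbreviation cat_diameter :: "nat \<Rightarrow> (nat \<Rightarrow> nat) \<Rightarrow> enat" where
  "cat_diameter n m \<equiv> assoc_diameter (cat_verts n m) (cat_adj n m)"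

text \<open>
  The one-vertex caterpillar has a unique search tree, so its diameter is \<open>0\<close>, although
  \<open>n + m (H + 1) = 1\<close>. Hence no lower bound with a positive constant can include it.
\<close>

lemma cat_diameter_single_vertex:
  assumes "m 1 = 0"
  shows "cat_diameter 1 m = 0"
proof -
  have V: "cat_verts 1 m = {Spine 1}"
    using assms by (auto simp: cat_verts_def)
  have "T = {}" if "search_tree_rooted (cat_adj 1 m) {Spine 1} r T" for r T
    using that by cases (auto simp: components_def quotient_def)
  moreover have "search_tree_rooted E {Spine 1} (Spine 1) {}" for E
    using search_tree_rooted.intros[of "Spine 1" "{Spine 1}" E]
    by (simp add: components_def quotient_def)
  ultimately have T: "search_trees (cat_verts 1 m) (cat_adj 1 m) = {{}}"
    unfolding search_trees_def V by blast
  have "rotation_distance (cat_adj 1 m) {} {} \<le> enat 0"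
    unfolding rotation_distance_def by (rule INF_lower) simp
  then show ?thesis
    unfolding assoc_diameter_def T by (simp flip: zero_enat_def)
qed

end

theory Submission
  imports Defs "HOL-Library.Sublist"
begin

text \<open>
  A search tree is determined by its ancestor order, and a rotation at \<open>(p, c)\<close> only changes the
  ancestors of vertices below \<open>p\<close>. The distance of two search trees is at most the number of pairs
  that they order oppositely.

  Upper bound: after moving the ends of each block of consecutive legless spine vertices up, every
  search tree has few inversions with one whose top is a balanced binary search tree, weighted by
  the numbers of legs, on the spine vertices with legs, and whose legs are leaves; the average depth
  of a leg in it is the entropy. The remaining differences on the spine are removed by at most \<open>n\<close>
  rotations, by making one spine vertex after the other an ancestor of the last one.

  Lower bound: a rotation changes the depth of a vertex by at most one, which gives the linear term.
  For the entropy term, as in Wilber's bound for binary search trees, fix a hierarchical splitting of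
  the spine. For the split of \<open>[a, b]\<close> at \<open>k\<close>, let the common ancestors of \<open>s\<^sub>k\<close> and its successor on the spine alternate
  between the two sides as often as possible. A rotation decreases this number by at most two, and
  only for the one split that separates \<open>p\<close> from \<open>c\<close>. The sum over all splits is small if the legs are
  sorted, and at least of the order of the entropy if the legs of the two sides are interleaved at
  every split.
\<close>

section \<open>Search trees as ancestor orders\<close>

text \<open>Inversion counts alone cannot give the upper bound. On a spine without legs, the search
  trees that are paths rooted at the two ends have \<open>n * (n - 1) / 2\<close> inversions,
  although their distance is linear. The target of the inversion count therefore keeps the order
  that the given tree has on its legless vertices, so it differs from tree to tree; only a last
  stage of at most \<open>n\<close> rotations leads to one tree common to all. What remains costly
  is a legless vertex above leg-bearing ones, since legless vertices may far outnumber the legs.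
  Once the ends of a block are just below its top, only three vertices of the block can be in this
  position, and these are charged to the leg-bearing vertex next to the block. In the lower bound, a
  rotation must not be able to lower the numbers of many splits at once. A hierarchy separates any
  two spine positions at most once, so the total drops by at most two. The sum of the smaller sides
  of all splits falls short of the entropy when one vertex holds most of the legs; the linear bound
  makes up for that.\<close>

definition hasse :: "'a rel \<Rightarrow> 'a rel" where
  "hasse A = {(x, y) \<in> A. x \<noteq> y \<and> (\<forall>z. (x, z) \<in> A \<longrightarrow> (z, y) \<in> A \<longrightarrow> z = x \<or> z = y)}"

text \<open>\<open>P x y\<close> stands for the vertex set of the path between \<open>x\<close> and
  \<open>y\<close> in a tree, described by betweenness laws. Apart from symmetry,
  \<open>connected_iff\<close> is the only link to the edges: an induced subgraph connects two
  vertices exactly if it contains their path.\<close>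

locale tree_paths =
  fixes V :: "'a set" and E :: "'a rel" and P :: "'a \<Rightarrow> 'a \<Rightarrow> 'a set"
  assumes finite_verts: "finite V"
    and path_in: "x \<in> V \<Longrightarrow> y \<in> V \<Longrightarrow> P x y \<subseteq> V"
    and path_start: "x \<in> P x y"
    and path_self: "P x x = {x}"
    and path_sym: "P x y = P y x"
    and path_triangle: "P x z \<subseteq> P x y \<union> P y z"
    and path_sub: "z \<in> P x y \<Longrightarrow> P x z \<subseteq> P x y"
    and path_antisym: "z \<in> P x y \<Longrightarrow> y \<in> P x z \<Longrightarrow> z = y"
    and adj_sym: "(x, y) \<in> E \<Longrightarrow> (y, x) \<in> E"
    and connected_iff:
      "S \<subseteq> V \<Longrightarrow> x \<in> S \<Longrightarrow> y \<in> S \<Longrightarrow> (x, y) \<in> (E \<inter> S \<times> S)\<^sup>* \<longleftrightarrow> P x y \<subseteq> S"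
begin

lemma path_end: "y \<in> P x y"
  using path_start[of y x] path_sym[of x y] by simp

text \<open>The last two conditions say that the descendants of a vertex form a connected set and
  that every path carries a common ancestor of its ends. That ancestors form chains and that there
  is a root follows from them.\<close>

definition anc_order :: "'a set \<Rightarrow> 'a rel \<Rightarrow> bool" where
  "anc_order S A \<longleftrightarrow> A \<subseteq> S \<times> S \<and> (\<forall>x\<in>S. (x, x) \<in> A) \<and> antisym A \<and> trans A \<and>
     (\<forall>a x y. (a, x) \<in> A \<longrightarrow> (a, y) \<in> A \<longrightarrow> P x y \<subseteq> A `` {a}) \<and>
     (\<forall>x\<in>S. \<forall>y\<in>S. \<exists>z \<in> P x y. (z, x) \<in> A \<and> (z, y) \<in> A)"

lemma ao_in: "anc_order S A \<Longrightarrow> (x, y) \<in> A \<Longrightarrow> x \<in> S \<and> y \<in> S"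
  unfolding anc_order_def by auto

lemma ao_refl: "anc_order S A \<Longrightarrow> x \<in> S \<Longrightarrow> (x, x) \<in> A"
  unfolding anc_order_def by auto

lemma ao_antisym: "anc_order S A \<Longrightarrow> (x, y) \<in> A \<Longrightarrow> (y, x) \<in> A \<Longrightarrow> x = y"
  unfolding anc_order_def antisym_def by blast

lemma ao_trans: "anc_order S A \<Longrightarrow> (x, y) \<in> A \<Longrightarrow> (y, z) \<in> A \<Longrightarrow> (x, z) \<in> A"
  unfolding anc_order_def trans_def by blast

lemma ao_convex: "anc_order S A \<Longrightarrow> (a, x) \<in> A \<Longrightarrow> (a, y) \<in> A \<Longrightarrow> w \<in> P x y \<Longrightarrow> (a, w) \<in> A"
  unfolding anc_order_def by blast

lemma ao_top:
  assumes "anc_order S A" "x \<in> S" "y \<in> S"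
  obtains z where "z \<in> P x y" "(z, x) \<in> A" "(z, y) \<in> A"
  using assms unfolding anc_order_def by blast

lemma ao_path: "anc_order S A \<Longrightarrow> (a, x) \<in> A \<Longrightarrow> w \<in> P a x \<Longrightarrow> (a, w) \<in> A"
  using ao_convex[of S A a a x w] ao_refl ao_in by metis

text \<open>The common ancestor \<open>z\<close> on the path from \<open>a\<close> to
  \<open>b\<close> lies on the path from \<open>a\<close> to \<open>x\<close> or on that from
  \<open>b\<close> to \<open>x\<close>. So it is also a descendant of \<open>a\<close> or of
  \<open>b\<close>, and must equal that vertex.\<close>

lemma ao_chain:
  assumes A: "anc_order S A" and "(a, x) \<in> A" "(b, x) \<in> A"
  shows "(a, b) \<in> A \<or> (b, a) \<in> A"
proof -
  have ab: "a \<in> S" "b \<in> S" "x \<in> S" using assms ao_in by metis+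
  obtain z where z: "z \<in> P a b" "(z, a) \<in> A" "(z, b) \<in> A"
    using ao_top[OF A ab(1,2)] by metis
  have "z \<in> P a x \<or> z \<in> P b x"
    using z(1) path_triangle[of a b x] path_sym[of x b] by blast
  then have "(a, z) \<in> A \<or> (b, z) \<in> A"
    using ao_path[OF A] assms by metis
  then have "z = a \<or> z = b"
    using ao_antisym[OF A] z by metis
  then show ?thesis using z by metis
qed

lemma ao_finite:
  assumes "anc_order S A" "finite S"
  shows "finite {u. (u, w) \<in> A}" "finite (A `` {w})"
proof -
  have "{u. (u, w) \<in> A} \<subseteq> S" "A `` {w} \<subseteq> S" using ao_in[OF assms(1)] by auto
  then show "finite {u. (u, w) \<in> A}" "finite (A `` {w})" using assms(2) by (auto intro: finite_subset)
qed

lemma ao_card_less: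
  assumes A: "anc_order S A" "finite S" and zw: "(z, w) \<in> A" "z \<noteq> w"
  shows "card {u. (u, z) \<in> A} < card {u. (u, w) \<in> A}"
proof (rule psubset_card_mono[OF ao_finite(1)[OF A]])
  have "{u. (u, z) \<in> A} \<subseteq> {u. (u, w) \<in> A}" using ao_trans[OF A(1) _ zw(1)] by auto
  moreover have "(w, w) \<in> A" using ao_refl[OF A(1)] ao_in[OF A(1) zw(1)] by simp
  moreover have "(w, z) \<notin> A" using ao_antisym[OF A(1) zw(1)] zw(2) by auto
  ultimately show "{u. (u, z) \<in> A} \<subset> {u. (u, w) \<in> A}" by auto
qed

text \<open>Since the proper ancestors of \<open>y\<close> form a chain, the parent is the lowest of
  them and all others are above it. The proofs about rotations work with this form.\<close>

lemma hasse_iff: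
  assumes A: "anc_order S A"
  shows "(x, y) \<in> hasse A \<longleftrightarrow> (x, y) \<in> A \<and> x \<noteq> y \<and> (\<forall>z. (z, y) \<in> A \<longrightarrow> z \<noteq> y \<longrightarrow> (z, x) \<in> A)"
proof
  assume h: "(x, y) \<in> hasse A"
  then have xy: "(x, y) \<in> A" "x \<noteq> y" and
    n: "\<And>z. (x, z) \<in> A \<Longrightarrow> (z, y) \<in> A \<Longrightarrow> z = x \<or> z = y" unfolding hasse_def by auto
  have "(z, x) \<in> A" if z: "(z, y) \<in> A" "z \<noteq> y" for z
    using ao_chain[OF A z(1) xy(1)] n[of z] z by (metis xy(1) ao_refl[OF A] ao_in[OF A])
  then show "(x, y) \<in> A \<and> x \<noteq> y \<and> (\<forall>z. (z, y) \<in> A \<longrightarrow> z \<noteq> y \<longrightarrow> (z, x) \<in> A)"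
    using xy by blast
next
  assume h: "(x, y) \<in> A \<and> x \<noteq> y \<and> (\<forall>z. (z, y) \<in> A \<longrightarrow> z \<noteq> y \<longrightarrow> (z, x) \<in> A)"
  then show "(x, y) \<in> hasse A"
    unfolding hasse_def using ao_antisym[OF A] by auto
qed

lemma hasse_unique:
  assumes A: "anc_order S A" and "(x, y) \<in> hasse A" "(x', y) \<in> hasse A"
  shows "x = x'"
  using assms(2,3) ao_antisym[OF A] unfolding hasse_iff[OF A] by metis

lemma hasse_parent_ex:
  assumes A: "anc_order S A" "finite S" and x: "(x, y) \<in> A" "x \<noteq> y"
  obtains q where "(q, y) \<in> hasse A" "(x, q) \<in> A"
proof -
  let ?B = "{z. (z, y) \<in> A \<and> z \<noteq> y}"
  have fin: "finite ?B"
    by (rule finite_subset[OF _ ao_finite(1)[OF A, of y]]) auto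
  \<comment> \<open>The number of ancestors is the depth, which grows strictly downwards; the parent
    is the deepest proper ancestor.\<close>
  define d where "d z = card {w. (w, z) \<in> A}" for z
  have dl: "d z < d w" if "(z, w) \<in> A" "z \<noteq> w" for z w
    unfolding d_def using ao_card_less[OF A that] .
  have "Max (d ` ?B) \<in> d ` ?B" using x fin by (intro Max_in) auto
  then obtain q where q: "q \<in> ?B" "d q = Max (d ` ?B)" by auto
  have mx: "d z \<le> d q" if "z \<in> ?B" for z using that fin q(2) by auto
  have le: "(z, q) \<in> A" if z: "z \<in> ?B" for z
  proof (cases "z = q")
    case True then show ?thesis using q(1) ao_refl[OF A(1)] ao_in[OF A(1)] by blast
  next
    case False
    have "(z, q) \<in> A \<or> (q, z) \<in> A" using ao_chain[OF A(1)] z q(1) by blast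
    moreover have "\<not> (q, z) \<in> A" using dl[of q z] False mx[OF z] by fastforce
    ultimately show ?thesis by blast
  qed
  have "(q, y) \<in> hasse A" unfolding hasse_iff[OF A(1)] using q(1) le by blast
  moreover have "(x, q) \<in> A" using le x by blast
  ultimately show ?thesis by (rule that)
qed

lemma hasse_rtrancl:
  assumes A: "anc_order S A" "finite S" and xy: "(x, y) \<in> A"
  shows "(x, y) \<in> (hasse A)\<^sup>*"
  using xy
proof (induction "card {w. (w, y) \<in> A}" arbitrary: y rule: less_induct)
  case less
  show ?case
  proof (cases "x = y")
    case False
    obtain q where q: "(q, y) \<in> hasse A" "(x, q) \<in> A"
      using hasse_parent_ex[OF A less.prems False] by metis
    have qy: "(q, y) \<in> A" "q \<noteq> y" using q(1) unfolding hasse_def by auto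
    have "card {u. (u, q) \<in> A} < card {u. (u, y) \<in> A}" by (rule ao_card_less[OF A qy])
    then have "(x, q) \<in> (hasse A)\<^sup>*" using less.hyps q(2) by blast
    then show ?thesis using q(1) by (rule rtrancl_into_rtrancl)
  qed simp
qed

lemma hasse_rtrancl_iff:
  assumes A: "anc_order S A" "finite S" and x: "x \<in> S"
  shows "(x, y) \<in> (hasse A)\<^sup>* \<longleftrightarrow> (x, y) \<in> A"
proof
  assume "(x, y) \<in> (hasse A)\<^sup>*"
  then show "(x, y) \<in> A"
  proof induction
    case base show ?case using ao_refl[OF A(1) x] .
  next
    case (step y z)
    then show ?case using ao_trans[OF A(1)] unfolding hasse_def by blast
  qed
qed (rule hasse_rtrancl[OF A])

lemma hasse_inj:
  assumes A: "anc_order S A" and B: "anc_order S B" and S: "finite S" and h: "hasse A = hasse B"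
  shows "A = B"
proof -
  have "(x, y) \<in> A \<longleftrightarrow> (x, y) \<in> B" for x y
    using hasse_rtrancl_iff[OF A S] hasse_rtrancl_iff[OF B S] h ao_in[OF A] ao_in[OF B] by metis
  then show ?thesis by auto
qed

section \<open>Ancestor orders from vertex priorities\<close>

text \<open>The Cartesian tree of \<open>d\<close>, with the paths of a tree in place of intervals:
  in each component the vertex of least priority becomes the root. Constructing a search tree thus
  reduces to giving an injective rank function.\<close>

definition prio :: "('a \<Rightarrow> nat) \<Rightarrow> 'a rel" where
  "prio d = {(x, y). x \<in> V \<and> y \<in> V \<and> (\<forall>w \<in> P x y. d x \<le> d w)}"

lemma prio_ao:
  assumes inj: "inj_on d V"
  shows "anc_order V (prio d)"
  unfolding anc_order_def
proof (intro conjI ballI allI impI)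
  show "prio d \<subseteq> V \<times> V" unfolding prio_def by auto
  show "(x, x) \<in> prio d" if "x \<in> V" for x using that path_self unfolding prio_def by auto
  show "antisym (prio d)"
  proof (rule antisymI)
    fix x y assume "(x, y) \<in> prio d" "(y, x) \<in> prio d"
    then have "x \<in> V" "y \<in> V" "d x = d y"
      unfolding prio_def using path_end[of y x] path_end[of x y] by (auto intro: antisym)
    then show "x = y" using inj by (auto dest: inj_onD)
  qed
  show "trans (prio d)"
  proof (rule transI)
    fix x y z assume xy: "(x, y) \<in> prio d" and yz: "(y, z) \<in> prio d"
    then have "d x \<le> d y" unfolding prio_def using path_end[of y x] by auto
    moreover have "P x z \<subseteq> P x y \<union> P y z" by (rule path_triangle)
    ultimately have "\<forall>w \<in> P x z. d x \<le> d w"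
      using xy yz unfolding prio_def by fastforce
    then show "(x, z) \<in> prio d" using xy yz unfolding prio_def by auto
  qed
  fix a x y assume ax: "(a, x) \<in> prio d" and ay: "(a, y) \<in> prio d"
  show "P x y \<subseteq> prio d `` {a}"
  proof
    fix z assume z: "z \<in> P x y"
    have "z \<in> V" using z path_in[of x y] ax ay unfolding prio_def by auto
    moreover have "P a z \<subseteq> P a x \<union> P x z" by (rule path_triangle)
    moreover have "P x z \<subseteq> P x y" using z by (rule path_sub)
    moreover have "P x y \<subseteq> P a x \<union> P a y" using path_triangle[of x y a] path_sym[of x a] by simp
    ultimately show "z \<in> prio d `` {a}" using ax ay unfolding prio_def by blast
  qed
next
  fix x y assume xy: "x \<in> V" "y \<in> V"
  have "finite (P x y)" using path_in[OF xy] finite_verts by (rule finite_subset)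
  then have "Min (d ` P x y) \<in> d ` P x y" using path_start by (intro Min_in) auto
  then obtain z where z: "z \<in> P x y" "d z = Min (d ` P x y)" by auto
  have mn: "d z \<le> d w" if "w \<in> P x y" for w using that \<open>finite (P x y)\<close> z(2) by simp
  have "P x z \<subseteq> P x y" using z(1) by (rule path_sub)
  moreover have "P y z \<subseteq> P x y" using path_sub[of z y x] z(1) path_sym[of x y] by simp
  ultimately have "(z, x) \<in> prio d" "(z, y) \<in> prio d"
    using mn xy z(1) path_in[OF xy] path_sym[of z x] path_sym[of z y] unfolding prio_def by auto
  then show "\<exists>z \<in> P x y. (z, x) \<in> prio d \<and> (z, y) \<in> prio d" using z(1) by blast
qed

text \<open>A linear extension serves as priority: ranked by depth, with ties broken by an arbitrary
  numbering \<open>f\<close> below \<open>N\<close>. A vertex of least rank on its path to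
  \<open>y\<close> must be the common ancestor that this path carries.\<close>

lemma ao_is_prio:
  assumes A: "anc_order V A"
  obtains d :: "'a \<Rightarrow> nat" where "inj_on d V" "A = prio d"
proof -
  obtain f :: "'a \<Rightarrow> nat" and N where f: "f ` V = {i. i < N}" "inj_on f V"
    using finite_imp_inj_to_nat_seg[OF finite_verts] by metis
  define D where "D x = card {w. (w, x) \<in> A}" for x
  define d where "d x = D x * N + f x" for x
  have Dl: "D z < D w" if "(z, w) \<in> A" "z \<noteq> w" for z w
    unfolding D_def using ao_card_less[OF A finite_verts that] .
  have fl: "f x < N" if "x \<in> V" for x using that f(1) by blast
  have dl: "d z < d w" if zw: "(z, w) \<in> A" "z \<noteq> w" for z w
  proof -
    have "d z < D z * N + N" unfolding d_def using fl ao_in[OF A zw(1)] by simp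
    also have "\<dots> = Suc (D z) * N" by simp
    also have "\<dots> \<le> D w * N" using Dl[OF zw] by (intro mult_right_mono) auto
    also have "\<dots> \<le> d w" unfolding d_def by simp
    finally show ?thesis .
  qed
  have "inj_on d V"
  proof (rule inj_onI)
    fix x y assume xy: "x \<in> V" "y \<in> V" "d x = d y"
    have "f x = d x mod N" "f y = d y mod N" unfolding d_def using fl xy by auto
    then have "f x = f y" using xy(3) by simp
    then show "x = y" by (rule inj_onD[OF f(2) _ xy(1,2)])
  qed
  moreover have "A = prio d"
  proof (rule set_eqI, clarify)
    fix x y
    show "(x, y) \<in> A \<longleftrightarrow> (x, y) \<in> prio d"
    proof
      assume xy: "(x, y) \<in> A"
      have "d x \<le> d w" if "w \<in> P x y" for w
        using ao_path[OF A xy that] dl[of x w] by (cases "x = w") auto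
      then show "(x, y) \<in> prio d" using ao_in[OF A xy] unfolding prio_def by blast
    next
      assume xy: "(x, y) \<in> prio d"
      then have V: "x \<in> V" "y \<in> V" and mn: "\<And>w. w \<in> P x y \<Longrightarrow> d x \<le> d w" unfolding prio_def by auto
      obtain z where z: "z \<in> P x y" "(z, x) \<in> A" "(z, y) \<in> A" using ao_top[OF A V] by metis
      have "z = x" using dl[OF z(2)] mn[OF z(1)] by fastforce
      then show "(x, y) \<in> A" using z by simp
    qed
  qed
  ultimately show ?thesis by (rule that)
qed

section \<open>Search trees correspond to ancestor orders\<close>

definition comp :: "'a set \<Rightarrow> 'a \<Rightarrow> 'a set" where
  "comp S x = {y \<in> S. P x y \<subseteq> S}"

lemma components_eq:
  assumes "S \<subseteq> V"
  shows "components E S = comp S ` S"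
proof -
  have "(E \<inter> S \<times> S)\<^sup>* `` {x} = comp S x" if x: "x \<in> S" for x
  proof -
    have "y \<in> S" if "(x, y) \<in> (E \<inter> S \<times> S)\<^sup>*" for y
      using that x by (induction) auto
    then show ?thesis using connected_iff[OF assms x] unfolding comp_def by blast
  qed
  then show ?thesis unfolding components_def quotient_def by auto
qed

lemma comp_self: "x \<in> S \<Longrightarrow> x \<in> comp S x"
  unfolding comp_def using path_self by auto

lemma comp_eq:
  assumes "y \<in> comp S x"
  shows "comp S y = comp S x"
proof -
  have "P x z \<subseteq> S \<longleftrightarrow> P y z \<subseteq> S" for z
    using assms path_triangle[of x z y] path_triangle[of y z x] path_sym[of y x] unfolding comp_def by blast
  then show ?thesis unfolding comp_def by blast
qed

lemma comp_convex:
  assumes "a \<in> comp S x" "b \<in> comp S x"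
  shows "P a b \<subseteq> comp S x"
proof
  fix w assume w: "w \<in> P a b"
  have ab: "P a b \<subseteq> S" using assms comp_eq[OF assms(1)] unfolding comp_def by blast
  then have "w \<in> comp S a" using w path_sub[OF w] unfolding comp_def by blast
  then show "w \<in> comp S x" using comp_eq[OF assms(1)] by simp
qed

definition convex :: "'a set \<Rightarrow> bool" where
  "convex S \<longleftrightarrow> S \<subseteq> V \<and> (\<forall>x\<in>S. \<forall>y\<in>S. P x y \<subseteq> S)"

text \<open>The order consists of the root above everything and the orders of the components. A path
  between two vertices either contains \<open>r\<close>, which is then their common ancestor, or
  stays inside one component. The components of \<open>S - {r}\<close> inherit convexity, which lets
  the induction go on.\<close>

lemma search_tree_imp_ao:
  assumes "search_tree_rooted E S r T" "convex S"
  shows "\<exists>A. anc_order S A \<and> T = hasse A \<and> r \<in> S \<and> (\<forall>y\<in>S. (r, y) \<in> A)"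
  using assms
proof (induction rule: search_tree_rooted.induct)
  case (1 r S \<rho> \<tau>)
  let ?S = "S - {r}"
  let ?K = "components E ?S"
  have SV: "?S \<subseteq> V" using "1.prems" unfolding convex_def by auto
  note K = components_eq[OF SV]
  have Kd: "C = comp ?S x" if "C \<in> ?K" "x \<in> C" for C x
    using that comp_eq unfolding K by auto
  have Ks: "C \<subseteq> ?S" if "C \<in> ?K" for C
    using that unfolding K comp_def by auto
  have Kc: "convex C" if C: "C \<in> ?K" for C
  proof -
    obtain x where "C = comp ?S x" using C unfolding K by auto
    then show ?thesis
      using Ks[OF C] SV comp_convex[of _ ?S x] unfolding convex_def by auto
  qed
  have "\<forall>C\<in>?K. \<exists>A. anc_order C A \<and> \<tau> C = hasse A \<and> \<rho> C \<in> C \<and> (\<forall>y\<in>C. (\<rho> C, y) \<in> A)"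
    using "1.IH" Kc by blast
  then obtain F where F: "\<And>C. C \<in> ?K \<Longrightarrow> anc_order C (F C)" "\<And>C. C \<in> ?K \<Longrightarrow> \<tau> C = hasse (F C)"
    "\<And>C. C \<in> ?K \<Longrightarrow> \<rho> C \<in> C" "\<And>C y. C \<in> ?K \<Longrightarrow> y \<in> C \<Longrightarrow> (\<rho> C, y) \<in> F C"
    by metis
  define A where "A = {r} \<times> S \<union> (\<Union>C\<in>?K. F C)"
  have FA: "(x, y) \<in> F C" if h: "(x, y) \<in> A" "x \<in> C" "C \<in> ?K" for x y C
  proof -
    obtain C' where C': "C' \<in> ?K" "(x, y) \<in> F C'" using h Ks unfolding A_def by blast
    have "x \<in> C'" using ao_in[OF F(1)[OF C'(1)] C'(2)] by blast
    then have "C' = C" using Kd[OF C'(1), of x] Kd[OF h(3,2)] by simp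
    then show ?thesis using C' by simp
  qed
  have Acase: "x = r \<and> y \<in> S \<or> (\<exists>C\<in>?K. (x, y) \<in> F C \<and> x \<in> C \<and> y \<in> C)" if "(x, y) \<in> A" for x y
    using that ao_in[OF F(1)] unfolding A_def by blast
  have Kex: "\<exists>C\<in>?K. x \<in> C" if "x \<in> S" "x \<noteq> r" for x
    using that comp_self[of x ?S] unfolding K by blast
  have sym: "(r, x) \<notin> F C" "(x, r) \<notin> F C" if "C \<in> ?K" for x C
    using that Ks ao_in[OF F(1)] by blast+
  have rx: "x = r" if "(x, r) \<in> A" for x
    using that sym unfolding A_def by blast
  have ao: "anc_order S A"
    unfolding anc_order_def
  proof (intro conjI ballI allI impI)
    show "A \<subseteq> S \<times> S" using Acase Ks "1.hyps"(1) by fast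
    show "(x, x) \<in> A" if xS: "x \<in> S" for x
    proof (cases "x = r")
      case True then show ?thesis using xS unfolding A_def by blast
    next
      case False
      then obtain C where "C \<in> ?K" "x \<in> C" using Kex[OF xS] by blast
      then show ?thesis using ao_refl[OF F(1)] unfolding A_def by blast
    qed
    show "antisym A"
    proof (rule antisymI)
      fix x y assume xy: "(x, y) \<in> A" "(y, x) \<in> A"
      show "x = y"
      proof (cases "x = r")
        case True then show ?thesis using rx xy by blast
      next
        case False
        then obtain C where "C \<in> ?K" "(x, y) \<in> F C" "x \<in> C" "y \<in> C" using Acase[OF xy(1)] by blast
        then show ?thesis using FA[OF xy(2), of C] ao_antisym[OF F(1)] by blast
      qed
    qed
    show "trans A"
    proof (rule transI)
      fix x y z assume xy: "(x, y) \<in> A" "(y, z) \<in> A"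
      show "(x, z) \<in> A"
      proof (cases "x = r")
        case True
        then show ?thesis using Acase[OF xy(2)] Ks unfolding A_def by blast
      next
        case False
        then obtain C where C: "C \<in> ?K" "(x, y) \<in> F C" "x \<in> C" "y \<in> C" using Acase[OF xy(1)] by blast
        then have "(x, z) \<in> F C" using FA[OF xy(2), of C] ao_trans[OF F(1)] by blast
        then show ?thesis using C(1) unfolding A_def by blast
      qed
    qed
    fix a x y assume ax: "(a, x) \<in> A" and ay: "(a, y) \<in> A"
    show "P x y \<subseteq> A `` {a}"
    proof (cases "a = r")
      case True
      have "x \<in> S" "y \<in> S" using Acase[OF ax] Acase[OF ay] Ks by blast+
      then have "P x y \<subseteq> S" using "1.prems" unfolding convex_def by blast
      then show ?thesis using True unfolding A_def by blast
    next
      case False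
      then obtain C where C: "C \<in> ?K" "(a, x) \<in> F C" "a \<in> C" using Acase[OF ax] by blast
      have "(a, y) \<in> F C" using FA[OF ay C(3,1)] .
      then have "(a, w) \<in> F C" if "w \<in> P x y" for w using ao_convex[OF F(1)[OF C(1)] C(2) _ that] by blast
      then show ?thesis using C(1) unfolding A_def by blast
    qed
  next
    fix x y assume xy: "x \<in> S" "y \<in> S"
    show "\<exists>z\<in>P x y. (z, x) \<in> A \<and> (z, y) \<in> A"
    proof (cases "r \<in> P x y")
      case True then show ?thesis using xy unfolding A_def by blast
    next
      case False
      have xr: "x \<noteq> r" using False path_start[of x y] by blast
      have yr: "y \<noteq> r" using False path_end[of y x] by blast
      have "P x y \<subseteq> ?S" using "1.prems" xy False unfolding convex_def by blast
      then have y: "y \<in> comp ?S x" using xy yr unfolding comp_def by blast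
      have x: "x \<in> comp ?S x" using xy xr comp_self[of x ?S] by blast
      have C: "comp ?S x \<in> ?K" using xy xr unfolding K by blast
      obtain z where "z \<in> P x y" "(z, x) \<in> F (comp ?S x)" "(z, y) \<in> F (comp ?S x)"
        using ao_top[OF F(1)[OF C] x y] by metis
      then show ?thesis using C unfolding A_def by blast
    qed
  qed
  have "hasse A = (\<Union>C\<in>?K. insert (r, \<rho> C) (\<tau> C))"
  proof (rule set_eqI, clarify)
    fix x y
    show "(x, y) \<in> hasse A \<longleftrightarrow> (x, y) \<in> (\<Union>C\<in>?K. insert (r, \<rho> C) (\<tau> C))"
    proof
      assume h: "(x, y) \<in> hasse A"
      then have xy: "(x, y) \<in> A" "x \<noteq> y" and n: "\<And>z. (z, y) \<in> A \<Longrightarrow> z \<noteq> y \<Longrightarrow> (z, x) \<in> A"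
        unfolding hasse_iff[OF ao] by blast+
      show "(x, y) \<in> (\<Union>C\<in>?K. insert (r, \<rho> C) (\<tau> C))"
      proof (cases "x = r")
        case True
        then have "y \<in> S" "y \<noteq> r" using Acase[OF xy(1)] xy(2) Ks by blast+
        then obtain C where C: "C \<in> ?K" "y \<in> C" using Kex by blast
        have "(\<rho> C, y) \<in> A" using F(4)[OF C] C(1) unfolding A_def by blast
        then have "y = \<rho> C" using n[of "\<rho> C"] rx[of "\<rho> C"] True F(3)[OF C(1)] Ks[OF C(1)] by blast
        then show ?thesis using C True by blast
      next
        case False
        then obtain C where C: "C \<in> ?K" "(x, y) \<in> F C" "x \<in> C" "y \<in> C" using Acase[OF xy(1)] by blast
        have "(z, x) \<in> F C" if "(z, y) \<in> F C" "z \<noteq> y" for z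
        proof -
          have "(z, y) \<in> A" using C(1) that unfolding A_def by blast
          then show ?thesis using n[of z] that FA C(1) ao_in[OF F(1)[OF C(1)]] by blast
        qed
        then have "(x, y) \<in> hasse (F C)" unfolding hasse_iff[OF F(1)[OF C(1)]] using C(2) xy(2) by blast
        then show ?thesis using F(2)[OF C(1)] C(1) by blast
      qed
    next
      assume "(x, y) \<in> (\<Union>C\<in>?K. insert (r, \<rho> C) (\<tau> C))"
      then obtain C where C: "C \<in> ?K" and xy: "(x, y) = (r, \<rho> C) \<or> (x, y) \<in> hasse (F C)"
        using F(2) by blast
      from xy show "(x, y) \<in> hasse A"
      proof
        assume e: "(x, y) = (r, \<rho> C)"
        have y: "y \<in> C" "y \<in> S" "y \<noteq> r" using e F(3)[OF C] Ks[OF C] by blast+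
        have "(z, r) \<in> A" if z: "(z, y) \<in> A" "z \<noteq> y" for z
        proof (rule ccontr)
          assume "(z, r) \<notin> A"
          then have "z \<noteq> r" using "1.hyps" unfolding A_def by blast
          then obtain C' where C': "C' \<in> ?K" "(z, y) \<in> F C'" "z \<in> C'" "y \<in> C'" using Acase[OF z(1)] by blast
          then have "C' = C" using Kd[of C' y] Kd[of C y] C y by simp
          then have "(y, z) \<in> F C" "(z, y) \<in> F C" using F(4)[OF C, of z] C' e by auto
          then show False using ao_antisym[OF F(1)[OF C]] z(2) by blast
        qed
        then show ?thesis unfolding hasse_iff[OF ao] using e y unfolding A_def by blast
      next
        assume h: "(x, y) \<in> hasse (F C)"
        then have h1: "(x, y) \<in> F C" "x \<noteq> y" "\<And>z. (z, y) \<in> F C \<Longrightarrow> z \<noteq> y \<Longrightarrow> (z, x) \<in> F C"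
          unfolding hasse_iff[OF F(1)[OF C]] by blast+
        have xyC: "x \<in> C" "y \<in> C" using ao_in[OF F(1)[OF C] h1(1)] by blast+
        have "(z, x) \<in> A" if z: "(z, y) \<in> A" "z \<noteq> y" for z
        proof (cases "z = r")
          case True then show ?thesis using xyC Ks[OF C] unfolding A_def by blast
        next
          case False
          then obtain C' where C': "C' \<in> ?K" "(z, y) \<in> F C'" "z \<in> C'" "y \<in> C'" using Acase[OF z(1)] by blast
          then have "C' = C" using Kd[of C' y] Kd[of C y] C xyC by simp
          then show ?thesis using h1(3)[of z] C' z unfolding A_def by blast
        qed
        then show ?thesis unfolding hasse_iff[OF ao] using h1(1,2) C unfolding A_def by blast
      qed
    qed
  qed
  then show ?case using ao "1.hyps"(1) unfolding A_def by blast
qed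

text \<open>A vertex with the most descendants is the root: a common ancestor of it and any other
  vertex has at least as many descendants, hence is that same vertex.\<close>

lemma ao_root:
  assumes A: "anc_order S A" and S: "finite S" "S \<noteq> {}"
  obtains r where "r \<in> S" "\<forall>y\<in>S. (r, y) \<in> A"
proof -
  have "Max ((\<lambda>x. card (A `` {x})) ` S) \<in> (\<lambda>x. card (A `` {x})) ` S" using S by (intro Max_in) auto
  then obtain r where r: "r \<in> S" "card (A `` {r}) = Max ((\<lambda>x. card (A `` {x})) ` S)" by auto
  have mx: "card (A `` {x}) \<le> card (A `` {r})" if "x \<in> S" for x using that S r(2) by simp
  have "(r, y) \<in> A" if y: "y \<in> S" for y
  proof -
    obtain z where z: "(z, r) \<in> A" "(z, y) \<in> A" using ao_top[OF A r(1) y] by metis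
    have "z = r"
    proof (rule ccontr)
      assume "z \<noteq> r"
      have "A `` {r} \<subseteq> A `` {z}" using ao_trans[OF A z(1)] by auto
      moreover have "(z, z) \<in> A" using ao_refl[OF A] ao_in[OF A z(1)] by simp
      moreover have "(r, z) \<notin> A" using ao_antisym[OF A z(1)] \<open>z \<noteq> r\<close> by auto
      ultimately have "A `` {r} \<subset> A `` {z}" by auto
      moreover have "finite (A `` {z})" by (rule ao_finite(2)[OF A S(1)])
      ultimately have "card (A `` {r}) < card (A `` {z})" by (rule psubset_card_mono[rotated])
      then show False using mx[of z] ao_in[OF A z(1)] by simp
    qed
    then show ?thesis using z by simp
  qed
  then show ?thesis using that r(1) by blast
qed

text \<open>Restricted to a component of \<open>S - {r}\<close>, the order is again an ancestor
  order because the component is closed downwards: a path through \<open>r\<close> from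
  \<open>x\<close> to a descendant would make \<open>x\<close> an ancestor of the root.\<close>

lemma ao_imp_search_tree:
  assumes "anc_order S A" "S \<subseteq> V" "r \<in> S" "\<forall>y\<in>S. (r, y) \<in> A"
  shows "search_tree_rooted E S r (hasse A)"
  using assms
proof (induction "card S" arbitrary: S A r rule: less_induct)
  case less
  note A = less.prems(1)
  let ?S = "S - {r}"
  let ?K = "components E ?S"
  have finS: "finite S" using less.prems(2) finite_verts by (rule finite_subset)
  have SV: "?S \<subseteq> V" using less.prems by auto
  note K = components_eq[OF SV]
  have Ks: "C \<subseteq> ?S" if "C \<in> ?K" for C using that unfolding K comp_def by auto
  have Kcl: "y \<in> C" if C: "C \<in> ?K" "x \<in> C" and xy: "(x, y) \<in> A" for C x y
  proof -
    have "r \<notin> P x y"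
    proof
      assume "r \<in> P x y"
      then have "(x, r) \<in> A" using ao_path[OF A xy] by blast
      then have "x = r" using ao_antisym[OF A] less.prems(4) ao_in[OF A] by blast
      then show False using C Ks by blast
    qed
    moreover have "P x y \<subseteq> S" using ao_path[OF A xy] ao_in[OF A] by blast
    ultimately have "P x y \<subseteq> ?S" by blast
    moreover have "y \<in> P x y" by (rule path_end)
    ultimately have "y \<in> comp ?S x" unfolding comp_def by blast
    then show ?thesis using C comp_eq unfolding K by auto
  qed
  define R where "R C = A \<inter> C \<times> C" for C
  have Rao: "anc_order C (R C)" if C: "C \<in> ?K" for C
    unfolding anc_order_def
  proof (intro conjI ballI allI impI)
    show "R C \<subseteq> C \<times> C" unfolding R_def by auto
    show "(x, x) \<in> R C" if "x \<in> C" for x using that ao_refl[OF A] Ks[OF C] unfolding R_def by blast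
    show "antisym (R C)" unfolding R_def using ao_antisym[OF A] by (auto intro!: antisymI)
    show "trans (R C)" unfolding R_def using ao_trans[OF A] by (auto intro!: transI)
    fix a x y assume ax: "(a, x) \<in> R C" and ay: "(a, y) \<in> R C"
    then have "P x y \<subseteq> A `` {a}" using ao_convex[OF A] unfolding R_def by blast
    then show "P x y \<subseteq> R C `` {a}" using ax Kcl[OF C] unfolding R_def by blast
  next
    fix x y assume xy: "x \<in> C" "y \<in> C"
    obtain z where z: "z \<in> P x y" "(z, x) \<in> A" "(z, y) \<in> A" using ao_top[OF A] xy Ks[OF C] by blast
    have "P x y \<subseteq> C" using comp_convex xy C unfolding K by blast
    then show "\<exists>z\<in>P x y. (z, x) \<in> R C \<and> (z, y) \<in> R C" using z xy unfolding R_def by blast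
  qed
  have Kex: "\<exists>C\<in>?K. x \<in> C" if "x \<in> ?S" for x
    using that comp_self[of x ?S] unfolding K by blast
  have Kd: "C = comp ?S x" if "C \<in> ?K" "x \<in> C" for C x
    using that comp_eq unfolding K by auto
  have Kx: "\<exists>x. x \<in> C" if "C \<in> ?K" for C
    using that comp_self[of _ ?S] unfolding K by auto
  have Kne: "C \<noteq> {}" if "C \<in> ?K" for C using Kx[OF that] by blast
  have "\<forall>C\<in>?K. \<exists>q. q \<in> C \<and> (\<forall>y\<in>C. (q, y) \<in> R C)"
    using ao_root[OF Rao] Kne finite_subset[OF Ks] finS by (metis finite_Diff)
  then obtain \<rho> where \<rho>: "\<And>C. C \<in> ?K \<Longrightarrow> \<rho> C \<in> C" "\<And>C y. C \<in> ?K \<Longrightarrow> y \<in> C \<Longrightarrow> (\<rho> C, y) \<in> R C"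
    by metis
  have IH: "search_tree_rooted E C (\<rho> C) (hasse (R C))" if C: "C \<in> ?K" for C
  proof (rule less.hyps)
    show "card C < card S" using Ks[OF C] less.prems(3) finS by (intro psubset_card_mono) auto
    show "C \<subseteq> V" using Ks[OF C] SV by blast
  qed (use Rao[OF C] \<rho> C in blast)+
  have "hasse A = (\<Union>C\<in>?K. insert (r, \<rho> C) (hasse (R C)))"
  proof (rule set_eqI, clarify)
    fix x y
    show "(x, y) \<in> hasse A \<longleftrightarrow> (x, y) \<in> (\<Union>C\<in>?K. insert (r, \<rho> C) (hasse (R C)))"
    proof
      assume h: "(x, y) \<in> hasse A"
      then have xy: "(x, y) \<in> A" "x \<noteq> y" and n: "\<And>z. (z, y) \<in> A \<Longrightarrow> z \<noteq> y \<Longrightarrow> (z, x) \<in> A"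
        unfolding hasse_iff[OF A] by blast+
      have xS: "x \<in> S" "y \<in> S" using ao_in[OF A xy(1)] by blast+
      show "(x, y) \<in> (\<Union>C\<in>?K. insert (r, \<rho> C) (hasse (R C)))"
      proof (cases "x = r")
        case True
        then have y: "y \<in> ?S" using xS xy by blast
        then obtain C where C: "C \<in> ?K" "y \<in> C" using Kex[of y] by blast
        have "(\<rho> C, y) \<in> A" using \<rho>(2)[OF C] unfolding R_def by blast
        then have "\<rho> C = y" using n[of "\<rho> C"] True \<rho>(1)[OF C(1)] Ks[OF C(1)] ao_antisym[OF A] less.prems(4) by blast
        then show ?thesis using C True by blast
      next
        case False
        then have "x \<in> ?S" using xS by blast
        then obtain C where C: "C \<in> ?K" "x \<in> C" using Kex[of x] by blast
        have y: "y \<in> C" using Kcl[OF C xy(1)] .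
        have "(x, y) \<in> hasse (R C)" unfolding hasse_iff[OF Rao[OF C(1)]] using xy n C y unfolding R_def by blast
        then show ?thesis using C by blast
      qed
    next
      assume "(x, y) \<in> (\<Union>C\<in>?K. insert (r, \<rho> C) (hasse (R C)))"
      then obtain C where C: "C \<in> ?K" and xy: "(x, y) = (r, \<rho> C) \<or> (x, y) \<in> hasse (R C)" by blast
      from xy show "(x, y) \<in> hasse A"
      proof
        assume e: "(x, y) = (r, \<rho> C)"
        have y: "y \<in> C" "y \<in> S" "y \<noteq> r" using e \<rho>(1)[OF C] Ks[OF C] by blast+
        have "(z, r) \<in> A" if z: "(z, y) \<in> A" "z \<noteq> y" for z
        proof (cases "z = r")
          case True then show ?thesis using ao_refl[OF A] less.prems(3) by blast
        next
          case False
          then have zS: "z \<in> ?S" using ao_in[OF A z(1)] by blast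
          then obtain C' where C': "C' \<in> ?K" "z \<in> C'" using Kex[of z] by blast
          then have y': "y \<in> C'" using Kcl z(1) by blast
          then have "C' = C" using Kd[OF C, of y] Kd[OF C'(1) y'] y by simp
          then have "(y, z) \<in> A" using \<rho>(2)[OF C, of z] C' e unfolding R_def by blast
          then show ?thesis using ao_antisym[OF A z(1)] z(2) by blast
        qed
        then show ?thesis unfolding hasse_iff[OF A] using e y less.prems(4) by blast
      next
        assume h: "(x, y) \<in> hasse (R C)"
        then have h1: "(x, y) \<in> R C" "x \<noteq> y" "\<And>z. (z, y) \<in> R C \<Longrightarrow> z \<noteq> y \<Longrightarrow> (z, x) \<in> R C"
          unfolding hasse_iff[OF Rao[OF C]] by blast+
        have xyC: "x \<in> C" "y \<in> C" using ao_in[OF Rao[OF C] h1(1)] by blast+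
        have "(z, x) \<in> A" if z: "(z, y) \<in> A" "z \<noteq> y" for z
        proof (cases "z = r")
          case True then show ?thesis using xyC Ks[OF C] less.prems(4) by blast
        next
          case False
          then have zS: "z \<in> ?S" using ao_in[OF A z(1)] by blast
          then obtain C' where C': "C' \<in> ?K" "z \<in> C'" using Kex[of z] by blast
          then have y': "y \<in> C'" using Kcl z(1) by blast
          then have "C' = C" using Kd[OF C'(1) y'] Kd[OF C xyC(2)] by simp
          then show ?thesis using h1(3)[of z] C' z xyC unfolding R_def by blast
        qed
        then show ?thesis unfolding hasse_iff[OF A] using h1(1,2) unfolding R_def by blast
      qed
    qed
  qed
  then show ?case using search_tree_rooted.intros[OF less.prems(3), of E \<rho> "\<lambda>C. hasse (R C)"] IH by simp
qed

lemma search_trees_eq: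
  assumes "V \<noteq> {}"
  shows "search_trees V E = hasse ` {A. anc_order V A}"
proof -
  have c: "convex V" unfolding convex_def using path_in by blast
  show ?thesis
  proof (intro subset_antisym subsetI)
    fix T assume "T \<in> search_trees V E"
    then show "T \<in> hasse ` {A. anc_order V A}"
      unfolding search_trees_def using search_tree_imp_ao[OF _ c] by blast
  next
    fix T assume "T \<in> hasse ` {A. anc_order V A}"
    then obtain A where A: "anc_order V A" "T = hasse A" by blast
    obtain r where "r \<in> V" "\<forall>y\<in>V. (r, y) \<in> A" using ao_root[OF A(1) finite_verts assms] by metis
    then show "T \<in> search_trees V E"
      unfolding search_trees_def using ao_imp_search_tree[OF A(1)] A(2) by blast
  qed
qed

end

section \<open>Rotations\<close>

text \<open>In terms of priorities, a rotation moves \<open>c\<close> directly in front of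
  \<open>p\<close>. Doubling all ranks makes room for it.\<close>

definition rank_rotated :: "('a \<Rightarrow> nat) \<Rightarrow> 'a \<Rightarrow> 'a \<Rightarrow> 'a \<Rightarrow> nat" where
  "rank_rotated d p c = (\<lambda>x. if x = c then 2 * d p else 2 * d x + 1)"

context tree_paths
begin

text \<open>The intended effect of \<open>rotate_edge\<close> on ancestors: the only pairs lost have
  \<open>p\<close> on top and the only pairs gained have \<open>c\<close> on top. Later arguments
  about rotations use this form rather than tree edges.\<close>

definition rotated :: "'a rel \<Rightarrow> 'a \<Rightarrow> 'a \<Rightarrow> 'a rel" where
  "rotated A p c = {(x, y). (x \<noteq> p \<and> (x, y) \<in> A) \<or> (x = p \<and> (p, y) \<in> A \<and> c \<notin> P p y) \<or>
     (x = c \<and> (p, y) \<in> A)}"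

lemma rotated_iff:
  "(x, y) \<in> rotated A p c \<longleftrightarrow> (x \<noteq> p \<and> (x, y) \<in> A) \<or> (x = p \<and> (p, y) \<in> A \<and> c \<notin> P p y) \<or>
     (x = c \<and> (p, y) \<in> A)"
  unfolding rotated_def by auto

text \<open>Among its ancestors, \<open>c\<close> overtakes only \<open>p\<close>: all others are
  ancestors of \<open>p\<close> and have smaller rank. As a priority order, the rotated relation is
  then known to be an ancestor order.\<close>

lemma prio_rotated:
  assumes inj: "inj_on d V" and pc: "(p, c) \<in> hasse (prio d)"
  shows "rotated (prio d) p c = prio (rank_rotated d p c)"
proof (rule set_eqI, clarify)
  note A = prio_ao[OF inj]
  have pcA: "(p, c) \<in> prio d" "p \<noteq> c" and par: "\<And>z. (z, c) \<in> prio d \<Longrightarrow> z \<noteq> c \<Longrightarrow> (z, p) \<in> prio d"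
    using pc unfolding hasse_iff[OF A] by blast+
  have pV: "p \<in> V" "c \<in> V" using ao_in[OF A pcA(1)] by blast+
  have dlt: "d x < d y" if xy: "(x, y) \<in> prio d" "x \<noteq> y" for x y
  proof -
    have "x \<in> V" "y \<in> V" "d x \<le> d y" using xy path_end[of y x] unfolding prio_def by auto
    moreover have "d x \<noteq> d y" using inj_onD[OF inj _ \<open>x \<in> V\<close> \<open>y \<in> V\<close>] xy(2) by blast
    ultimately show ?thesis by simp
  qed
  let ?e = "rank_rotated d p c"
  have ec: "?e c = 2 * d p" unfolding rank_rotated_def by simp
  have eo: "?e x = 2 * d x + 1" if "x \<noteq> c" for x using that unfolding rank_rotated_def by simp
  fix x y
  show "(x, y) \<in> rotated (prio d) p c \<longleftrightarrow> (x, y) \<in> prio ?e"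
  proof (cases "x \<in> V \<and> y \<in> V")
    case False
    then show ?thesis using ao_in[OF A] pV unfolding rotated_iff prio_def by blast
  next
    case True
    then have V: "x \<in> V" "y \<in> V" by auto
    consider "x = c" | "x = p" | "x \<noteq> c" "x \<noteq> p" by blast
    then show ?thesis
    proof cases
      case 1
      have "(p, y) \<in> prio d \<longleftrightarrow> (\<forall>w\<in>P c y. ?e c \<le> ?e w)"
      proof
        assume py: "(p, y) \<in> prio d"
        show "\<forall>w\<in>P c y. ?e c \<le> ?e w"
        proof
          fix w assume "w \<in> P c y"
          then have "(p, w) \<in> prio d" using ao_convex[OF A pcA(1) py] by blast
          then have "d p \<le> d w" using path_end[of w p] unfolding prio_def by blast
          then show "?e c \<le> ?e w" using ec eo[of w] by (cases "w = c") auto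
        qed
      next
        assume le: "\<forall>w\<in>P c y. ?e c \<le> ?e w"
        obtain t where t: "t \<in> P c y" "(t, c) \<in> prio d" "(t, y) \<in> prio d"
          using ao_top[OF A pV(2) V(2)] by blast
        show "(p, y) \<in> prio d"
        proof (cases "t = c")
          case True then show ?thesis using ao_trans[OF A pcA(1)] t(3) by blast
        next
          case False
          then have tp: "(t, p) \<in> prio d" using par t(2) by blast
          have "2 * d p \<le> 2 * d t + 1" using le t(1) ec eo[OF False] by fastforce
          then have "t = p" using dlt[OF tp] by fastforce
          then show ?thesis using t(3) by simp
        qed
      qed
      moreover have "(c, y) \<in> prio d \<Longrightarrow> (p, y) \<in> prio d" using ao_trans[OF A pcA(1)] by blast
      moreover have "(c, y) \<in> prio ?e \<longleftrightarrow> (\<forall>w\<in>P c y. ?e c \<le> ?e w)"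
        using V pV unfolding prio_def by blast
      ultimately show ?thesis unfolding rotated_iff 1 using pcA(2) by blast
    next
      case 2
      have "(p, y) \<in> prio ?e \<longleftrightarrow> (p, y) \<in> prio d \<and> c \<notin> P p y"
      proof
        assume "(p, y) \<in> prio ?e"
        then have le: "\<And>w. w \<in> P p y \<Longrightarrow> ?e p \<le> ?e w" unfolding prio_def by blast
        have c: "c \<notin> P p y" using le[of c] ec eo[of p] pcA(2) by auto
        have "d p \<le> d w" if w: "w \<in> P p y" for w
        proof -
          have "w \<noteq> c" using c w by blast
          then show ?thesis using le[OF w] eo[of w] eo[of p] pcA(2) by auto
        qed
        then show "(p, y) \<in> prio d \<and> c \<notin> P p y" using V pV c unfolding prio_def by blast
      next
        assume h: "(p, y) \<in> prio d \<and> c \<notin> P p y"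
        have "?e p \<le> ?e w" if w: "w \<in> P p y" for w
        proof -
          have "w \<noteq> c" using h w by blast
          then show ?thesis using eo[of w] eo[of p] pcA(2) h w unfolding prio_def by auto
        qed
        then show "(p, y) \<in> prio ?e" using V pV unfolding prio_def by blast
      qed
      then show ?thesis unfolding rotated_iff 2 using pcA(2) by blast
    next
      case 3
      have "(x, y) \<in> prio ?e \<longleftrightarrow> (x, y) \<in> prio d"
      proof
        assume h: "(x, y) \<in> prio ?e"
        then have le: "?e x \<le> ?e w" if "w \<in> P x y" for w using that unfolding prio_def by blast
        have "d x \<le> d w" if w: "w \<in> P x y" for w
        proof (cases "w = c")
          case True
          have "d p < d c" using dlt[OF pcA] .
          then show ?thesis using le[OF w] True ec eo[of x] 3(1) by auto
        next
          case False
          then show ?thesis using le[OF w] eo[of w] eo[of x] 3(1) by auto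
        qed
        then show "(x, y) \<in> prio d" using V unfolding prio_def by blast
      next
        assume h: "(x, y) \<in> prio d"
        have "?e x \<le> ?e w" if w: "w \<in> P x y" for w
        proof (cases "w = c")
          case True
          have "(x, c) \<in> prio d" using ao_path[OF A h] w True by blast
          then have "(x, p) \<in> prio d" using par 3(1) by blast
          then have "d x < d p" using dlt 3(2) by blast
          then show ?thesis using True ec eo[of x] 3(1) by auto
        next
          case False
          then show ?thesis using h w eo[of w] eo[of x] 3(1) unfolding prio_def by auto
        qed
        then show "(x, y) \<in> prio ?e" using V unfolding prio_def by blast
      qed
      then show ?thesis unfolding rotated_iff using 3 by blast
    qed
  qed
qed

lemma rotated_ao:
  assumes A: "anc_order V A" and pc: "(p, c) \<in> hasse A"
  shows "anc_order V (rotated A p c)"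
proof -
  obtain d :: "'a \<Rightarrow> nat" where d: "inj_on d V" "A = prio d" using ao_is_prio[OF A] by metis
  have "inj_on (rank_rotated d p c) V"
  proof (rule inj_onI)
    fix x y assume xy: "x \<in> V" "y \<in> V" "rank_rotated d p c x = rank_rotated d p c y"
    have "Suc (2 * d y) \<noteq> 2 * d p" "2 * d p \<noteq> Suc (2 * d y)" for y by presburger+
    then have "x = y \<or> d x = d y" using xy(3) unfolding rank_rotated_def by (auto split: if_splits)
    then show "x = y" using inj_onD[OF d(1) _ xy(1,2)] by blast
  qed
  then show ?thesis using prio_ao prio_rotated[OF d(1)] pc d(2) by metis
qed

text \<open>Parents are unique. Hence it suffices that every edge of the claimed set is a parent
  edge of the new order, and that every vertex with a parent in the new order has an incoming edge
  in the set.\<close>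

lemma hasse_rotated:
  assumes A: "anc_order V A" and pc: "(p, c) \<in> hasse A"
  shows "hasse (rotated A p c) =
    (hasse A - ((hasse A)\<inverse> `` {p} \<times> {p} \<union> {(p, c)} \<union> {c} \<times> {x. (c, x) \<in> hasse A \<and> c \<notin> P p x})) \<union>
    ((hasse A)\<inverse> `` {p} \<times> {c} \<union> {(c, p)} \<union> {p} \<times> {x. (c, x) \<in> hasse A \<and> c \<notin> P p x})"
    (is "hasse ?A' = ?R")
proof -
  note A' = rotated_ao[OF A pc]
  define X where "X = {x. (c, x) \<in> hasse A \<and> c \<notin> P p x}"
  note hA = hasse_iff[OF A] and hA' = hasse_iff[OF A']
  have pcA: "(p, c) \<in> A" "p \<noteq> c" and par: "\<And>z. (z, c) \<in> A \<Longrightarrow> z \<noteq> c \<Longrightarrow> (z, p) \<in> A"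
    using pc unfolding hA by blast+
  have pV: "p \<in> V" "c \<in> V" using ao_in[OF A pcA(1)] by blast+
  have cp: "(c, p) \<notin> A" using ao_antisym[OF A pcA(1)] pcA(2) by blast
  have cP: "c \<in> P p c" by (rule path_end)
  have pp: "(p, p) \<in> A" using ao_refl[OF A pV(1)] .
  have cPp: "c \<notin> P p p" using path_self[of p] pcA(2) by simp
  have up: "(x, y) \<in> A \<or> (x = c \<and> (p, y) \<in> A)" if "(x, y) \<in> ?A'" for x y
    using that unfolding rotated_iff by blast
  have child_c: "(c, p) \<in> hasse ?A'"
    unfolding hA'
  proof (intro conjI allI impI)
    show "(c, p) \<in> ?A'" unfolding rotated_iff using pp by blast
    show "c \<noteq> p" using pcA(2) by blast
    fix z assume z: "(z, p) \<in> ?A'" "z \<noteq> p"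
    show "(z, c) \<in> ?A'"
      using z ao_trans[OF A _ pcA(1), of z] pcA(1) unfolding rotated_iff by blast
  qed
  have child_q: "(q, c) \<in> hasse ?A'" if q: "(q, p) \<in> hasse A" for q
    unfolding hA'
  proof (intro conjI allI impI)
    have qp: "(q, p) \<in> A" "q \<noteq> p" "\<And>z. (z, p) \<in> A \<Longrightarrow> z \<noteq> p \<Longrightarrow> (z, q) \<in> A" using q unfolding hA by blast+
    show "(q, c) \<in> ?A'" unfolding rotated_iff using qp ao_trans[OF A qp(1) pcA(1)] by blast
    show "q \<noteq> c" using qp(1) cp by blast
    fix z assume z: "(z, c) \<in> ?A'" "z \<noteq> c"
    then have "z \<noteq> p" "(z, c) \<in> A" unfolding rotated_iff using cP by blast+
    then show "(z, q) \<in> ?A'" using par qp(3) z(2) unfolding rotated_iff by blast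
  qed
  have child_x: "(p, x) \<in> hasse ?A'" if x: "x \<in> X" for x
    unfolding hA'
  proof (intro conjI allI impI)
    have cx: "(c, x) \<in> A" "c \<noteq> x" "\<And>z. (z, x) \<in> A \<Longrightarrow> z \<noteq> x \<Longrightarrow> (z, c) \<in> A" and cPx: "c \<notin> P p x"
      using x unfolding X_def hA by blast+
    have px: "(p, x) \<in> A" using ao_trans[OF A pcA(1) cx(1)] .
    show "(p, x) \<in> ?A'" unfolding rotated_iff using px cPx by blast
    show "p \<noteq> x" using cx(1) cp by blast
    fix z assume z: "(z, x) \<in> ?A'" "z \<noteq> x"
    show "(z, p) \<in> ?A'"
    proof (cases "z = p \<or> z = c")
      case True then show ?thesis unfolding rotated_iff using pp cPp by blast
    next
      case False
      then have "(z, x) \<in> A" using up[OF z(1)] by blast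
      then have "(z, p) \<in> A" using cx(3) z(2) par False by blast
      then show ?thesis unfolding rotated_iff using False by blast
    qed
  qed
  have child_o: "(q, y) \<in> hasse ?A'" if q: "(q, y) \<in> hasse A" "y \<noteq> p" "y \<noteq> c" "y \<notin> X" for q y
    unfolding hA'
  proof (intro conjI allI impI)
    have qy: "(q, y) \<in> A" "q \<noteq> y" "\<And>z. (z, y) \<in> A \<Longrightarrow> z \<noteq> y \<Longrightarrow> (z, q) \<in> A" using q unfolding hA by blast+
    \<comment> \<open>A child \<open>y\<close> of \<open>p\<close> other than \<open>c\<close> does
      not lie behind \<open>c\<close>. Otherwise the top \<open>t\<close> of the path from
      \<open>c\<close> to \<open>y\<close> is above \<open>p\<close>, being a proper ancestor of
      \<open>c\<close>, and below \<open>p\<close>, being between \<open>p\<close> and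
      \<open>y\<close>. So \<open>t = p\<close>, but \<open>p\<close> is not between
      \<open>c\<close> and \<open>y\<close>.\<close>
    have cy: "c \<notin> P p y" if "q = p"
    proof
      assume "c \<in> P p y"
      then have "P c y \<subseteq> P p y" using path_sub[of c y p] path_sym[of y p] path_sym[of y c] by simp
      have "(c, y) \<notin> A" using qy(3)[of c] cp q(3) that by blast
      obtain t where t: "t \<in> P c y" "(t, c) \<in> A" "(t, y) \<in> A" using ao_top[OF A pV(2)] ao_in[OF A qy(1)] by blast
      have "t \<noteq> c" using t(3) \<open>(c, y) \<notin> A\<close> by blast
      then have tp: "(t, p) \<in> A" using par t(2) by blast
      have "(p, t) \<in> A" using ao_path[OF A] qy(1) that t(1) \<open>P c y \<subseteq> P p y\<close> by blast
      then have "t = p" using ao_antisym[OF A tp] by blast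
      then have "p \<in> P y c" using t(1) path_sym[of c y] by simp
      moreover have "c \<in> P y p" using \<open>c \<in> P p y\<close> path_sym[of p y] by simp
      ultimately show False using path_antisym[of p y c] pcA(2) by blast
    qed
    show qA: "(q, y) \<in> ?A'" unfolding rotated_iff using qy(1) cy by blast
    show "q \<noteq> y" by fact
    fix z assume z: "(z, y) \<in> ?A'" "z \<noteq> y"
    consider "z = p" | "z = c" "z \<noteq> p" | "z \<noteq> c" "z \<noteq> p" by blast
    then show "(z, q) \<in> ?A'"
    proof cases
      case 1
      have py: "(p, y) \<in> A" "c \<notin> P p y" using z(1) 1 pcA(2) unfolding rotated_iff by blast+
      have pq: "(p, q) \<in> A" using qy(3)[OF py(1)] q(2) by blast
      have qc: "q \<noteq> c" using q(1,4) py(2) unfolding X_def by blast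
      have "c \<notin> P p q"
      proof
        assume c: "c \<in> P p q"
        then have "c \<in> P y q" using path_triangle[of p q y] py(2) by blast
        then have "(q, c) \<in> A" using ao_path[OF A qy(1)] path_sym[of y q] by simp
        then have "(q, p) \<in> A" using par qc by blast
        then have "q = p" using ao_antisym[OF A pq] by simp
        then show False using c cPp by simp
      qed
      then show ?thesis using pq 1 unfolding rotated_iff by blast
    next
      case 2
      then have "(p, y) \<in> A" using z(1) ao_trans[OF A pcA(1), of y] unfolding rotated_iff by blast
      then have "(p, q) \<in> A" using qy(3) q(2) by blast
      then show ?thesis using 2 unfolding rotated_iff by blast
    next
      case 3
      then have "(z, y) \<in> A" using z(1) unfolding rotated_iff by blast
      then show ?thesis using qy(3) z(2) 3 unfolding rotated_iff by blast
    qed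
  qed
  have R: "?R = (hasse A - ((hasse A)\<inverse> `` {p} \<times> {p} \<union> {(p, c)} \<union> {c} \<times> X)) \<union>
    ((hasse A)\<inverse> `` {p} \<times> {c} \<union> {(c, p)} \<union> {p} \<times> X)" unfolding X_def by blast
  have sub: "?R \<subseteq> hasse ?A'"
  proof (rule subrelI, unfold R)
    fix x y assume "(x, y) \<in> (hasse A - ((hasse A)\<inverse> `` {p} \<times> {p} \<union> {(p, c)} \<union> {c} \<times> X)) \<union>
    ((hasse A)\<inverse> `` {p} \<times> {c} \<union> {(c, p)} \<union> {p} \<times> X)"
    then consider "(x, y) \<in> hasse A" "\<not> ((x, p) \<in> hasse A \<and> y = p)" "\<not> (x = p \<and> y = c)" "\<not> (x = c \<and> y \<in> X)"
      | "(x, p) \<in> hasse A" "y = c" | "x = c" "y = p" | "x = p" "y \<in> X" by blast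
    then show "(x, y) \<in> hasse ?A'"
    proof cases
      case 1
      have "y \<noteq> p" using 1 by blast
      moreover have "y \<noteq> c" using 1 hasse_unique[OF A _ pc] by blast
      moreover have "y \<notin> X" using 1 hasse_unique[OF A _ 1(1), of c] unfolding X_def by blast
      ultimately show ?thesis using child_o 1(1) by blast
    qed (use child_q child_c child_x in auto)
  qed
  have ex: "\<exists>x'. (x', y) \<in> ?R" if xy: "(x, y) \<in> hasse ?A'" for x y
  proof -
    have h: "(x, y) \<in> ?A'" "x \<noteq> y" using xy unfolding hA' by blast+
    consider "y = p" | "y = c" | "y \<noteq> p" "y \<noteq> c" by blast
    then show ?thesis
    proof cases
      case 1 then show ?thesis by blast
    next
      case 2
      then have "x \<noteq> p" "(x, c) \<in> A" using h unfolding rotated_iff using cP by blast+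
      then have "(x, p) \<in> A" using par h(2) 2 by blast
      then obtain q where "(q, p) \<in> hasse A" using hasse_parent_ex[OF A finite_verts _ \<open>x \<noteq> p\<close>] by blast
      then show ?thesis using 2 by blast
    next
      case 3
      have "\<exists>z. (z, y) \<in> A \<and> z \<noteq> y" using up[OF h(1)] h(2) 3 by blast
      then obtain q where q: "(q, y) \<in> hasse A" using hasse_parent_ex[OF A finite_verts] by blast
      show ?thesis
      proof (cases "q = c \<and> y \<in> X")
        case True then show ?thesis unfolding R by blast
      next
        case False then show ?thesis unfolding R using q 3 by blast
      qed
    qed
  qed
  have "hasse ?A' \<subseteq> ?R"
  proof (rule subrelI)
    fix x y assume xy: "(x, y) \<in> hasse ?A'"
    obtain x' where x': "(x', y) \<in> ?R" using ex[OF xy] by blast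
    then have "x' = x" using sub hasse_unique[OF A' _ xy] by blast
    then show "(x, y) \<in> ?R" using x' by simp
  qed
  then show ?thesis using sub by (rule subset_antisym)
qed

text \<open>\<open>rotate_edge\<close> decides by adjacency which children of \<open>c\<close> pass
  to \<open>p\<close>; in terms of paths they are the children \<open>x\<close> that
  \<open>p\<close> reaches without passing \<open>c\<close>. A neighbour of \<open>p\<close> below
  \<open>x\<close> yields such a path, and conversely the vertex next to \<open>p\<close> on such a
  path lies below \<open>x\<close>.\<close>

lemma rotate_edge_hasse:
  assumes A: "anc_order V A" and pc: "(p, c) \<in> hasse A"
  shows "rotate_edge E (hasse A) p c = hasse (rotated A p c)"
proof -
  note hA = hasse_iff[OF A]
  have pcA: "(p, c) \<in> A" "p \<noteq> c" and par: "\<And>z. (z, c) \<in> A \<Longrightarrow> z \<noteq> c \<Longrightarrow> (z, p) \<in> A"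
    using pc unfolding hA by blast+
  have pV: "p \<in> V" "c \<in> V" using ao_in[OF A pcA(1)] by blast+
  have "(\<exists>y \<in> subtree_verts (hasse A) x. (y, p) \<in> E) \<longleftrightarrow> c \<notin> P p x" if x: "(c, x) \<in> hasse A" for x
  proof -
    have cx: "(c, x) \<in> A" "c \<noteq> x" "\<And>z. (z, x) \<in> A \<Longrightarrow> z \<noteq> x \<Longrightarrow> (z, c) \<in> A"
      using x unfolding hA by blast+
    have xV: "x \<in> V" using ao_in[OF A cx(1)] by blast
    have xc: "(x, c) \<notin> A" using ao_antisym[OF A cx(1)] cx(2) by blast
    have sv: "subtree_verts (hasse A) x = {y. (x, y) \<in> A}"
      unfolding subtree_verts_def using hasse_rtrancl_iff[OF A finite_verts xV] by blast
    show ?thesis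
    proof
      assume "\<exists>y \<in> subtree_verts (hasse A) x. (y, p) \<in> E"
      then obtain y where y: "(x, y) \<in> A" "(y, p) \<in> E" unfolding sv by blast
      have yV: "y \<in> V" using ao_in[OF A y(1)] by blast
      have "(p, y) \<in> (E \<inter> {p, y} \<times> {p, y})\<^sup>*" using adj_sym[OF y(2)] by blast
      then have "P p y \<subseteq> {p, y}" using connected_iff[of "{p, y}" p y] pV yV by blast
      moreover have "y \<noteq> c" using y(1) xc by blast
      ultimately have "c \<notin> P p y" using pcA(2) by blast
      moreover have "c \<notin> P y x" using ao_path[OF A y(1), of c] xc path_sym[of y x] by auto
      ultimately show "c \<notin> P p x" using path_triangle[of p x y] by blast
    next
      assume c: "c \<notin> P p x"
      have PV: "P p x \<subseteq> V" using path_in[OF pV(1) xV] .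
      have px: "p \<noteq> x" using cx(1) ao_antisym[OF A pcA(1)] pcA(2) by blast
      have "(x, p) \<in> (E \<inter> P p x \<times> P p x)\<^sup>*"
        using connected_iff[OF PV path_end path_start] path_sym[of x p] by blast
      moreover have "\<exists>w. (w, p) \<in> E \<and> w \<in> P p x \<and> w \<noteq> p"
        if "(x, z) \<in> (E \<inter> P p x \<times> P p x)\<^sup>*" "z = p" for z
        using that
      proof (induction)
        case base then show ?case using px by simp
      next
        case (step u v)
        then show ?case by (cases "u = p") auto
      qed
      ultimately obtain y where y: "y \<in> P p x" "(y, p) \<in> E" "y \<noteq> p" by blast
      have ax: "(p, x) \<in> A" using ao_trans[OF A pcA(1) cx(1)] .
      have yp: "p \<notin> P x y"
      proof
        assume "p \<in> P x y"
        moreover have "y \<in> P x p" using y(1) path_sym[of p x] by simp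
        ultimately have "p = y" using path_antisym[of y x p] by blast
        then show False using y(3) by simp
      qed
      have Pxy: "P x y \<subseteq> P p x" using path_sub[of y x p] y(1) path_sym[of p x] by simp
      obtain t where t: "t \<in> P x y" "(t, x) \<in> A" "(t, y) \<in> A" using ao_top[OF A xV, of y] PV y(1) by blast
      \<comment> \<open>Any other \<open>t\<close> is a proper ancestor of \<open>x\<close>, hence
        an ancestor of \<open>c\<close>, and since the path avoids \<open>c\<close> even of
        \<open>p\<close>. Lying on the path from \<open>p\<close> to \<open>x\<close>, it is also a
        descendant of \<open>p\<close>. So it would be \<open>p\<close>, which the path from
        \<open>x\<close> to \<open>y\<close> avoids.\<close>
      have "t = x"
      proof (rule ccontr)
        assume "t \<noteq> x"
        then have tc: "(t, c) \<in> A" using cx(3) t(2) by blast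
        have "t \<noteq> c" using t(1) Pxy c by blast
        then have "(t, p) \<in> A" using par tc by blast
        moreover have "(p, t) \<in> A" using ao_path[OF A ax] t(1) Pxy by blast
        ultimately have "t = p" using ao_antisym[OF A] by blast
        then show False using yp t(1) by blast
      qed
      then show "\<exists>y \<in> subtree_verts (hasse A) x. (y, p) \<in> E" unfolding sv using t(3) y(2) by blast
    qed
  qed
  then have "{x. (c, x) \<in> hasse A \<and> (\<exists>y \<in> subtree_verts (hasse A) x. (y, p) \<in> E)} = {x. (c, x) \<in> hasse A \<and> c \<notin> P p x}"
    by blast
  then show ?thesis unfolding rotate_edge_def hasse_rotated[OF A pc] Let_def by simp
qed

section \<open>Bounding rotation distances from below and above\<close>

definition reachable :: "nat \<Rightarrow> 'a rel \<Rightarrow> 'a rel \<Rightarrow> bool" where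
  "reachable k A B \<longleftrightarrow> (\<exists>j\<le>k. (hasse A, hasse B) \<in> rotation E ^^ j)"

lemma reachable_refl: "reachable k A A"
  unfolding reachable_def by (intro exI[of _ 0]) auto

lemma reachable_trans:
  assumes "reachable j A B" "reachable k B C"
  shows "reachable (j + k) A C"
proof -
  obtain a b where ab: "a \<le> j" "b \<le> k" "(hasse A, hasse B) \<in> rotation E ^^ a" "(hasse B, hasse C) \<in> rotation E ^^ b"
    using assms unfolding reachable_def by blast
  then have "(hasse A, hasse C) \<in> rotation E ^^ (a + b)" unfolding relpow_add by blast
  then show ?thesis unfolding reachable_def using ab by (intro exI[of _ "a + b"]) auto
qed

lemma reachable_mono: "reachable j A B \<Longrightarrow> j \<le> k \<Longrightarrow> reachable k A B"
  unfolding reachable_def using le_trans by blast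

lemma reachable_rotated:
  assumes "anc_order V A" "(p, c) \<in> hasse A"
  shows "reachable 1 A (rotated A p c)"
proof -
  have "(hasse A, hasse (rotated A p c)) \<in> rotation E"
    unfolding rotation_def rotate_edge_hasse[OF assms, symmetric] using assms(2) by blast
  then show ?thesis unfolding reachable_def by (intro exI[of _ 1]) auto
qed

lemma reachable_iff: "reachable k A B \<longleftrightarrow> rotation_distance E (hasse A) (hasse B) \<le> enat k"
proof
  assume "reachable k A B"
  then obtain j where j: "j \<le> k" "(hasse A, hasse B) \<in> rotation E ^^ j" unfolding reachable_def by blast
  have "rotation_distance E (hasse A) (hasse B) \<le> enat j"
    unfolding rotation_distance_def by (rule INF_lower) (use j in simp)
  also have "\<dots> \<le> enat k" using j by simp
  finally show "rotation_distance E (hasse A) (hasse B) \<le> enat k" .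
next
  assume h: "rotation_distance E (hasse A) (hasse B) \<le> enat k"
  let ?K = "enat ` {k. (hasse A, hasse B) \<in> rotation E ^^ k}"
  have ne: "?K \<noteq> {}"
  proof
    assume "?K = {}"
    then show False using h unfolding rotation_distance_def by (simp add: Inf_enat_def)
  qed
  \<comment> \<open>The infimum of a nonempty set of extended naturals is attained; the empty set
    was excluded because its infimum is infinite.\<close>
  have "Inf ?K \<in> ?K" unfolding Inf_enat_def using ne by (auto intro: LeastI)
  then obtain j where "Inf ?K = enat j" "(hasse A, hasse B) \<in> rotation E ^^ j" by blast
  then show "reachable k A B" unfolding reachable_def using h unfolding rotation_distance_def by auto
qed

text \<open>The principle behind both lower bounds. Only decreases are controlled, so the potential
  has to be the larger one at the starting order \<open>A\<close>.\<close>

lemma potential_bound: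
  fixes f :: "'a rel \<Rightarrow> nat"
  assumes step: "\<And>A p c. anc_order V A \<Longrightarrow> (p, c) \<in> hasse A \<Longrightarrow> f A \<le> f (rotated A p c) + q"
    and A: "anc_order V A" and B: "anc_order V B" and r: "reachable k A B"
  shows "f A \<le> f B + q * k"
proof -
  obtain j where j: "j \<le> k" "(hasse A, hasse B) \<in> rotation E ^^ j" using r unfolding reachable_def by blast
  have "\<exists>C. anc_order V C \<and> T = hasse C \<and> f A \<le> f C + q * j" if "(hasse A, T) \<in> rotation E ^^ j" for T j
    using that
  proof (induction j arbitrary: T)
    case 0 then show ?case using A by auto
  next
    case (Suc j)
    then obtain T' where T': "(hasse A, T') \<in> rotation E ^^ j" "(T', T) \<in> rotation E" by auto
    then obtain C where C: "anc_order V C" "T' = hasse C" "f A \<le> f C + q * j" using Suc.IH by blast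
    obtain p c where pc: "(p, c) \<in> hasse C" "T = rotate_edge E (hasse C) p c"
      using T'(2) C(2) unfolding rotation_def by blast
    have "T = hasse (rotated C p c)" using pc rotate_edge_hasse[OF C(1)] by simp
    moreover have "f A \<le> f (rotated C p c) + q * Suc j" using step[OF C(1) pc(1)] C(3) by simp
    ultimately show ?case using rotated_ao[OF C(1) pc(1)] by blast
  qed
  then obtain C where C: "anc_order V C" "hasse B = hasse C" "f A \<le> f C + q * j" using j(2) by blast
  then have "C = B" using hasse_inj[OF C(1) B finite_verts] by simp
  then have "f A \<le> f B + q * j" using C(3) by simp
  moreover have "q * j \<le> q * k" using j(1) by (rule mult_le_mono2)
  ultimately show ?thesis by linarith
qed

definition inversions :: "'a rel \<Rightarrow> 'a rel \<Rightarrow> 'a rel" where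
  "inversions A B = {(x, y) \<in> A. (y, x) \<in> B \<and> x \<noteq> y}"

lemma finite_inversions:
  assumes "anc_order V A"
  shows "finite (inversions A B)"
proof (rule finite_subset)
  show "inversions A B \<subseteq> V \<times> V" using ao_in[OF assms] unfolding inversions_def by auto
  show "finite (V \<times> V)" using finite_verts by simp
qed

lemma card_inversions_sym: "card (inversions A B) = card (inversions B A)"
proof -
  have "inversions A B = (inversions B A)\<inverse>" unfolding inversions_def by auto
  then show ?thesis by simp
qed

text \<open>On a given path, the top vertex of either order is above that of the other; without
  inversions the two coincide. And \<open>x\<close> is an ancestor of \<open>y\<close> exactly if it
  is the top of their path.\<close>

lemma inversions_empty:
  assumes A: "anc_order V A" and B: "anc_order V B" and n: "inversions A B = {}"
  shows "A = B"
proof (rule set_eqI, clarify)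
  fix x y
  show "(x, y) \<in> A \<longleftrightarrow> (x, y) \<in> B"
  proof (cases "x \<in> V \<and> y \<in> V")
    case False then show ?thesis using ao_in[OF A] ao_in[OF B] by blast
  next
    case True
    obtain z where z: "z \<in> P x y" "(z, x) \<in> A" "(z, y) \<in> A" using ao_top[OF A] True by blast
    obtain w where w: "w \<in> P x y" "(w, x) \<in> B" "(w, y) \<in> B" using ao_top[OF B] True by blast
    have "(z, w) \<in> A" using ao_convex[OF A z(2,3) w(1)] .
    moreover have "(w, z) \<in> B" using ao_convex[OF B w(2,3) z(1)] .
    ultimately have zw: "z = w" using n unfolding inversions_def by blast
    have "(x, y) \<in> A \<longleftrightarrow> z = x"
      using z ao_path[OF A _ z(1)] ao_antisym[OF A z(2)] by blast
    moreover have "(x, y) \<in> B \<longleftrightarrow> w = x"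
      using w ao_path[OF B _ w(1)] ao_antisym[OF B w(2)] by blast
    ultimately show ?thesis using zw by simp
  qed
qed

text \<open>Rotate at an inverted pair whose lower vertex has minimal depth in the target order.\<close>

lemma inversions_step:
  assumes A: "anc_order V A" and B: "anc_order V B" and n: "inversions A B \<noteq> {}"
  obtains p c where "(p, c) \<in> hasse A" "card (inversions (rotated A p c) B) < card (inversions A B)"
proof -
  define d where "d x = card {u. (u, x) \<in> B}" for x
  have dl: "d x < d y" if "(x, y) \<in> B" "x \<noteq> y" for x y
    unfolding d_def using ao_card_less[OF B finite_verts that] .
  define W where "W = {w. \<exists>x. (x, w) \<in> inversions A B}"
  have "W \<noteq> {}" using n unfolding W_def by auto
  then obtain w where w: "w \<in> W" "\<And>y. y \<in> W \<Longrightarrow> d w \<le> d y"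
    using ex_has_least_nat[of "\<lambda>w. w \<in> W" _ d] by blast
  then obtain x where x: "(x, w) \<in> A" "(w, x) \<in> B" "x \<noteq> w" unfolding W_def inversions_def by blast
  obtain p where p: "(p, w) \<in> hasse A" "(x, p) \<in> A" using hasse_parent_ex[OF A finite_verts x(1,3)] by metis
  have pw: "(p, w) \<in> A" "p \<noteq> w" using p(1) unfolding hasse_iff[OF A] by blast+
  have V: "p \<in> V" "w \<in> V" using ao_in[OF A pw(1)] by blast+
  obtain t where t: "t \<in> P p w" "(t, p) \<in> B" "(t, w) \<in> B" using ao_top[OF B V] by metis
  have "t = w"
  proof (rule ccontr)
    assume tw: "t \<noteq> w"
    then have "t \<notin> W" using dl[OF t(3)] w(2)[of t] by fastforce
    have "(p, t) \<in> A" using ao_path[OF A pw(1) t(1)] .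
    then have xt: "(x, t) \<in> A" using ao_trans[OF A p(2)] by blast
    have tx: "(t, x) \<in> B" using ao_trans[OF B t(3) x(2)] .
    have "x = t" using \<open>t \<notin> W\<close> xt tx unfolding W_def inversions_def by blast
    then have "(x, w) \<in> B" using t(3) by simp
    then show False using ao_antisym[OF B _ x(2)] x(3) by blast
  qed
  then have wp: "(w, p) \<in> B" using t(2) by simp
  \<comment> \<open>A new pair has \<open>w\<close> above a descendant \<open>v\<close> of
    \<open>p\<close>. If \<open>B\<close> puts \<open>v\<close> above \<open>w\<close>, it puts
    \<open>v\<close> above \<open>p\<close> as well, so \<open>(p, v)\<close> would already be an
    inversion whose lower vertex is less deep in \<open>B\<close> than \<open>w\<close>.\<close>
  have "inversions (rotated A p w) B \<subseteq> inversions A B - {(p, w)}"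
  proof clarify
    fix u v assume uv: "(u, v) \<in> inversions (rotated A p w) B"
    then have h: "(u, v) \<in> rotated A p w" "(v, u) \<in> B" "u \<noteq> v" unfolding inversions_def by auto
    have ne: "\<not> (u = p \<and> v = w)" using h(1) pw(2) path_end[of w p] unfolding rotated_iff by blast
    have "(u, v) \<in> A"
    proof (rule ccontr)
      assume "(u, v) \<notin> A"
      then have u: "u = w" "(p, v) \<in> A" using h(1) unfolding rotated_iff by blast+
      have vp: "(v, p) \<in> B" using ao_trans[OF B h(2)] wp u by simp
      have "v \<notin> W" using w(2)[of v] dl[OF h(2)] h(3) u by fastforce
      then have "v = p" using u(2) vp unfolding W_def inversions_def by blast
      then show False using h(2) u(1) wp ao_antisym[OF B wp] pw(2) by blast
    qed
    then show "(u, v) \<in> inversions A B - {(p, w)}" using h ne unfolding inversions_def by blast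
  qed
  moreover have "(p, w) \<in> inversions A B" using pw wp unfolding inversions_def by blast
  ultimately have "inversions (rotated A p w) B \<subset> inversions A B" by blast
  then have "card (inversions (rotated A p w) B) < card (inversions A B)"
    by (rule psubset_card_mono[OF finite_inversions[OF A]])
  then show ?thesis by (rule that[OF p(1)])
qed

lemma reachable_inversions:
  assumes "anc_order V A" "anc_order V B"
  shows "reachable (card (inversions A B)) A B"
  using assms
proof (induction "card (inversions A B)" arbitrary: A rule: less_induct)
  case less
  show ?case
  proof (cases "inversions A B = {}")
    case True
    then show ?thesis using inversions_empty[OF less.prems] reachable_refl by simp
  next
    case False
    obtain p c where pc: "(p, c) \<in> hasse A" "card (inversions (rotated A p c) B) < card (inversions A B)"
      using inversions_step[OF less.prems False] by metis
    have "reachable (card (inversions (rotated A p c) B)) (rotated A p c) B"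
      using less.hyps[OF pc(2)] rotated_ao[OF less.prems(1) pc(1)] less.prems(2) by blast
    then have "reachable (1 + card (inversions (rotated A p c) B)) A B"
      using reachable_trans[OF reachable_rotated[OF less.prems(1) pc(1)]] by blast
    then show ?thesis using pc(2) by (elim reachable_mono) simp
  qed
qed

text \<open>The pair \<open>(p, c)\<close> is the only possible inversion between the two orders, so
  the inversion bound itself provides the reverse rotation.\<close>

lemma reachable_rotated_back:
  assumes A: "anc_order V A" and pc: "(p, c) \<in> hasse A"
  shows "reachable 1 (rotated A p c) A"
proof -
  have "inversions A (rotated A p c) \<subseteq> {(p, c)}"
  proof clarify
    fix x y assume "(x, y) \<in> inversions A (rotated A p c)"
    then have h: "(x, y) \<in> A" "(y, x) \<in> rotated A p c" "x \<noteq> y" unfolding inversions_def by auto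
    have yx: "(y, x) \<notin> A" using ao_antisym[OF A h(1)] h(3) by blast
    then have yc: "y = c" "(p, x) \<in> A" using h(2) unfolding rotated_iff by blast+
    then have "(x, p) \<in> A" using h(1,3) pc unfolding hasse_iff[OF A] by blast
    then have "x = p" using ao_antisym[OF A _ yc(2)] by blast
    then show "x = p \<and> y = c" using yc by blast
  qed
  then have "card (inversions A (rotated A p c)) \<le> 1"
    using card_mono[of "{(p, c)}"] by fastforce
  then show ?thesis
    using reachable_inversions[OF rotated_ao[OF A pc] A] unfolding card_inversions_sym[of "rotated A p c"]
    by (rule reachable_mono[rotated])
qed

end

section \<open>Caterpillars\<close>

fun foot :: "cat_vertex \<Rightarrow> nat" where
  "foot (Spine i) = i"
| "foot (Leg i j) = i"

definition between :: "nat \<Rightarrow> nat \<Rightarrow> nat \<Rightarrow> bool" where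
  "between a k b \<longleftrightarrow> (a \<le> k \<and> k \<le> b) \<or> (b \<le> k \<and> k \<le> a)"

text \<open>Legs occur only as ends of a path, and everything in between is on the spine. The
  condition \<open>x \<noteq> y\<close> keeps the foot of a leg out of the path from the leg to
  itself.\<close>

definition cpath :: "cat_vertex \<Rightarrow> cat_vertex \<Rightarrow> cat_vertex set" where
  "cpath x y = {w. w = x \<or> w = y \<or> (x \<noteq> y \<and> (\<exists>k. w = Spine k \<and> between (foot x) k (foot y)))}"

lemma cpath_iff: "w \<in> cpath x y \<longleftrightarrow>
    w = x \<or> w = y \<or> (x \<noteq> y \<and> (\<exists>k. w = Spine k \<and> between (foot x) k (foot y)))"
  unfolding cpath_def by simp

lemma cpath_Spine: "w \<in> cpath (Spine i) (Spine j) \<longleftrightarrow> (\<exists>k. w = Spine k \<and> between i k j)"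
  unfolding cpath_iff by (auto simp: between_def)

lemma cpath_foot: "w \<in> cpath x y \<Longrightarrow> between (foot x) (foot w) (foot y)"
  unfolding cpath_iff by (auto simp: between_def)

lemma cpath_triangle: "cpath x z \<subseteq> cpath x y \<union> cpath y z"
proof
  fix w assume w: "w \<in> cpath x z"
  show "w \<in> cpath x y \<union> cpath y z"
  proof (cases "w = x \<or> w = z \<or> x = y \<or> y = z")
    case True then show ?thesis using w by (auto simp: cpath_iff)
  next
    case False
    then obtain k where k: "w = Spine k" "between (foot x) k (foot z)" using w by (auto simp: cpath_iff)
    have "between (foot x) k (foot y) \<or> between (foot y) k (foot z)"
      using k(2) unfolding between_def by linarith
    then show ?thesis using k(1) False by (auto simp: cpath_iff)
  qed
qed

lemma cpath_sub:
  assumes "z \<in> cpath x y"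
  shows "cpath x z \<subseteq> cpath x y"
proof
  fix w assume w: "w \<in> cpath x z"
  show "w \<in> cpath x y"
  proof (cases "w = x \<or> w = z \<or> z = y")
    case True then show ?thesis using w assms by (auto simp: cpath_iff)
  next
    case False
    then obtain k where k: "w = Spine k" "between (foot x) k (foot z)" "x \<noteq> z" using w by (auto simp: cpath_iff)
    then obtain l where l: "z = Spine l" "between (foot x) l (foot y)" "x \<noteq> y"
      using assms False by (auto simp: cpath_iff)
    have "between (foot x) k (foot y)"
      using k(2) l(1,2) by (auto simp: between_def)
    then show ?thesis using k(1) l(3) by (auto simp: cpath_iff)
  qed
qed

lemma cpath_antisym:
  assumes "z \<in> cpath x y" "y \<in> cpath x z"
  shows "z = y"
proof (rule ccontr)
  assume zy: "z \<noteq> y"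
  have ne: "x \<noteq> y" "x \<noteq> z" using assms zy by (auto simp: cpath_iff)
  obtain k where k: "z = Spine k" "between (foot x) k (foot y)"
    using assms(1) zy ne by (auto simp: cpath_iff)
  obtain l where l: "y = Spine l" "between (foot x) l (foot z)"
    using assms(2) zy ne by (auto simp: cpath_iff)
  have "k = l" using k l by (auto simp: between_def)
  then show False using k l zy by simp
qed

lemma cpath_sym: "cpath x y = cpath y x"
  by (auto simp: cpath_def between_def)

lemma cpath_ends: "x \<in> cpath x y" "y \<in> cpath x y"
  by (auto simp: cpath_iff)

lemma foot_range: "x \<in> cat_verts n m \<Longrightarrow> 1 \<le> foot x \<and> foot x \<le> n"
  unfolding cat_verts_def by auto

lemma Spine_in [simp]: "Spine i \<in> cat_verts n m \<longleftrightarrow> 1 \<le> i \<and> i \<le> n"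
  unfolding cat_verts_def by auto

lemma Leg_in [simp]: "Leg i j \<in> cat_verts n m \<longleftrightarrow> 1 \<le> i \<and> i \<le> n \<and> 1 \<le> j \<and> j \<le> m i"
  unfolding cat_verts_def by auto

lemma cpath_in: "x \<in> cat_verts n m \<Longrightarrow> y \<in> cat_verts n m \<Longrightarrow> cpath x y \<subseteq> cat_verts n m"
  using foot_range[of x n m] foot_range[of y n m] by (auto simp: cpath_iff between_def)

lemma cat_verts_eq: "cat_verts n m = Spine ` {1..n} \<union> (\<lambda>(i, j). Leg i j) ` (SIGMA i:{1..n}. {1..m i})"
  unfolding cat_verts_def by auto

lemma finite_cat_verts: "finite (cat_verts n m)"
  unfolding cat_verts_eq by auto

lemma card_cat_verts: "card (cat_verts n m) = n + num_legs n m"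
proof -
  have "inj_on (\<lambda>(i, j). Leg i j) X" for X by (auto simp: inj_on_def)
  then show ?thesis
    unfolding cat_verts_eq num_legs_def
    by (subst card_Un_disjoint) (auto simp: card_image inj_on_def)
qed

lemma cat_adj_sym: "(x, y) \<in> cat_adj n m \<Longrightarrow> (y, x) \<in> cat_adj n m"
  unfolding cat_adj_def by auto

lemma cpath_adj: "(x, y) \<in> cat_adj n m \<Longrightarrow> cpath x y = {x, y}"
  by (auto simp: cat_adj_def cat_arcs_def cpath_def between_def le_Suc_eq)

text \<open>An edge is its own path, so \<open>cpath_triangle\<close> carries the inclusion along
  any walk. Conversely, the spine vertices of the path form a walk between the two feet, to which
  the ends are attached.\<close>

lemma cat_connected:
  assumes S: "S \<subseteq> cat_verts n m" and x: "x \<in> S" and y: "y \<in> S"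
  shows "(x, y) \<in> (cat_adj n m \<inter> S \<times> S)\<^sup>* \<longleftrightarrow> cpath x y \<subseteq> S"
proof
  assume "(x, y) \<in> (cat_adj n m \<inter> S \<times> S)\<^sup>*"
  then show "cpath x y \<subseteq> S"
  proof induction
    case base show ?case using x by (auto simp: cpath_iff)
  next
    case (step y z)
    have "cpath y z \<subseteq> S" using cpath_adj[of y z n m] step.hyps by auto
    then show ?case using cpath_triangle[of x z y] step.IH by blast
  qed
next
  assume P: "cpath x y \<subseteq> S"
  let ?R = "cat_adj n m \<inter> S \<times> S"
  have sym: "sym (?R\<^sup>*)" using cat_adj_sym by (intro sym_rtrancl) (auto simp: sym_def)
  have walk: "(Spine i, Spine j) \<in> ?R\<^sup>*" if "i \<le> j" "\<forall>k. i \<le> k \<and> k \<le> j \<longrightarrow> Spine k \<in> S" for i j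
    using that
  proof (induction j rule: dec_induct)
    case base show ?case by simp
  next
    case (step j)
    have "Spine j \<in> S" "Spine (Suc j) \<in> S" using step.prems step.hyps by auto
    moreover have "(Spine j, Spine (Suc j)) \<in> cat_adj n m"
      using calculation S by (auto simp: cat_adj_def cat_arcs_def)
    ultimately have "(Spine j, Spine (Suc j)) \<in> ?R" by blast
    moreover have "(Spine i, Spine j) \<in> ?R\<^sup>*" using step by auto
    ultimately show ?case by (rule rtrancl_into_rtrancl[rotated])
  qed
  have leg: "(z, Spine (foot z)) \<in> ?R\<^sup>*" if "z \<in> S" "Spine (foot z) \<in> S" for z
  proof (cases z)
    case (Leg i j)
    then have "(Spine i, z) \<in> cat_adj n m" using that S by (auto simp: cat_adj_def cat_arcs_def)
    then show ?thesis using that Leg cat_adj_sym by auto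
  qed simp
  show "(x, y) \<in> ?R\<^sup>*"
  proof (cases "x = y")
    case False
    have sp: "Spine k \<in> S" if "between (foot x) k (foot y)" for k
      using P that False unfolding cpath_def by blast
    have spxy: "Spine (foot x) \<in> S" "Spine (foot y) \<in> S" by (auto intro!: sp simp: between_def)
    have "(x, Spine (foot x)) \<in> ?R\<^sup>*" using leg[OF x spxy(1)] .
    moreover have "(Spine (foot x), Spine (foot y)) \<in> ?R\<^sup>*"
    proof (cases "foot x \<le> foot y")
      case True then show ?thesis using walk sp by (simp add: between_def)
    next
      case False
      then have "(Spine (foot y), Spine (foot x)) \<in> ?R\<^sup>*" using walk sp by (simp add: between_def)
      then show ?thesis using sym by (auto dest: symD)
    qed
    moreover have "(Spine (foot y), y) \<in> ?R\<^sup>*" using symD[OF sym leg[OF y spxy(2)]] .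
    ultimately show ?thesis by (meson rtrancl_trans)
  qed simp
qed

locale caterpillar =
  fixes n :: nat and m :: "nat \<Rightarrow> nat"
  assumes n_pos: "n \<ge> 1"
begin

abbreviation "CV \<equiv> cat_verts n m"

sublocale tree_paths "cat_verts n m" "cat_adj n m" cpath
proof
  show "finite CV" by (rule finite_cat_verts)
  show "cpath x y \<subseteq> CV" if "x \<in> CV" "y \<in> CV" for x y using that by (rule cpath_in)
  show "x \<in> cpath x y" for x y by (rule cpath_ends)
  show "cpath x x = {x}" for x by (auto simp: cpath_iff)
  show "cpath x y = cpath y x" for x y by (rule cpath_sym)
  show "cpath x z \<subseteq> cpath x y \<union> cpath y z" for x y z by (rule cpath_triangle)
  show "cpath x z \<subseteq> cpath x y" if "z \<in> cpath x y" for x y z using that by (rule cpath_sub)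
  show "z = y" if "z \<in> cpath x y" "y \<in> cpath x z" for x y z using that by (rule cpath_antisym)
  show "(y, x) \<in> cat_adj n m" if "(x, y) \<in> cat_adj n m" for x y using that by (rule cat_adj_sym)
  show "(x, y) \<in> (cat_adj n m \<inter> S \<times> S)\<^sup>* \<longleftrightarrow> cpath x y \<subseteq> S"
    if "S \<subseteq> CV" "x \<in> S" "y \<in> S" for S x y using that by (rule cat_connected)
qed

lemma verts_nonempty: "CV \<noteq> {}"
  using n_pos Spine_in[of 1 n m] by blast

lemma cat_diameter_le:
  assumes "\<And>A B. anc_order CV A \<Longrightarrow> anc_order CV B \<Longrightarrow> reachable k A B"
  shows "cat_diameter n m \<le> enat k"
  unfolding assoc_diameter_def search_trees_eq[OF verts_nonempty]
  by (intro SUP_least) (use assms reachable_iff in blast)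

lemma cat_diameter_ge:
  assumes "anc_order CV A" "anc_order CV B" "\<And>k. reachable k A B \<Longrightarrow> l \<le> k"
  shows "enat l \<le> cat_diameter n m"
proof -
  have "enat l \<le> rotation_distance (cat_adj n m) (hasse A) (hasse B)"
  proof (rule ccontr)
    assume h: "\<not> ?thesis"
    then obtain k where "rotation_distance (cat_adj n m) (hasse A) (hasse B) = enat k" "k < l"
      by (cases "rotation_distance (cat_adj n m) (hasse A) (hasse B)") auto
    then show False using assms(3)[of k] reachable_iff[of k A B] by simp
  qed
  also have "\<dots> \<le> (SUP T\<^sub>2 \<in> search_trees CV (cat_adj n m). rotation_distance (cat_adj n m) (hasse A) T\<^sub>2)"
    using assms(2) unfolding search_trees_eq[OF verts_nonempty] by (intro SUP_upper) auto
  also have "\<dots> \<le> cat_diameter n m"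
    unfolding assoc_diameter_def using assms(1) unfolding search_trees_eq[OF verts_nonempty]
    by (intro SUP_upper[of "hasse A" _ "\<lambda>T. SUP T\<^sub>2 \<in> hasse ` {A. anc_order CV A}. rotation_distance (cat_adj n m) T T\<^sub>2"]) auto
  finally show ?thesis .
qed

lemma prio_cat_iff:
  "(x, y) \<in> prio d \<longleftrightarrow> x \<in> CV \<and> y \<in> CV \<and> d x \<le> d y \<and>
     (x \<noteq> y \<longrightarrow> (\<forall>k. between (foot x) k (foot y) \<longrightarrow> d x \<le> d (Spine k)))"
  unfolding prio_def by (auto simp: cpath_iff)

end

section \<open>Lower bound\<close>

context caterpillar
begin

section \<open>Alternation numbers of splits\<close>

definition alt_chain :: "cat_vertex rel \<Rightarrow> nat \<times> nat \<times> nat \<Rightarrow> cat_vertex list \<Rightarrow> bool" where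
  "alt_chain A = (\<lambda>(a, k, b) xs.
     (\<forall>x \<in> set xs. a \<le> foot x \<and> foot x \<le> b \<and> (x, Spine k) \<in> A \<and> (x, Spine (Suc k)) \<in> A) \<and>
     sorted_wrt (\<lambda>x y. (x, y) \<in> A \<and> x \<noteq> y) xs \<and>
     successively (\<lambda>x y. (foot x \<le> k) \<noteq> (foot y \<le> k)) xs)"

definition alt :: "cat_vertex rel \<Rightarrow> nat \<times> nat \<times> nat \<Rightarrow> nat" where
  "alt A v = Max {length xs | xs. alt_chain A v xs}"

definition crosses :: "nat \<times> nat \<times> nat \<Rightarrow> nat \<Rightarrow> nat \<Rightarrow> bool" where
  "crosses = (\<lambda>(a, k, b) i j. a \<le> i \<and> i \<le> b \<and> a \<le> j \<and> j \<le> b \<and> (i \<le> k) \<noteq> (j \<le> k))"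

definition split_in :: "nat \<Rightarrow> nat \<Rightarrow> nat \<times> nat \<times> nat \<Rightarrow> bool" where
  "split_in l r = (\<lambda>(a, k, b). l \<le> a \<and> a \<le> k \<and> k < b \<and> b \<le> r)"

lemma alt_chain_length:
  assumes A: "anc_order CV A" and xs: "alt_chain A v xs"
  shows "length xs \<le> card CV"
proof -
  obtain a k b where v: "v = (a, k, b)" by (cases v) auto
  have "set xs \<subseteq> CV" using xs ao_in[OF A] unfolding alt_chain_def v by auto
  moreover have "sorted_wrt (\<noteq>) xs"
    using xs unfolding alt_chain_def v by (auto intro: sorted_wrt_mono_rel[rotated])
  then have "distinct xs" by (induction xs) auto
  ultimately show ?thesis using card_mono[OF finite_verts] distinct_card by metis
qed

lemma alt_finite:
  assumes "anc_order CV A"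
  shows "finite {length xs | xs. alt_chain A v xs}"
proof (rule finite_subset)
  show "{length xs | xs. alt_chain A v xs} \<subseteq> {..card CV}" using alt_chain_length[OF assms, of v] by auto
qed simp

lemma alt_chain_Nil: "alt_chain A v []"
  unfolding alt_chain_def by (auto split: prod.splits)

lemma alt_ge:
  assumes "anc_order CV A" "alt_chain A v xs"
  shows "length xs \<le> alt A v"
  unfolding alt_def by (rule Max_ge[OF alt_finite[OF assms(1)]]) (use assms(2) in blast)

lemma alt_ex:
  assumes "anc_order CV A"
  obtains xs where "alt_chain A v xs" "length xs = alt A v"
proof -
  have "alt A v \<in> {length xs | xs. alt_chain A v xs}"
    unfolding alt_def by (rule Max_in[OF alt_finite[OF assms]]) (use alt_chain_Nil in blast)
  then obtain xs where "alt_chain A v xs" "length xs = alt A v" by auto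
  then show ?thesis by (rule that)
qed

lemma alt_chain_remove2:
  assumes "alt_chain A v (ys @ p # z # zs)"
  shows "alt_chain A v (ys @ zs)"
  using assms unfolding alt_chain_def
  by (auto simp: sorted_wrt_append successively_append_iff successively_Cons split: prod.splits)

lemma alt_chain_rotated_notin:
  assumes "alt_chain A v xs" "p \<notin> set xs"
  shows "alt_chain (rotated A p c) v xs"
proof -
  obtain a k b where v: "v = (a, k, b)" by (cases v) auto
  have "sorted_wrt (\<lambda>x y. (x, y) \<in> rotated A p c \<and> x \<noteq> y) xs"
    using assms unfolding alt_chain_def v
    by (auto simp: rotated_iff intro: sorted_wrt_mono_rel[rotated])
  then show ?thesis
    using assms unfolding alt_chain_def v by (auto simp: rotated_iff)
qed

text \<open>Only pairs with \<open>p\<close> on top are lost, so a longest chain without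
  \<open>p\<close> survives. In a chain with \<open>p\<close>, a vertex \<open>c\<close> on the same
  side takes the place of \<open>p\<close>. If the foot of \<open>c\<close> is outside
  \<open>[a, b]\<close>, then \<open>p\<close> keeps all descendants that matter. If the split
  separates \<open>p\<close> from \<open>c\<close>, then \<open>p\<close> is dropped together with
  its successor in the chain, if any, which preserves the alternation.\<close>

lemma alt_rotated:
  assumes A: "anc_order CV A" and pc: "(p, c) \<in> hasse A" and v: "v = (a, k, b)" "a \<le> k" "k < b"
  shows "alt A v \<le> alt (rotated A p c) v + (if crosses v (foot p) (foot c) then 2 else 0)"
proof -
  let ?A' = "rotated A p c"
  note A' = rotated_ao[OF A pc]
  have pcA: "(p, c) \<in> A" "p \<noteq> c" and par: "\<And>z. (z, c) \<in> A \<Longrightarrow> z \<noteq> c \<Longrightarrow> (z, p) \<in> A"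
    using pc unfolding hasse_iff[OF A] by blast+
  obtain xs where xs: "alt_chain A v xs" "length xs = alt A v" using alt_ex[OF A] by metis
  note xs' = xs(1)[unfolded alt_chain_def v, simplified]
  consider "p \<notin> set xs" | "p \<in> set xs" "crosses v (foot p) (foot c)"
    | "p \<in> set xs" "\<not> (a \<le> foot c \<and> foot c \<le> b)"
    | "p \<in> set xs" "a \<le> foot c" "foot c \<le> b" "(foot p \<le> k) = (foot c \<le> k)"
    using xs' unfolding crosses_def v by auto
  then show ?thesis
  proof cases
    case 1
    then show ?thesis using alt_ge[OF A' alt_chain_rotated_notin[OF xs(1) 1]] xs(2) by simp
  next
    case 2
    obtain ys zs where s: "xs = ys @ p # zs" using split_list[OF 2(1)] by blast
    have nin: "p \<notin> set ys" "p \<notin> set zs" using xs' unfolding s by (auto simp: sorted_wrt_append)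
    obtain ws where ws: "alt_chain A v ws" "p \<notin> set ws" "length xs \<le> length ws + 2"
    proof (cases zs)
      case Nil
      have "alt_chain A v ys" using xs(1) unfolding s alt_chain_def v
        by (auto simp: sorted_wrt_append successively_append_iff)
      then show ?thesis using that[of ys] nin s Nil by simp
    next
      case (Cons z zs')
      have "alt_chain A v (ys @ zs')" using xs(1) alt_chain_remove2 unfolding s Cons by blast
      then show ?thesis using that[of "ys @ zs'"] nin s Cons by simp
    qed
    show ?thesis using alt_ge[OF A' alt_chain_rotated_notin[OF ws(1,2)]] ws(3) xs(2) 2(2) by simp
  next
    case 3
    have p: "a \<le> foot p" "foot p \<le> b" using 3(1) xs' by auto
    have key: "(x, y) \<in> ?A'" if "(x, y) \<in> A" "a \<le> foot y" "foot y \<le> b" for x y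
    proof (cases "x = p")
      case True
      have "c \<notin> cpath p y" using cpath_foot[of c p y] p that 3(2) unfolding between_def by auto
      then show ?thesis using that True unfolding rotated_iff by blast
    next
      case False then show ?thesis using that unfolding rotated_iff by blast
    qed
    have "sorted_wrt (\<lambda>x y. (x, y) \<in> ?A' \<and> x \<noteq> y) xs"
      using xs' key by (auto intro: sorted_wrt_mono_rel[rotated])
    then have "alt_chain ?A' v xs" unfolding alt_chain_def v using xs' key v by auto
    then show ?thesis using alt_ge[OF A'] xs(2) by fastforce
  next
    case 4
    obtain ys zs where s: "xs = ys @ p # zs" using split_list[OF 4(1)] by blast
    have nin: "p \<notin> set ys" "p \<notin> set zs" using xs' unfolding s by (auto simp: sorted_wrt_append)
    have ysp: "(y, p) \<in> A" if "y \<in> set ys" for y using that xs' unfolding s by (auto simp: sorted_wrt_append)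
    have pz: "(p, z) \<in> A" if "z \<in> set zs" for z using that xs' unfolding s by (auto simp: sorted_wrt_append)
    have cys: "c \<notin> set ys" using ysp ao_antisym[OF A pcA(1)] pcA(2) by auto
    \<comment> \<open>The element after \<open>p\<close> is on the other side, so it is not
      \<open>c\<close>. If \<open>c\<close> came later, that element would be a proper ancestor of
      \<open>c\<close> strictly below \<open>p\<close>, the parent of \<open>c\<close>.\<close>
    have czs: "c \<notin> set zs"
    proof
      assume c: "c \<in> set zs"
      obtain z zs' where z: "zs = z # zs'" using c by (cases zs) auto
      have "z \<noteq> c" using xs' 4(4) unfolding s z by (auto simp: successively_append_iff successively_Cons)
      then have "(z, c) \<in> A" using xs' c unfolding s z by (auto simp: sorted_wrt_append)
      then have "(z, p) \<in> A" using par \<open>z \<noteq> c\<close> by blast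
      then have "z = p" using pz[of z] ao_antisym[OF A] z by simp
      then show False using nin z by simp
    qed
    have cA': "(c, z) \<in> ?A'" if "(p, z) \<in> A" for z using that unfolding rotated_iff by blast
    have xA': "(x, z) \<in> ?A'" if "(x, z) \<in> A" "x \<noteq> p" for x z using that unfolding rotated_iff by blast
    have srt: "sorted_wrt (\<lambda>x y. (x, y) \<in> A \<and> x \<noteq> y) ys" "sorted_wrt (\<lambda>x y. (x, y) \<in> A \<and> x \<noteq> y) zs"
      "\<And>y z. y \<in> set ys \<Longrightarrow> z \<in> set zs \<Longrightarrow> (y, z) \<in> A \<and> y \<noteq> z"
      using xs' unfolding s by (auto simp: sorted_wrt_append)
    have srt': "sorted_wrt (\<lambda>x y. (x, y) \<in> ?A' \<and> x \<noteq> y) ys" "sorted_wrt (\<lambda>x y. (x, y) \<in> ?A' \<and> x \<noteq> y) zs"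
      using srt(1,2) nin xA' by (auto intro: sorted_wrt_mono_rel[rotated])
    have yc: "(y, c) \<in> ?A'" if "y \<in> set ys" for y
      using ao_trans[OF A ysp[OF that] pcA(1)] xA' nin that by metis
    have yz: "(y, z) \<in> ?A' \<and> y \<noteq> z" if "y \<in> set ys" "z \<in> set zs" for y z
      using srt(3)[OF that] xA' nin that by metis
    have "sorted_wrt (\<lambda>x y. (x, y) \<in> ?A' \<and> x \<noteq> y) (ys @ c # zs)"
      unfolding sorted_wrt_append using srt' yc yz cA' pz cys czs by auto
    moreover have "successively (\<lambda>x y. (foot x \<le> k) \<noteq> (foot y \<le> k)) (ys @ c # zs)"
      using xs' 4(4) unfolding s by (auto simp: successively_append_iff successively_Cons)
    moreover have "\<forall>x \<in> set (ys @ c # zs). a \<le> foot x \<and> foot x \<le> b \<and> (x, Spine k) \<in> ?A' \<and> (x, Spine (Suc k)) \<in> ?A'"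
      using xs' 4(2,3) nin cA' xA' unfolding s by auto
    ultimately have "alt_chain ?A' v (ys @ c # zs)" unfolding alt_chain_def v by blast
    then show ?thesis using alt_ge[OF A'] xs(2) s by fastforce
  qed
qed

text \<open>By \<open>cr\<close>, at most one split of the family separates the feet of
  \<open>p\<close> and \<open>c\<close>, so the loss of two occurs once and not once per
  split.\<close>

lemma sum_alt_rotated:
  assumes A: "anc_order CV A" and pc: "(p, c) \<in> hasse A" and fin: "finite S"
    and S: "\<And>v. v \<in> S \<Longrightarrow> split_in 1 n v"
    and cr: "\<And>v w i j. v \<in> S \<Longrightarrow> w \<in> S \<Longrightarrow> crosses v i j \<Longrightarrow> crosses w i j \<Longrightarrow> v = w"
  shows "(\<Sum>v\<in>S. alt A v) \<le> (\<Sum>v\<in>S. alt (rotated A p c) v) + 2"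
proof -
  have "(\<Sum>v\<in>S. alt A v) \<le> (\<Sum>v\<in>S. alt (rotated A p c) v + (if crosses v (foot p) (foot c) then 2 else 0))"
  proof (rule sum_mono)
    fix v assume v: "v \<in> S"
    obtain a k b where "v = (a, k, b)" by (cases v) auto
    then show "alt A v \<le> alt (rotated A p c) v + (if crosses v (foot p) (foot c) then 2 else 0)"
      using alt_rotated[OF A pc] S[OF v] unfolding split_in_def by simp
  qed
  also have "\<dots> = (\<Sum>v\<in>S. alt (rotated A p c) v) + (\<Sum>v\<in>S. if crosses v (foot p) (foot c) then 2 else 0)"
    by (rule sum.distrib)
  also have "(\<Sum>v\<in>S. if crosses v (foot p) (foot c) then 2 else 0) = 2 * card {v \<in> S. crosses v (foot p) (foot c)}"
    using fin by (simp add: sum.If_cases Int_def)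
  also have "card {v \<in> S. crosses v (foot p) (foot c)} \<le> 1"
  proof (cases "{v \<in> S. crosses v (foot p) (foot c)} = {}")
    case True then show ?thesis unfolding True by simp
  next
    case False
    then obtain w where "w \<in> S" "crosses w (foot p) (foot c)" by blast
    then have "{v \<in> S. crosses v (foot p) (foot c)} \<subseteq> {w}" using cr by blast
    then show ?thesis using card_mono[of "{w}"] by fastforce
  qed
  finally show ?thesis by simp
qed

end

section \<open>Splicing, two-way entropy and weighted medians\<close>

text \<open>As long as both lists last, \<open>splice\<close> takes from them in turn; this initial
  part alternates and the rest is discarded. The claim about the head allows two more elements to be
  put in front.\<close>

lemma splice_alternating:
  assumes "\<forall>x\<in>set xs. Q x" "\<forall>y\<in>set ys. \<not> Q y"
  shows "\<exists>zs. subseq zs (splice xs ys) \<and> successively (\<lambda>x y. Q x \<noteq> Q y) zs \<and>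
    length zs = 2 * min (length xs) (length ys) \<and> (zs \<noteq> [] \<longrightarrow> Q (hd zs))"
  using assms
proof (induction xs arbitrary: ys)
  case Nil then show ?case by (intro exI[of _ "[]"]) auto
next
  case (Cons x xs)
  show ?case
  proof (cases ys)
    case Nil then show ?thesis by (intro exI[of _ "[]"]) auto
  next
    case y: (Cons y ys')
    obtain zs where zs: "subseq zs (splice xs ys')" "successively (\<lambda>x y. Q x \<noteq> Q y) zs"
      "length zs = 2 * min (length xs) (length ys')" "zs \<noteq> [] \<longrightarrow> Q (hd zs)"
      using Cons.IH[of ys'] Cons.prems unfolding y by auto
    have "Q x" "\<not> Q y" using Cons.prems unfolding y by auto
    then show ?thesis
      unfolding y using zs by (intro exI[of _ "x # y # zs"]) (auto simp: successively_Cons)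
  qed
qed

lemma subseq_splice: "subseq xs (splice xs ys) \<and> subseq ys (splice xs ys)"
  by (induction xs ys rule: splice.induct) auto

lemma set_splice: "set (splice xs ys) = set xs \<union> set ys"
  by (induction xs ys rule: splice.induct) auto

lemma distinct_splice: "distinct (splice xs ys) \<longleftrightarrow> distinct xs \<and> distinct ys \<and> set xs \<inter> set ys = {}"
  by (induction xs ys rule: splice.induct) (auto simp: set_splice)

lemma sorted_wrt_subseq: "subseq xs ys \<Longrightarrow> sorted_wrt R ys \<Longrightarrow> sorted_wrt R xs"
  by (induction rule: list_emb.induct) (auto dest: list_emb_set)

definition xlog :: "nat \<Rightarrow> real" where
  "xlog x = real x * log 2 (real x)"

text \<open>Up to normalisation: a two-way split has at most one bit of entropy. With
  \<open>s = a + b\<close>, the inequality \<open>ln t \<le> t - 1\<close> is used at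
  \<open>s / (2 * a)\<close> and \<open>s / (2 * b)\<close>, where the weighted right-hand sides
  cancel.\<close>

lemma xlog_add: "xlog (a + b) \<le> xlog a + xlog b + real (a + b)"
proof (cases "a = 0 \<or> b = 0")
  case True then show ?thesis by (auto simp: xlog_def)
next
  case False
  then have ab: "real a > 0" "real b > 0" by auto
  have *: "x * log 2 (y / (2 * x)) \<le> (y / 2 - x) / ln 2" if "x > 0" "y > 0" for x y :: real
  proof -
    have "ln (y / (2 * x)) \<le> y / (2 * x) - 1" using that by (intro ln_le_minus_one) auto
    then have "x * ln (y / (2 * x)) \<le> x * (y / (2 * x) - 1)" using that by (intro mult_left_mono) auto
    also have "\<dots> = y / 2 - x" using that by (simp add: field_simps)
    finally show ?thesis unfolding log_def using divide_right_mono[of _ _ "ln 2"] by fastforce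
  qed
  let ?s = "real a + real b"
  have "real a * log 2 (?s / (2 * real a)) + real b * log 2 (?s / (2 * real b)) \<le>
    (?s / 2 - real a) / ln 2 + (?s / 2 - real b) / ln 2"
    using *[of "real a" ?s] *[of "real b" ?s] ab by linarith
  also have "\<dots> = 0" by (simp add: field_simps)
  finally have "real a * log 2 (?s / (2 * real a)) + real b * log 2 (?s / (2 * real b)) \<le> 0" .
  moreover have "log 2 (?s / (2 * real a)) = log 2 ?s - 1 - log 2 (real a)"
    "log 2 (?s / (2 * real b)) = log 2 ?s - 1 - log 2 (real b)"
    using ab by (simp_all add: log_divide log_mult)
  ultimately have "real a * (log 2 ?s - 1 - log 2 (real a)) + real b * (log 2 ?s - 1 - log 2 (real b)) \<le> 0"
    by simp
  then show ?thesis unfolding xlog_def by (simp add: algebra_simps)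
qed

text \<open>Take the least position up to which, inclusively, at least half of the weight has
  accumulated. It provides the splits of the lower bound and the roots of the upper bound.\<close>

lemma weighted_median:
  fixes w :: "nat \<Rightarrow> nat"
  assumes "finite Z" "sum w Z > 0"
  obtains k where "k \<in> Z" "w k > 0" "2 * sum w {i \<in> Z. i < k} \<le> sum w Z" "2 * sum w {i \<in> Z. i > k} \<le> sum w Z"
proof -
  let ?Q = "\<lambda>k. k \<in> Z \<and> sum w Z \<le> 2 * sum w {i \<in> Z. i \<le> k}"
  have "Z \<noteq> {}" using assms by auto
  have "{i \<in> Z. i \<le> Max Z} = Z" using assms(1) by auto
  then have Q: "?Q (Max Z)" using \<open>Z \<noteq> {}\<close> assms(1) by simp
  define k where "k = (LEAST k. ?Q k)"
  have k: "?Q k" "\<And>j. ?Q j \<Longrightarrow> k \<le> j"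
    unfolding k_def by (rule LeastI[of ?Q, OF Q], rule Least_le)
  have split: "sum w {i \<in> Z. i \<le> k} = sum w {i \<in> Z. i < k} + w k"
  proof -
    have "{i \<in> Z. i \<le> k} = insert k {i \<in> Z. i < k}" using k(1) by auto
    then show ?thesis using assms(1) by simp
  qed
  have split2: "sum w Z = sum w {i \<in> Z. i \<le> k} + sum w {i \<in> Z. i > k}"
  proof -
    have "Z = {i \<in> Z. i \<le> k} \<union> {i \<in> Z. i > k}" by auto
    then show ?thesis using assms(1) sum.union_disjoint[of "{i \<in> Z. i \<le> k}" "{i \<in> Z. i > k}" w] by fastforce
  qed
  have lo: "2 * sum w {i \<in> Z. i < k} < sum w Z"
  proof (cases "{i \<in> Z. i < k} = {}")
    case True then show ?thesis unfolding True using assms(2) by simp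
  next
    case False
    define j where "j = Max {i \<in> Z. i < k}"
    have j: "j \<in> Z" "j < k" using False assms(1) Max_in[of "{i \<in> Z. i < k}"] unfolding j_def by auto
    have "{i \<in> Z. i < k} = {i \<in> Z. i \<le> j}" using assms(1) j unfolding j_def by auto
    moreover have "\<not> ?Q j" using k(2)[of j] j by auto
    ultimately show ?thesis using j by simp
  qed
  have "w k > 0" using lo k(1) split by linarith
  moreover have "2 * sum w {i \<in> Z. i > k} \<le> sum w Z" using k(1) split2 by linarith
  ultimately show ?thesis using that[of k] k(1) lo by simp
qed

context caterpillar
begin

section \<open>Hierarchical splits with interleaved legs\<close>

definition weight :: "nat \<Rightarrow> nat \<Rightarrow> nat" where
  "weight a b = sum m {a..b}"

definition legs :: "nat \<Rightarrow> nat \<Rightarrow> cat_vertex set" where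
  "legs a b = {Leg i j | i j. a \<le> i \<and> i \<le> b \<and> 1 \<le> j \<and> j \<le> m i}"

definition min_weight :: "nat \<times> nat \<times> nat \<Rightarrow> nat" where
  "min_weight = (\<lambda>(a, k, b). min (weight a k) (weight (Suc k) b))"

lemma card_legs: "card (legs a b) = weight a b"
proof -
  have "legs a b = (\<lambda>(i, j). Leg i j) ` (SIGMA i:{a..b}. {1..m i})" unfolding legs_def by auto
  moreover have "inj_on (\<lambda>(i, j). Leg i j) X" for X by (auto simp: inj_on_def)
  ultimately show ?thesis unfolding weight_def by (simp add: card_image)
qed

lemma weight_split: "a \<le> k \<Longrightarrow> k \<le> b \<Longrightarrow> weight a b = weight a k + weight (Suc k) b"
  unfolding weight_def using sum.ub_add_nat[of a k m "b - k"] by simp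

lemma weight_single: "weight a a = m a"
  unfolding weight_def by simp

text \<open>\<open>2 * min_weight\<close> is the length of the alternating list that splicing the
  legs of both sides produces. The property survives when \<open>L\<close> is spliced with further
  legs, so one list can serve all splits.\<close>

definition interleaves :: "cat_vertex list \<Rightarrow> nat \<times> nat \<times> nat \<Rightarrow> bool" where
  "interleaves L = (\<lambda>(a, k, b). \<exists>xs. subseq xs L \<and> (\<forall>x\<in>set xs. a \<le> foot x \<and> foot x \<le> b) \<and>
     successively (\<lambda>x y. (foot x \<le> k) \<noteq> (foot y \<le> k)) xs \<and> length xs = 2 * min_weight (a, k, b))"

text \<open>A recursive splitting of \<open>[a, b]\<close>, recorded as a set of splits rather than
  as a tree. Its hierarchical nature enters only through \<open>crosses\<close>, which is what
  limits the effect of a rotation.\<close>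

definition spliced :: "nat \<Rightarrow> nat \<Rightarrow> (nat \<times> nat \<times> nat) set \<Rightarrow> cat_vertex list \<Rightarrow> bool" where
  "spliced a b S L \<longleftrightarrow> finite S \<and> card S \<le> b - a \<and> (\<forall>v\<in>S. split_in a b v) \<and>
     (\<forall>v\<in>S. \<forall>w\<in>S. \<forall>i j. crosses v i j \<longrightarrow> crosses w i j \<longrightarrow> v = w) \<and>
     distinct L \<and> set L = legs a b \<and> (\<forall>v\<in>S. interleaves L v)"

lemma crosses_split: "split_in a b v \<Longrightarrow> crosses v i j \<Longrightarrow> a \<le> i \<and> i \<le> b \<and> a \<le> j \<and> j \<le> b"
  unfolding split_in_def crosses_def by (auto split: prod.splits)

lemma spliced_single: "spliced a a {} (map (Leg a) [1..<Suc (m a)])"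
  unfolding spliced_def legs_def by (auto simp: distinct_map inj_on_def)

lemma interleaves_subseq: "interleaves L v \<Longrightarrow> subseq L L' \<Longrightarrow> interleaves L' v"
  unfolding interleaves_def using subseq_order.order_trans by (auto split: prod.splits)

text \<open>Splicing keeps both lists as subsequences, so the splits inside the two parts stay
  interleaved. The new split separates only positions in different parts, while an old one separates
  positions of the same part.\<close>

lemma spliced_join:
  assumes 1: "spliced a k S L" and 2: "spliced (Suc k) b S' L'" and k: "a \<le> k" "k < b"
  shows "spliced a b (insert (a, k, b) (S \<union> S')) (splice L L') \<and>
    sum min_weight (insert (a, k, b) (S \<union> S')) = min_weight (a, k, b) + sum min_weight S + sum min_weight S'"
proof -
  let ?v = "(a, k, b)" and ?L = "splice L L'"
  have s: "split_in a k v" if "v \<in> S" for v using 1 that unfolding spliced_def by blast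
  have s': "split_in (Suc k) b v" if "v \<in> S'" for v using 2 that unfolding spliced_def by blast
  have fin: "finite S" "finite S'" using 1 2 unfolding spliced_def by auto
  have dis: "S \<inter> S' = {}"
  proof -
    have False if "v \<in> S" "v \<in> S'" for v using s[OF that(1)] s'[OF that(2)] unfolding split_in_def by (cases v) auto
    then show ?thesis by blast
  qed
  have vn: "?v \<notin> S \<union> S'"
    using s[of ?v] s'[of ?v] k unfolding split_in_def by auto
  have setL: "set L = legs a k" "set L' = legs (Suc k) b" "distinct L" "distinct L'"
    using 1 2 unfolding spliced_def by auto
  have il: "interleaves ?L ?v"
  proof -
    obtain zs where zs: "subseq zs ?L" "successively (\<lambda>x y. (foot x \<le> k) \<noteq> (foot y \<le> k)) zs"
      "length zs = 2 * min (length L) (length L')"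
    proof -
      have "\<forall>x\<in>set L. foot x \<le> k" "\<forall>x\<in>set L'. \<not> foot x \<le> k" unfolding setL legs_def by auto
      from splice_alternating[of L "\<lambda>x. foot x \<le> k" L', OF this] show ?thesis
        using that by blast
    qed
    have "length L = weight a k" "length L' = weight (Suc k) b"
      using distinct_card[OF setL(3)] distinct_card[OF setL(4)] setL card_legs by auto
    moreover have "\<forall>x\<in>set zs. a \<le> foot x \<and> foot x \<le> b"
    proof
      fix x assume "x \<in> set zs"
      then have "x \<in> set ?L" using list_emb_set[OF zs(1)] by metis
      then show "a \<le> foot x \<and> foot x \<le> b" using setL k unfolding legs_def by (auto simp: set_splice)
    qed
    ultimately show ?thesis unfolding interleaves_def min_weight_def using zs by auto
  qed
  have "spliced a b (insert ?v (S \<union> S')) ?L"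
    unfolding spliced_def
  proof (intro conjI)
    show "finite (insert ?v (S \<union> S'))" using fin by simp
    have cS: "card S \<le> k - a" "card S' \<le> b - Suc k" using 1 2 unfolding spliced_def by blast+
    have "card (insert ?v (S \<union> S')) \<le> Suc (card S + card S')"
      using card_insert_le_m1 card_Un_le[of S S'] fin by (simp add: card_insert_if)
    then show "card (insert ?v (S \<union> S')) \<le> b - a" using cS k by linarith
    show "\<forall>v\<in>insert ?v (S \<union> S'). split_in a b v"
    proof
      fix v assume "v \<in> insert ?v (S \<union> S')"
      then consider "v = ?v" | "split_in a k v" | "split_in (Suc k) b v" using s s' by blast
      then show "split_in a b v" using k unfolding split_in_def by cases auto
    qed
    have ne: "\<not> crosses ?v i j" if "crosses w i j" "w \<in> S \<union> S'" for w i j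
    proof -
      have "(i \<le> k \<and> j \<le> k) \<or> (i > k \<and> j > k)"
        using that(2) crosses_split[OF s that(1)] crosses_split[OF s' that(1)] by (meson Suc_le_lessD UnE)
      then show ?thesis unfolding crosses_def by auto
    qed
    have ne2: "\<not> crosses w' i j" if "crosses w i j" "w \<in> S" "w' \<in> S'" for w w' i j
      using crosses_split[OF s[OF that(2)] that(1)] crosses_split[OF s'[OF that(3)], of i j] by auto
    have u: "v = w" if "v \<in> S" "w \<in> S" "crosses v i j" "crosses w i j" for v w i j
      using 1 that unfolding spliced_def by blast
    have u': "v = w" if "v \<in> S'" "w \<in> S'" "crosses v i j" "crosses w i j" for v w i j
      using 2 that unfolding spliced_def by blast
    show "\<forall>v\<in>insert ?v (S \<union> S'). \<forall>w\<in>insert ?v (S \<union> S'). \<forall>i j. crosses v i j \<longrightarrow> crosses w i j \<longrightarrow> v = w"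
    proof (intro ballI allI impI)
      fix v w i j assume h: "v \<in> insert ?v (S \<union> S')" "w \<in> insert ?v (S \<union> S')" "crosses v i j" "crosses w i j"
      show "v = w"
      proof (cases "v = ?v \<or> w = ?v")
        case True then show ?thesis using ne h by blast
      next
        case False
        then have "v \<in> S \<union> S'" "w \<in> S \<union> S'" using h by blast+
        then show ?thesis using u[OF _ _ h(3,4)] u'[OF _ _ h(3,4)] ne2[OF h(3), of w] ne2[OF h(4), of v] h(3,4) by blast
      qed
    qed
    show "distinct ?L" unfolding distinct_splice using setL unfolding legs_def by auto
    show "set ?L = legs a b" unfolding set_splice setL(1,2) legs_def using k by (auto simp: not_le Suc_le_eq)
    have sub: "subseq L ?L" "subseq L' ?L" using subseq_splice by auto
    show "\<forall>v\<in>insert ?v (S \<union> S'). interleaves ?L v"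
    proof
      fix v assume "v \<in> insert ?v (S \<union> S')"
      then consider "v = ?v" | "v \<in> S" | "v \<in> S'" by blast
      then show "interleaves ?L v"
        using 1 2 il interleaves_subseq[OF _ sub(1), of v] interleaves_subseq[OF _ sub(2), of v]
        unfolding spliced_def by cases auto
    qed
  qed
  moreover have "sum min_weight (insert ?v (S \<union> S')) = min_weight ?v + sum min_weight S + sum min_weight S'"
    using vn fin sum.union_disjoint[OF fin dis, of min_weight] by simp
  ultimately show ?thesis by blast
qed

lemma xlog_zero: "xlog 0 = 0" unfolding xlog_def by simp

text \<open>
  The splits next to a weighted median \<open>k\<close> have an entropy that exceeds the smaller weights by far if
  most legs are at \<open>k\<close>. The excess is then paid by the share \<open>4 * m k\<close> of the linear term, which the
  interval \<open>{k}\<close> itself does not need.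
\<close>

lemma spliced_exists:
  assumes "a \<le> b"
  shows "\<exists>S L. spliced a b S L \<and>
    xlog (weight a b) \<le> (\<Sum>i\<in>{a..b}. xlog (m i)) + 4 * real (weight a b) + 4 * real (sum min_weight S)"
  using assms
proof (induction "b - a" arbitrary: a b rule: less_induct)
  case less
  define \<phi> where "\<phi> l r = (\<Sum>i\<in>{l..r}. xlog (m i))" for l r
  have \<phi>_split: "\<phi> l r = \<phi> l k + \<phi> (Suc k) r" if "l \<le> k" "k \<le> r" for l k r
    unfolding \<phi>_def using sum.ub_add_nat[of l k "\<lambda>i. xlog (m i)" "r - k"] that by simp
  have \<phi>_single: "\<phi> k k = xlog (m k)" for k unfolding \<phi>_def by simp
  define bound where "bound l r S \<longleftrightarrow> xlog (weight l r) \<le> \<phi> l r + 4 * real (weight l r) + 4 * real (sum min_weight S)"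
    for l r S
  have IH: "\<exists>S L. spliced l r S L \<and> bound l r S" if "r - l < b - a" "l \<le> r" for l r
    using less.hyps[OF that] unfolding bound_def \<phi>_def .
  have "\<exists>k\<in>{a..b}. 2 * sum m {i \<in> {a..b}. i < k} \<le> weight a b \<and> 2 * sum m {i \<in> {a..b}. i > k} \<le> weight a b"
  proof (cases "weight a b = 0")
    case True
    then have "\<forall>i\<in>{a..b}. m i = 0" unfolding weight_def by auto
    then have "sum m {i \<in> {a..b}. i < a} = 0" "sum m {i \<in> {a..b}. i > a} = 0"
      by (intro sum.neutral; auto)+
    then have "2 * sum m {i \<in> {a..b}. i < a} \<le> weight a b \<and> 2 * sum m {i \<in> {a..b}. i > a} \<le> weight a b"
      by linarith
    moreover have "a \<in> {a..b}" using less.prems by simp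
    ultimately show ?thesis by blast
  next
    case False
    then have pos: "sum m {a..b} > 0" unfolding weight_def by (rule neq0_conv[THEN iffD1])
    obtain k where "k \<in> {a..b}" "m k > 0" "2 * sum m {i \<in> {a..b}. i < k} \<le> sum m {a..b}"
      "2 * sum m {i \<in> {a..b}. i > k} \<le> sum m {a..b}"
      by (rule weighted_median[OF finite_atLeastAtMost pos])
    then show ?thesis unfolding weight_def by blast
  qed
  then obtain k where k: "a \<le> k" "k \<le> b" "2 * sum m {i \<in> {a..b}. i < k} \<le> weight a b"
    "2 * sum m {i \<in> {a..b}. i > k} \<le> weight a b" by auto
  define x where "x = sum m {i \<in> {a..b}. i < k}"
  define y where "y = m k"
  define z where "z = sum m {i \<in> {a..b}. i > k}"
  have zR: "z = weight (Suc k) b"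
    unfolding z_def weight_def using k by (intro sum.cong) auto
  have xL: "x = weight a (k - 1)" if "a < k"
    unfolding x_def weight_def using k that by (intro sum.cong) auto
  have W: "weight a b = x + y + z"
  proof (cases "a < k")
    case True
    then show ?thesis using weight_split[of a "k - 1" b] weight_split[of k k b] k zR xL[OF True]
      by (simp add: weight_single y_def)
  next
    case False
    then have "k = a" using k by simp
    moreover have "x = 0" unfolding x_def \<open>k = a\<close> by (auto intro!: sum.neutral)
    ultimately show ?thesis using weight_split[of k k b] k zR by (simp add: weight_single y_def)
  qed
  have half: "2 * x \<le> x + y + z" "2 * z \<le> x + y + z" using k(3,4) unfolding W x_def z_def by auto
  have split2: "xlog (p + q) \<le> xlog p + xlog q + (real p + real q)" for p q
    using xlog_add[of p q] by simp
  \<comment> \<open>Two binary splits separate the three parts, each at a cost of at most one bit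
    per leg.\<close>
  have xl: "xlog (x + y + z) \<le> xlog x + xlog y + xlog z + 2 * real (x + y + z)"
    using split2[of x "y + z"] split2[of y z] by (simp add: add.assoc)
  have IHL: "\<exists>S L. spliced a (k - 1) S L \<and> bound a (k - 1) S" if "a < k"
  proof (rule IH)
    show "k - 1 - a < b - a" "a \<le> k - 1" using that k by linarith+
  qed
  have IHR: "\<exists>S L. spliced (Suc k) b S L \<and> bound (Suc k) b S" if "k < b"
  proof (rule IH)
    show "b - Suc k < b - a" "Suc k \<le> b" using that k by linarith+
  qed
  let ?leaf = "map (Leg k) [1..<Suc (m k)]"
  \<comment> \<open>With \<open>w = x + y + z\<close>, the induction hypotheses and
    \<open>xl\<close> leave \<open>2 * w + 4 * (x + z)\<close> to be covered by \<open>4 * w\<close>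
    and four times the smaller side of the outermost split. Splitting off the heavier side first
    makes that side \<open>max x z\<close>, by the median property, and
    \<open>2 * (x + z) \<le> 4 * max x z\<close> suffices. If one side is missing, the other has
    weight at most \<open>y\<close> and the linear terms alone suffice.\<close>
  consider "a < k" "k < b" "x \<ge> z" | "a < k" "k < b" "x < z" | "a = k" "k < b" | "a < k" "k = b" | "a = b"
    using k by linarith
  then have "\<exists>S L. spliced a b S L \<and> bound a b S"
  proof cases
    case 1
    obtain S L where SL: "spliced a (k - 1) S L" "bound a (k - 1) S" using IHL 1 by blast
    obtain S' L' where SL': "spliced (Suc k) b S' L'" "bound (Suc k) b S'" using IHR 1 by blast
    let ?T = "insert (k, k, b) ({} \<union> S')"
    have j1: "spliced k b ?T (splice ?leaf L')" "sum min_weight ?T = min_weight (k, k, b) + 0 + sum min_weight S'"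
      using spliced_join[OF spliced_single SL'(1)] 1(2) by auto
    let ?U = "insert (a, k - 1, b) (S \<union> ?T)"
    have j2: "spliced a b ?U (splice L (splice ?leaf L'))"
      "sum min_weight ?U = min_weight (a, k - 1, b) + sum min_weight S + sum min_weight ?T"
      using spliced_join[OF SL(1), of b ?T "splice ?leaf L'"] j1(1) 1 by auto
    have "min_weight (a, k - 1, b) = x"
      using weight_split[of k k b] 1 half zR xL[OF 1(1)] k unfolding min_weight_def
      by (simp add: weight_single y_def)
    then have "real (sum min_weight ?U) \<ge> real x + real (sum min_weight S) + real (sum min_weight S')"
      using j1(2) j2(2) by simp
    moreover have "\<phi> a b = \<phi> a (k - 1) + xlog y + \<phi> (Suc k) b"
      using \<phi>_split[of a "k - 1" b] \<phi>_split[of k k b] \<phi>_single[of k] 1 k unfolding y_def by simp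
    ultimately have "bound a b ?U"
      using SL(2) SL'(2) xl 1(3) unfolding bound_def W zR[symmetric] xL[OF 1(1), symmetric] by simp
    then show ?thesis using j2(1) by blast
  next
    case 2
    obtain S L where SL: "spliced a (k - 1) S L" "bound a (k - 1) S" using IHL 2 by blast
    obtain S' L' where SL': "spliced (Suc k) b S' L'" "bound (Suc k) b S'" using IHR 2 by blast
    let ?T = "insert (a, k - 1, k) (S \<union> {})"
    have leaf: "spliced (Suc (k - 1)) k {} ?leaf" using spliced_single[of k] 2 by simp
    have j1: "spliced a k ?T (splice L ?leaf)" "sum min_weight ?T = min_weight (a, k - 1, k) + sum min_weight S + 0"
      using spliced_join[OF SL(1) leaf] 2 by auto
    let ?U = "insert (a, k, b) (?T \<union> S')"
    have j2: "spliced a b ?U (splice (splice L ?leaf) L')"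
      "sum min_weight ?U = min_weight (a, k, b) + sum min_weight ?T + sum min_weight S'"
      using spliced_join[OF j1(1) SL'(1)] 2 k by auto
    have "min_weight (a, k, b) = z"
      using weight_split[of a "k - 1" k] 2 half zR xL[OF 2(1)] k unfolding min_weight_def
      by (simp add: weight_single y_def)
    then have "real (sum min_weight ?U) \<ge> real z + real (sum min_weight S) + real (sum min_weight S')"
      using j1(2) j2(2) by simp
    moreover have "\<phi> a b = \<phi> a (k - 1) + xlog y + \<phi> (Suc k) b"
      using \<phi>_split[of a "k - 1" b] \<phi>_split[of k k b] \<phi>_single[of k] 2 k unfolding y_def by simp
    ultimately have "bound a b ?U"
      using SL(2) SL'(2) xl 2(3) unfolding bound_def W zR[symmetric] xL[OF 2(1), symmetric] by simp
    then show ?thesis using j2(1) by blast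
  next
    case 3
    have x0: "x = 0" unfolding x_def using 3 by (auto intro!: sum.neutral)
    obtain S' L' where SL': "spliced (Suc k) b S' L'" "bound (Suc k) b S'" using IHR 3 by blast
    let ?T = "insert (k, k, b) ({} \<union> S')"
    have j1: "spliced k b ?T (splice ?leaf L')" "sum min_weight ?T = min_weight (k, k, b) + 0 + sum min_weight S'"
      using spliced_join[OF spliced_single SL'(1)] 3(2) by auto
    have "\<phi> a b = xlog y + \<phi> (Suc k) b"
      using \<phi>_split[of k k b] \<phi>_single[of k] 3 k unfolding y_def by simp
    then have "bound a b ?T"
      using SL'(2) xl j1(2) half unfolding bound_def W zR[symmetric] x0 by (simp add: xlog_zero)
    then show ?thesis using j1(1) 3(1) by blast
  next
    case 4
    have z0: "z = 0" unfolding z_def using 4 by (auto intro!: sum.neutral)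
    obtain S L where SL: "spliced a (k - 1) S L" "bound a (k - 1) S" using IHL 4 by blast
    let ?T = "insert (a, k - 1, k) (S \<union> {})"
    have leaf: "spliced (Suc (k - 1)) k {} ?leaf" using spliced_single[of k] 4 by simp
    have j1: "spliced a k ?T (splice L ?leaf)" "sum min_weight ?T = min_weight (a, k - 1, k) + sum min_weight S + 0"
      using spliced_join[OF SL(1) leaf] 4 by auto
    have "\<phi> a b = \<phi> a (k - 1) + xlog y"
      using \<phi>_split[of a "k - 1" b] \<phi>_single[of k] 4 k unfolding y_def by simp
    then have "bound a b ?T"
      using SL(2) xl j1(2) half unfolding bound_def W z0 xL[OF 4(1), symmetric] by (simp add: xlog_zero)
    then show ?thesis using j1(1) 4(2) by blast
  next
    case 5
    have "bound a b {}" using 5 unfolding bound_def by (simp add: weight_single \<phi>_single)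
    then show ?thesis using spliced_single[of a] 5 by blast
  qed
  then show ?case unfolding bound_def \<phi>_def .
qed

text \<open>Written with \<open>xlog\<close>, the entropy becomes a difference between a whole
  interval and its single positions, the form in which it can be bounded recursively. Positions
  without legs contribute \<open>0\<close>.\<close>

lemma entropy_xlog:
  "real (num_legs n m) * leg_entropy n m = xlog (num_legs n m) - (\<Sum>i\<in>{1..n}. xlog (m i))"
proof (cases "num_legs n m = 0")
  case True
  then have "m i = 0" if "i \<in> {1..n}" for i using that unfolding num_legs_def by auto
  then have "(\<Sum>i\<in>{1..n}. xlog (m i)) = 0" by (intro sum.neutral) (auto simp: xlog_def)
  then show ?thesis using True by (simp add: xlog_def)
next
  case False
  let ?M = "real (num_legs n m)"
  have "?M * leg_entropy n m = (\<Sum>i \<in> {i \<in> {1..n}. m i > 0}. real (m i) * log 2 ?M - xlog (m i))"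
    unfolding leg_entropy_def sum_distrib_left
    by (rule sum.cong) (use False in \<open>auto simp: log_divide xlog_def algebra_simps\<close>)
  also have "\<dots> = (\<Sum>i \<in> {1..n}. real (m i) * log 2 ?M - xlog (m i))"
    by (rule sum.mono_neutral_left) (auto simp: xlog_def)
  also have "\<dots> = ?M * log 2 ?M - (\<Sum>i\<in>{1..n}. xlog (m i))"
    unfolding sum_subtractf sum_distrib_right[symmetric] num_legs_def by simp
  finally show ?thesis unfolding xlog_def .
qed

end

context caterpillar
begin

section \<open>The linear lower bound\<close>

text \<open>A rotation gives \<open>y\<close> at most the new ancestor \<open>c\<close>. The
  potential counts the vertices that are not ancestors of \<open>y\<close>, since
  \<open>potential_bound\<close> controls decreases.\<close>

lemma depth_bound:
  assumes A: "anc_order CV A" and B: "anc_order CV B" and r: "reachable k A B"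
  shows "card {x. (x, y) \<in> B} \<le> card {x. (x, y) \<in> A} + k"
proof -
  let ?f = "\<lambda>A. card CV - card {x. (x, y) \<in> A}"
  have fin: "finite {x. (x, y) \<in> A}" "card {x. (x, y) \<in> A} \<le> card CV" if "anc_order CV A" for A
  proof -
    have "{x. (x, y) \<in> A} \<subseteq> CV" using ao_in[OF that] by blast
    then show "finite {x. (x, y) \<in> A}" "card {x. (x, y) \<in> A} \<le> card CV"
      using finite_verts by (auto intro: finite_subset card_mono)
  qed
  have "?f A \<le> ?f B + 1 * k"
  proof (rule potential_bound[OF _ A B r])
    fix A p c assume A: "anc_order CV A" and pc: "(p, c) \<in> hasse A"
    have "{x. (x, y) \<in> rotated A p c} \<subseteq> insert c {x. (x, y) \<in> A}" unfolding rotated_iff by auto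
    then have "card {x. (x, y) \<in> rotated A p c} \<le> card (insert c {x. (x, y) \<in> A})"
      using fin(1)[OF A] by (intro card_mono) auto
    also have "\<dots> \<le> Suc (card {x. (x, y) \<in> A})" using fin(1)[OF A] by (simp add: card_insert_if)
    finally show "?f A \<le> ?f (rotated A p c) + 1" by linarith
  qed
  then show ?thesis using fin(2)[OF A] fin(2)[OF B] by linarith
qed

text \<open>In the first tree \<open>Spine 1\<close> is the root. In the second, all legs come first
  and then the spine from \<open>n\<close> down to \<open>1\<close>, so that every vertex is an
  ancestor of \<open>Spine 1\<close>.\<close>

lemma cat_diameter_ge_card: "enat (n + num_legs n m - 1) \<le> cat_diameter n m"
proof -
  \<comment> \<open>\<open>K\<close> exceeds every leg index, so foot and index can be read off
    \<open>code x\<close> by division; all codes stay below \<open>Suc n * K\<close>, where the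
    spine ranks of \<open>d2\<close> start.\<close>
  define K where "K = Suc (num_legs n m)"
  have mle: "m i < K" if "1 \<le> i" "i \<le> n" for i
    using that member_le_sum[of i "{1..n}" m] unfolding num_legs_def K_def by simp
  define h where "h x = (case x of Spine i \<Rightarrow> 0 | Leg i j \<Rightarrow> j)" for x
  define code where "code x = foot x * K + h x" for x
  have hl: "h x < K" if "x \<in> CV" for x
    using that mle unfolding h_def cat_verts_def by fastforce
  have code_inj: "x = y" if "x \<in> CV" "y \<in> CV" "code x = code y" for x y
  proof -
    have "code z div K = foot z \<and> code z mod K = h z" if "z \<in> CV" for z
      unfolding code_def using hl[OF that] by simp
    then have "foot x = foot y" "h x = h y" using that by metis+
    then show ?thesis using that(1,2) unfolding h_def cat_verts_def by auto
  qed
  have code_less: "code x < Suc n * K" if "x \<in> CV" for x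
  proof -
    have "code x < foot x * K + K" using hl[OF that] unfolding code_def by simp
    also have "\<dots> = Suc (foot x) * K" by simp
    also have "\<dots> \<le> Suc n * K" using foot_range[OF that] by (intro mult_right_mono) auto
    finally show ?thesis .
  qed
  define d1 where "d1 x = (if x = Spine 1 then 0 else Suc (code x))" for x
  define d2 where "d2 x = (case x of Leg i j \<Rightarrow> code x | Spine i \<Rightarrow> Suc n * K + (n - i))" for x
  have i1: "inj_on d1 CV"
    using code_inj unfolding d1_def inj_on_def by (auto split: if_splits)
  have i2: "inj_on d2 CV"
  proof (rule inj_onI)
    fix x y assume xy: "x \<in> CV" "y \<in> CV" "d2 x = d2 y"
    show "x = y"
    proof (cases x; cases y)
      fix i i' assume "x = Spine i" "y = Spine i'"
      then show ?thesis using xy unfolding d2_def by auto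
    next
      fix i i' j' assume h: "x = Spine i" "y = Leg i' j'"
      have "d2 x \<ge> Suc n * K" "d2 y = code y" unfolding d2_def h by auto
      then show ?thesis using xy code_less[OF xy(2)] by linarith
    next
      fix i i' j' assume h: "y = Spine i" "x = Leg i' j'"
      have "d2 y \<ge> Suc n * K" "d2 x = code x" unfolding d2_def h by auto
      then show ?thesis using xy code_less[OF xy(1)] by linarith
    next
      fix i j i' j' assume h: "x = Leg i j" "y = Leg i' j'"
      have "code x = code y" using xy(3) unfolding d2_def h by simp
      then show ?thesis by (rule code_inj[OF xy(1,2)])
    qed
  qed
  have s1: "{x. (x, Spine 1) \<in> prio d1} = {Spine 1}"
  proof -
    have "x = Spine 1" if "(x, Spine 1) \<in> prio d1" for x
      using that unfolding prio_cat_iff d1_def by (simp split: if_splits)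
    moreover have "(Spine 1, Spine 1) \<in> prio d1" using n_pos unfolding prio_cat_iff by simp
    ultimately show ?thesis by blast
  qed
  have s2: "{x. (x, Spine 1) \<in> prio d2} = CV"
  proof -
    have "(x, Spine 1) \<in> prio d2" if x: "x \<in> CV" for x
    proof -
      have "d2 x \<le> d2 (Spine l)" if "between (foot x) l 1" for l
      proof (cases x)
        case (Spine i)
        then show ?thesis using that x unfolding d2_def between_def by auto
      next
        case (Leg i j)
        then show ?thesis using code_less[OF x] unfolding d2_def by simp
      qed
      moreover have "between (foot x) 1 1" using foot_range[OF x] unfolding between_def by simp
      ultimately show ?thesis using x n_pos unfolding prio_cat_iff by simp
    qed
    then show ?thesis unfolding prio_cat_iff by blast
  qed
  show ?thesis
  proof (rule cat_diameter_ge[OF prio_ao[OF i1] prio_ao[OF i2]])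
    fix k assume "reachable k (prio d1) (prio d2)"
    then have "card {x. (x, Spine 1) \<in> prio d2} \<le> card {x. (x, Spine 1) \<in> prio d1} + k"
      by (rule depth_bound[OF prio_ao[OF i1] prio_ao[OF i2]])
    then show "n + num_legs n m - 1 \<le> k" unfolding s1 s2 card_cat_verts by simp
  qed
qed

section \<open>The entropy lower bound\<close>

text \<open>All legs are ranked before the spine, in the order of \<open>L\<close>. Since interior
  vertices of paths are spine vertices, the legs form a chain of common ancestors of the whole
  spine, and alternating subsequences of \<open>L\<close> become alternating chains.\<close>

lemma alternating_order:
  assumes L: "distinct L" "set L = legs 1 n"
  obtains A where "anc_order CV A"
    "\<And>v. split_in 1 n v \<Longrightarrow> interleaves L v \<Longrightarrow> 2 * min_weight v \<le> alt A v"
proof -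
  define d where "d x = (if x \<in> set L then inv_into {..<length L} (\<lambda>i. L ! i) x else length L + foot x)" for x
  have bij: "bij_betw ((!) L) {..<length L} (set L)" using L(1) by (intro bij_betw_nth) auto
  have dL: "d (L ! i) = i" if "i < length L" for i
    using that bij inv_into_f_f[of "(!) L" "{..<length L}" i] unfolding d_def bij_betw_def by auto
  have dlt: "d x < length L" if x: "x \<in> set L" for x
    using x dL by (metis in_set_conv_nth)
  have leg: "x \<in> set L" if "x \<in> CV" "\<And>i. x \<noteq> Spine i" for x
    using that unfolding L(2) legs_def cat_verts_def by auto
  have nL: "Spine i \<notin> set L" for i unfolding L(2) legs_def by auto
  have dS: "d (Spine i) = length L + i" for i unfolding d_def using nL by simp
  have LV: "set L \<subseteq> CV" unfolding L(2) legs_def cat_verts_def by auto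
  have inj: "inj_on d CV"
  proof (rule inj_onI)
    fix x y assume xy: "x \<in> CV" "y \<in> CV" "d x = d y"
    have c: "(\<exists>i. z = Spine i) \<or> z \<in> set L" if "z \<in> CV" for z using leg[OF that] by blast
    consider i j where "x = Spine i" "y = Spine j" | i where "x = Spine i" "y \<in> set L"
      | i where "y = Spine i" "x \<in> set L" | "x \<in> set L" "y \<in> set L"
      using c[OF xy(1)] c[OF xy(2)] by blast
    then show "x = y"
    proof cases
      case 4
      then show ?thesis using xy(3) dL by (metis in_set_conv_nth)
    qed (use xy(3) dS dlt in fastforce)+
  qed
  let ?A = "prio d"
  have A: "anc_order CV ?A" by (rule prio_ao[OF inj])
  have in1: "(x, y) \<in> ?A" if "x \<in> set L" "y \<in> CV" "d x \<le> d y" for x y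
    using that LV dlt[OF that(1)] unfolding prio_cat_iff dS by auto
  have "2 * min_weight v \<le> alt ?A v" if v: "split_in 1 n v" and I: "interleaves L v" for v
  proof -
    obtain a k b where v': "v = (a, k, b)" by (cases v) auto
    obtain xs where xs: "subseq xs L" "\<forall>x\<in>set xs. a \<le> foot x \<and> foot x \<le> b"
      "successively (\<lambda>x y. (foot x \<le> k) \<noteq> (foot y \<le> k)) xs" "length xs = 2 * min_weight (a, k, b)"
      using I unfolding interleaves_def v' by blast
    have kn: "1 \<le> k" "Suc k \<le> n" using v unfolding v' split_in_def by auto
    have xL: "x \<in> set L" if "x \<in> set xs" for x using list_emb_set[OF xs(1) that] by metis
    have top: "(x, Spine i) \<in> ?A" if "x \<in> set xs" "1 \<le> i" "i \<le> n" for x i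
      by (rule in1[OF xL[OF that(1)]]) (use dlt[OF xL[OF that(1)]] dS that in auto)
    have "sorted_wrt (\<lambda>x y. (x, y) \<in> ?A \<and> x \<noteq> y) L"
      unfolding sorted_wrt_iff_nth_less
    proof (intro allI impI)
      fix i j assume ij: "i < j" "j < length L"
      then have "L ! i \<in> set L" "L ! j \<in> CV" using LV nth_mem by auto
      then show "(L ! i, L ! j) \<in> ?A \<and> L ! i \<noteq> L ! j"
        using in1[of "L ! i" "L ! j"] dL[of i] dL[of j] ij by auto
    qed
    then have "sorted_wrt (\<lambda>x y. (x, y) \<in> ?A \<and> x \<noteq> y) xs" by (rule sorted_wrt_subseq[OF xs(1)])
    then have "alt_chain ?A v xs"
      unfolding alt_chain_def v' using xs(2,3) top kn by auto
    then show ?thesis using alt_ge[OF A] xs(4) v' by fastforce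
  qed
  then show ?thesis using that[OF A] by blast
qed

text \<open>The legs are ranked first, sorted by foot, followed by the spine from \<open>1\<close>
  to \<open>n\<close>. In an alternating chain come legs of the left side, then legs of the right
  side, then spine vertices up to \<open>Spine k\<close>, which are on the left again: three groups,
  numbered by \<open>g\<close>, each contributing at most one element.\<close>

lemma sorted_order:
  obtains A where "anc_order CV A" "\<And>v. split_in 1 n v \<Longrightarrow> alt A v \<le> 3"
proof -
  let ?K = "Suc (num_legs n m)"
  have mle: "m i < ?K" if "1 \<le> i" "i \<le> n" for i
    using that member_le_sum[of i "{1..n}" m] unfolding num_legs_def by simp
  define d where "d x = (case x of Leg i j \<Rightarrow> i * ?K + j | Spine i \<Rightarrow> Suc n * ?K + i)" for x
  have dleg: "d (Leg i j) < Suc i * ?K" if "Leg i j \<in> CV" for i j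
    using that mle[of i] unfolding d_def by simp
  have dleg_mono: "i \<le> i'" if "Leg i j \<in> CV" "Leg i' j' \<in> CV" "d (Leg i j) \<le> d (Leg i' j')" for i j i' j'
  proof (rule ccontr)
    assume "\<not> i \<le> i'"
    then have "Suc i' * ?K \<le> i * ?K" by (intro mult_right_mono) auto
    also have "\<dots> \<le> d (Leg i j)" unfolding d_def by simp
    finally show False using dleg[OF that(2)] that(3) by simp
  qed
  have dleg_spine: "d (Leg i j) < d (Spine i')" if "Leg i j \<in> CV" for i j i'
  proof -
    have "Suc i * ?K \<le> Suc n * ?K" using that by (intro mult_right_mono) auto
    then show ?thesis using dleg[OF that] unfolding d_def by simp
  qed
  have inj: "inj_on d CV"
  proof (rule inj_onI)
    fix x y assume xy: "x \<in> CV" "y \<in> CV" "d x = d y"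
    show "x = y"
    proof (cases x; cases y)
      fix i i' assume "x = Spine i" "y = Spine i'"
      then show ?thesis using xy unfolding d_def by auto
    next
      fix i i' j' assume "x = Spine i" "y = Leg i' j'"
      then show ?thesis using xy dleg_spine[of i' j' i] by simp
    next
      fix i i' j' assume "y = Spine i" "x = Leg i' j'"
      then show ?thesis using xy dleg_spine[of i' j' i] by simp
    next
      fix i j i' j' assume h: "x = Leg i j" "y = Leg i' j'"
      then have "i = i'" using dleg_mono[of i j i' j'] dleg_mono[of i' j' i j] xy by (metis le_antisym order_refl)
      then show ?thesis using xy h unfolding d_def by simp
    qed
  qed
  let ?A = "prio d"
  have A: "anc_order CV ?A" by (rule prio_ao[OF inj])
  have "alt ?A v \<le> 3" if v: "split_in 1 n v" for v
  proof -
    obtain a k b where v': "v = (a, k, b)" by (cases v) auto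
    obtain xs where xs: "alt_chain ?A v xs" "length xs = alt ?A v" using alt_ex[OF A] by metis
    note xs' = xs(1)[unfolded alt_chain_def v', simplified]
    define g :: "cat_vertex \<Rightarrow> nat" where
      "g x = (case x of Leg i j \<Rightarrow> if i \<le> k then 0 else 1 | Spine i \<Rightarrow> 2)" for x
    have g2: "g x \<le> 2" for x unfolding g_def by (cases x) auto
    have sp: "i \<le> k" if "Spine i \<in> set xs" for i
    proof -
      have "(Spine i, Spine k) \<in> ?A" using xs' that by blast
      then show ?thesis unfolding prio_cat_iff d_def by simp
    qed
    have side: "foot x \<le> k \<longleftrightarrow> g x \<noteq> 1" if "x \<in> set xs" for x
      using sp that unfolding g_def by (cases x) auto
    have mono: "g x \<le> g y" if "x \<in> set xs" "y \<in> set xs" "(x, y) \<in> ?A" for x y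
    proof -
      have V: "x \<in> CV" "y \<in> CV" "d x \<le> d y" using that(3) unfolding prio_cat_iff by blast+
      show ?thesis
      proof (cases x; cases y)
        fix i i' assume "x = Spine i" "y = Spine i'"
        then show ?thesis unfolding g_def by simp
      next
        fix i i' j' assume "x = Spine i" "y = Leg i' j'"
        then show ?thesis using V dleg_spine[of i' j' i] by simp
      next
        fix i i' j' assume "y = Spine i" "x = Leg i' j'"
        then show ?thesis unfolding g_def by simp
      next
        fix i j i' j' assume "x = Leg i j" "y = Leg i' j'"
        then show ?thesis using dleg_mono[of i j i' j'] V unfolding g_def by auto
      qed
    qed
    have "\<not> length xs > 3"
    proof
      assume len: "length xs > 3"
      then have "Suc (Suc (Suc (Suc 0))) \<le> length xs" by simp
      then obtain x0 x1 x2 x3 ys where e: "xs = x0 # x1 # x2 # x3 # ys"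
        unfolding Suc_le_length_iff by auto
      have "(x0, x1) \<in> ?A" "(x1, x2) \<in> ?A" "(x2, x3) \<in> ?A" using xs' unfolding e by auto
      then have "g x0 \<le> g x1" "g x1 \<le> g x2" "g x2 \<le> g x3" using mono unfolding e by auto
      moreover have "(g x0 \<noteq> 1) \<noteq> (g x1 \<noteq> 1)" "(g x1 \<noteq> 1) \<noteq> (g x2 \<noteq> 1)" "(g x2 \<noteq> 1) \<noteq> (g x3 \<noteq> 1)"
        using xs' side[of x0] side[of x1] side[of x2] side[of x3] unfolding e by auto
      ultimately show False using g2[of x3] by linarith
    qed
    then show ?thesis using xs(2) by simp
  qed
  then show ?thesis using that[OF A] by blast
qed

text \<open>The potential starts at \<open>2 * sum min_weight S\<close> or more, ends at no more
  than three per split, and drops by at most two per rotation; halving gives the term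
  \<open>(3 * n) div 2\<close>. The factor 4 is inherited from
  \<open>spliced_exists\<close>.\<close>

lemma cat_diameter_ge_entropy:
  assumes "cat_diameter n m = enat \<delta>"
  shows "real (num_legs n m) * leg_entropy n m \<le> 4 * real (num_legs n m) + 6 * real n + 4 * real \<delta>"
proof -
  obtain S L where SL: "spliced 1 n S L"
    "xlog (weight 1 n) \<le> (\<Sum>i\<in>{1..n}. xlog (m i)) + 4 * real (weight 1 n) + 4 * real (sum min_weight S)"
    using spliced_exists[OF n_pos] by blast
  have S: "finite S" "card S \<le> n - 1" "\<And>v. v \<in> S \<Longrightarrow> split_in 1 n v" "\<And>v. v \<in> S \<Longrightarrow> interleaves L v"
    "\<And>v w i j. v \<in> S \<Longrightarrow> w \<in> S \<Longrightarrow> crosses v i j \<Longrightarrow> crosses w i j \<Longrightarrow> v = w" "distinct L" "set L = legs 1 n"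
    using SL(1) unfolding spliced_def by blast+
  obtain A where A: "anc_order CV A" "\<And>v. split_in 1 n v \<Longrightarrow> interleaves L v \<Longrightarrow> 2 * min_weight v \<le> alt A v"
    using alternating_order[OF S(6,7)] by metis
  obtain B where B: "anc_order CV B" "\<And>v. split_in 1 n v \<Longrightarrow> alt B v \<le> 3"
    using sorted_order by metis
  have bound: "sum min_weight S - (3 * n) div 2 \<le> k" if r: "reachable k A B" for k
  proof -
    have "2 * sum min_weight S = (\<Sum>v\<in>S. 2 * min_weight v)" by (rule sum_distrib_left)
    also have "\<dots> \<le> (\<Sum>v\<in>S. alt A v)" using A(2) S by (intro sum_mono) auto
    also have "\<dots> \<le> (\<Sum>v\<in>S. alt B v) + 2 * k"
      using potential_bound[where f = "\<lambda>A. \<Sum>v\<in>S. alt A v", OF sum_alt_rotated A(1) B(1) r] S by blast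
    also have "(\<Sum>v\<in>S. alt B v) \<le> (\<Sum>v\<in>S. 3)" using B(2) S by (intro sum_mono) auto
    also have "\<dots> \<le> 3 * n" using S(2) by simp
    finally show ?thesis by linarith
  qed
  have "enat (sum min_weight S - (3 * n) div 2) \<le> cat_diameter n m"
    by (rule cat_diameter_ge[OF A(1) B(1) bound])
  then have "sum min_weight S - (3 * n) div 2 \<le> \<delta>" unfolding assms by simp
  then have "2 * sum min_weight S \<le> 3 * n + 2 * \<delta>" by linarith
  then have "2 * real (sum min_weight S) \<le> 3 * real n + 2 * real \<delta>"
    by (metis (mono_tags, lifting) of_nat_add of_nat_le_iff of_nat_mult of_nat_numeral)
  moreover have "weight 1 n = num_legs n m" unfolding weight_def num_legs_def by simp
  ultimately show ?thesis using SL(2) unfolding entropy_xlog by simp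
qed

text \<open>With at least two vertices, \<open>n + m - 1 \<le> \<delta>\<close> gives
  \<open>n + m \<le> 2 * \<delta>\<close>, where \<open>m\<close> is the number of legs. Then
  \<open>n + m * (H + 1) \<le> 7 * (n + m) + 4 * \<delta> \<le> 18 * \<delta>\<close>.\<close>

lemma lower_bound:
  assumes "cat_diameter n m = enat \<delta>" "n + num_legs n m \<ge> 2"
  shows "1 / 18 * (real n + real (num_legs n m) * (leg_entropy n m + 1)) \<le> real \<delta>"
proof -
  have "n + num_legs n m \<le> \<delta> + 1" using cat_diameter_ge_card unfolding assms(1) by simp
  then have "real n + real (num_legs n m) \<le> 2 * real \<delta>" using assms(2) by linarith
  then show ?thesis using cat_diameter_ge_entropy[OF assms(1)] by (simp add: algebra_simps)
qed

end

section \<open>Upper bound\<close>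

text \<open>For \<open>i\<close> in \<open>Z\<close>, the ancestors of \<open>i\<close>, itself
  included, in the Cartesian tree of \<open>\<rho>\<close> on \<open>Z\<close>.\<close>

definition bst_anc :: "(nat \<Rightarrow> nat) \<Rightarrow> nat set \<Rightarrow> nat \<Rightarrow> nat set" where
  "bst_anc \<rho> Z i = {j \<in> Z. \<forall>l\<in>Z. between i l j \<longrightarrow> \<rho> j \<le> \<rho> l}"

text \<open>With weighted medians as roots, the weight of a subtree at least halves with every
  level. The factor 2 arises because the depth counts \<open>i\<close> itself, so the root has depth
  one.\<close>

lemma median_bst:
  fixes w :: "nat \<Rightarrow> nat"
  assumes "finite Z" "\<forall>i\<in>Z. w i > 0"
  shows "\<exists>\<rho> :: nat \<Rightarrow> nat. inj_on \<rho> Z \<and> (\<forall>i\<in>Z. w i * 2 ^ card (bst_anc \<rho> Z i) \<le> 2 * sum w Z)"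
  using assms
proof (induction "card Z" arbitrary: Z rule: less_induct)
  case less
  show ?case
  proof (cases "Z = {}")
    case False
    then have "sum w Z > 0" using less.prems by (intro sum_pos) auto
    then obtain k where k: "k \<in> Z" "w k > 0" "2 * sum w {i \<in> Z. i < k} \<le> sum w Z" "2 * sum w {i \<in> Z. i > k} \<le> sum w Z"
      by (rule weighted_median[OF less.prems(1)])
    let ?L = "{i \<in> Z. i < k}" and ?R = "{i \<in> Z. i > k}"
    have "card ?L < card Z" "card ?R < card Z"
      using k(1) less.prems(1) by (intro psubset_card_mono; auto)+
    then obtain f g :: "nat \<Rightarrow> nat" where f: "inj_on f ?L" "\<forall>i\<in>?L. w i * 2 ^ card (bst_anc f ?L i) \<le> 2 * sum w ?L"
      and g: "inj_on g ?R" "\<forall>i\<in>?R. w i * 2 ^ card (bst_anc g ?R i) \<le> 2 * sum w ?R"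
      using less.hyps[of ?L] less.hyps[of ?R] less.prems by auto
    \<comment> \<open>The root gets rank \<open>0\<close>. Odd ranks on the left and positive even
      ranks on the right keep \<open>\<rho>\<close> injective and preserve the order within each
      side; comparisons across the root do not affect ancestors.\<close>
    define \<rho> where "\<rho> i = (if i = k then 0 else if i < k then 2 * f i + 1 else 2 * g i + 2)" for i
    have fin: "finite (bst_anc h S i)" if "finite S" for h :: "nat \<Rightarrow> nat" and S i
      unfolding bst_anc_def using that by simp
    have "inj_on \<rho> Z"
    proof (rule inj_onI)
      fix x y assume xy: "x \<in> Z" "y \<in> Z" "\<rho> x = \<rho> y"
      have par: "2 * u + 1 \<noteq> 2 * v + 2" "2 * v + 2 \<noteq> 2 * u + 1" for u v :: nat by presburger+
      show "x = y"
      proof (cases "x = k \<or> y = k")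
        case True then show ?thesis using xy(3) unfolding \<rho>_def by (auto split: if_splits)
      next
        case False
        then have "(x < k \<and> y < k \<and> f x = f y) \<or> (x > k \<and> y > k \<and> g x = g y)"
          using xy(3) par unfolding \<rho>_def by (auto split: if_splits)
        then show ?thesis using xy inj_onD[OF f(1), of x y] inj_onD[OF g(1), of x y] by auto
      qed
    qed
    moreover have "w i * 2 ^ card (bst_anc \<rho> Z i) \<le> 2 * sum w Z" if i: "i \<in> Z" for i
    proof -
      have top: "j = k" if "j \<in> bst_anc \<rho> Z i" "between i k j" for j
        using that k(1) unfolding bst_anc_def \<rho>_def by (auto split: if_splits)
      consider "i = k" | "i < k" | "i > k" by linarith
      then show ?thesis
      proof cases
        case 1
        have "between i k j" for j using 1 unfolding between_def by linarith
        then have "bst_anc \<rho> Z i \<subseteq> {k}" using top by blast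
        then have "card (bst_anc \<rho> Z i) \<le> 1" using card_mono[of "{k}"] by fastforce
        then have "(2::nat) ^ card (bst_anc \<rho> Z i) \<le> 2 ^ 1" by (intro power_increasing) auto
        then have "w i * 2 ^ card (bst_anc \<rho> Z i) \<le> w i * 2" by simp
        moreover have "w i \<le> sum w Z" using member_le_sum[of i Z w] i less.prems(1) by simp
        ultimately show ?thesis by linarith
      next
        case 2
        have "j \<in> insert k (bst_anc f ?L i)" if j: "j \<in> bst_anc \<rho> Z i" for j
        proof (cases "j < k")
          case True
          have "f j \<le> f l" if "l \<in> ?L" "between i l j" for l
          proof -
            have "\<rho> j \<le> \<rho> l" using j that unfolding bst_anc_def by blast
            then show ?thesis using True that unfolding \<rho>_def by simp
          qed
          then show ?thesis using j True unfolding bst_anc_def by blast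
        next
          case False then show ?thesis using top[OF j] 2 by (simp add: between_def)
        qed
        then have "card (bst_anc \<rho> Z i) \<le> card (insert k (bst_anc f ?L i))"
          using fin less.prems(1) by (intro card_mono) auto
        also have "\<dots> \<le> Suc (card (bst_anc f ?L i))" using fin less.prems(1) by (simp add: card_insert_if)
        finally have "(2::nat) ^ card (bst_anc \<rho> Z i) \<le> 2 ^ Suc (card (bst_anc f ?L i))"
          by (intro power_increasing) auto
        then have "w i * 2 ^ card (bst_anc \<rho> Z i) \<le> w i * 2 ^ Suc (card (bst_anc f ?L i))"
          by (rule mult_le_mono2)
        moreover have "w i * 2 ^ card (bst_anc f ?L i) \<le> 2 * sum w ?L" using f(2) i 2 by auto
        moreover have "w i * 2 ^ Suc (card (bst_anc f ?L i)) = 2 * (w i * 2 ^ card (bst_anc f ?L i))" by simp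
        ultimately show ?thesis using k(3) by linarith
      next
        case 3
        have "j \<in> insert k (bst_anc g ?R i)" if j: "j \<in> bst_anc \<rho> Z i" for j
        proof (cases "j > k")
          case True
          have "g j \<le> g l" if "l \<in> ?R" "between i l j" for l
          proof -
            have "\<rho> j \<le> \<rho> l" using j that unfolding bst_anc_def by blast
            then show ?thesis using True that unfolding \<rho>_def by simp
          qed
          then show ?thesis using j True unfolding bst_anc_def by blast
        next
          case False then show ?thesis using top[OF j] 3 by (simp add: between_def)
        qed
        then have "card (bst_anc \<rho> Z i) \<le> card (insert k (bst_anc g ?R i))"
          using fin less.prems(1) by (intro card_mono) auto
        also have "\<dots> \<le> Suc (card (bst_anc g ?R i))" using fin less.prems(1) by (simp add: card_insert_if)
        finally have "(2::nat) ^ card (bst_anc \<rho> Z i) \<le> 2 ^ Suc (card (bst_anc g ?R i))"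
          by (intro power_increasing) auto
        then have "w i * 2 ^ card (bst_anc \<rho> Z i) \<le> w i * 2 ^ Suc (card (bst_anc g ?R i))"
          by (rule mult_le_mono2)
        moreover have "w i * 2 ^ card (bst_anc g ?R i) \<le> 2 * sum w ?R" using g(2) i 3 by auto
        moreover have "w i * 2 ^ Suc (card (bst_anc g ?R i)) = 2 * (w i * 2 ^ card (bst_anc g ?R i))" by simp
        ultimately show ?thesis using k(4) by linarith
      qed
    qed
    ultimately show ?thesis by blast
  qed simp
qed

context caterpillar
begin

section \<open>A common meeting point: the spine as a path\<close>

definition legs_low :: "cat_vertex rel \<Rightarrow> bool" where
  "legs_low A \<longleftrightarrow> (\<forall>i j y. (Leg i j, y) \<in> A \<longrightarrow> y = Leg i j)"

definition spine_path :: "cat_vertex rel \<Rightarrow> bool" where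
  "spine_path A \<longleftrightarrow> anc_order CV A \<and> legs_low A \<and> (\<forall>i\<in>{1..n}. (Spine i, Spine n) \<in> A)"

text \<open>For \<open>j < i\<close>, the vertex \<open>Spine i\<close> lies between
  \<open>Spine j\<close> and \<open>Spine n\<close>, so \<open>Spine j\<close> is above it. Both
  trees thus order the spine alike, and a leg, having no proper descendants, belongs to no
  inversion.\<close>

lemma spine_path_unique:
  assumes A: "spine_path A" and B: "spine_path B"
  shows "A = B"
proof -
  have aoA: "anc_order CV A" and aoB: "anc_order CV B" using A B unfolding spine_path_def by auto
  have lt: "i < j" if C: "spine_path C" and h: "(Spine i, Spine j) \<in> C" "i \<noteq> j" for C i j
  proof (rule ccontr)
    assume "\<not> i < j"
    then have ji: "j < i" using h(2) by simp
    have ao: "anc_order CV C" using C unfolding spine_path_def by blast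
    have V: "Spine i \<in> CV" "Spine j \<in> CV" using ao_in[OF ao h(1)] by blast+
    then have "(Spine j, Spine n) \<in> C" using C unfolding spine_path_def by simp
    moreover have "Spine i \<in> cpath (Spine j) (Spine n)"
      using ji V unfolding cpath_Spine by (auto simp: between_def)
    ultimately have "(Spine j, Spine i) \<in> C" by (rule ao_path[OF ao])
    then show False using ao_antisym[OF ao h(1)] h(2) by simp
  qed
  have "inversions A B = {}"
  proof -
    have False if xy: "(x, y) \<in> A" "(y, x) \<in> B" "x \<noteq> y" for x y
    proof -
      obtain i where i: "x = Spine i" using xy A unfolding spine_path_def legs_low_def by (cases x) auto
      obtain j where j: "y = Spine j" using xy B unfolding spine_path_def legs_low_def by (cases y) auto
      show False using lt[OF A, of i j] lt[OF B, of j i] xy i j by auto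
    qed
    then show ?thesis unfolding inversions_def by auto
  qed
  then show ?thesis by (rule inversions_empty[OF aoA aoB])
qed

text \<open>Each rotation makes one more spine vertex an ancestor of the last spine vertex.\<close>

lemma reach_spine_path:
  assumes "anc_order CV A" "legs_low A"
  shows "\<exists>C. spine_path C \<and> reachable (n - card {i \<in> {1..n}. (Spine i, Spine n) \<in> A}) A C \<and>
    reachable (n - card {i \<in> {1..n}. (Spine i, Spine n) \<in> A}) C A"
  using assms
proof (induction "n - card {i \<in> {1..n}. (Spine i, Spine n) \<in> A}" arbitrary: A rule: less_induct)
  case less
  note A = less.prems(1)
  let ?S = "\<lambda>A. {i \<in> {1..n}. (Spine i, Spine n) \<in> A}"
  let ?N = "{i \<in> {1..n}. (Spine i, Spine n) \<notin> A}"
  show ?case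
  proof (cases "?N = {}")
    case True
    then have "spine_path A" unfolding spine_path_def using less.prems by blast
    then show ?thesis using reachable_refl by blast
  next
    case False
    define dep where "dep i = card {x. (x, Spine i) \<in> A}" for i
    obtain i where i: "i \<in> ?N" "\<And>j. j \<in> ?N \<Longrightarrow> dep i \<le> dep j"
      using False ex_has_least_nat[of "\<lambda>i. i \<in> ?N" _ dep] by blast
    have iV: "Spine i \<in> CV" "Spine n \<in> CV" using i(1) n_pos by auto
    have iS: "(Spine i, Spine n) \<notin> A" using i(1) by blast
    obtain t where t: "t \<in> cpath (Spine i) (Spine n)" "(t, Spine i) \<in> A" "(t, Spine n) \<in> A"
      using ao_top[OF A iV] by metis
    have "t \<noteq> Spine i" using t(3) iS by blast
    then obtain p where p: "(p, Spine i) \<in> hasse A" using hasse_parent_ex[OF A finite_verts t(2)] by metis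
    have pA: "(p, Spine i) \<in> A" "p \<noteq> Spine i" and par: "\<And>z. (z, Spine i) \<in> A \<Longrightarrow> z \<noteq> Spine i \<Longrightarrow> (z, p) \<in> A"
      using p unfolding hasse_iff[OF A] by blast+
    obtain j where j: "p = Spine j" using pA less.prems(2) unfolding legs_low_def by (cases p) auto
    have jn: "j \<in> {1..n}" using ao_in[OF A pA(1)] j by simp
    have "dep j < dep i" unfolding dep_def using ao_card_less[OF A finite_verts pA] j by simp
    \<comment> \<open>Since legs are leaves, the parent is a spine vertex; being less deep than
      \<open>Spine i\<close>, it is an ancestor of \<open>Spine n\<close> by the choice of
      \<open>i\<close>.\<close>
    then have pn: "(p, Spine n) \<in> A" using i(2)[of j] jn j by fastforce
    have tp: "t = p"
      using par[OF t(2) \<open>t \<noteq> Spine i\<close>] ao_convex[OF A pA(1) pn t(1)] ao_antisym[OF A] by blast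
    \<comment> \<open>As the top of the path, \<open>p\<close> lies between \<open>Spine i\<close>
      and \<open>Spine n\<close>, so \<open>Spine i\<close> is not between the other two. Hence
      \<open>p\<close> remains an ancestor of \<open>Spine n\<close> after the rotation.\<close>
    have cP: "Spine i \<notin> cpath p (Spine n)"
    proof
      assume h: "Spine i \<in> cpath p (Spine n)"
      have "p \<in> cpath (Spine n) (Spine i)" using t(1) tp cpath_sym by simp
      moreover have "Spine i \<in> cpath (Spine n) p" using h cpath_sym by simp
      ultimately show False using cpath_antisym pA(2) by blast
    qed
    let ?A' = "rotated A p (Spine i)"
    have A': "anc_order CV ?A'" by (rule rotated_ao[OF A p])
    have low: "legs_low ?A'" using less.prems(2) unfolding legs_low_def rotated_iff j by auto
    have "insert i (?S A) \<subseteq> ?S ?A'" using i(1) pn cP unfolding rotated_iff j by auto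
    then have "card (insert i (?S A)) \<le> card (?S ?A')" by (intro card_mono) auto
    moreover have "card (insert i (?S A)) = Suc (card (?S A))" using i(1) by simp
    ultimately have c1: "card (?S A) < card (?S ?A')" by simp
    have "card (?S ?A') \<le> card {1..n}" by (intro card_mono) auto
    then have c2: "n - card (?S ?A') < n - card (?S A)" "1 + (n - card (?S ?A')) \<le> n - card (?S A)"
      using c1 by auto
    obtain C where C: "spine_path C" "reachable (n - card (?S ?A')) ?A' C" "reachable (n - card (?S ?A')) C ?A'"
      using less.hyps[OF c2(1) A' low] by blast
    have "reachable (1 + (n - card (?S ?A'))) A C"
      by (rule reachable_trans[OF reachable_rotated[OF A p] C(2)])
    moreover have "reachable (n - card (?S ?A') + 1) C A"
      by (rule reachable_trans[OF C(3) reachable_rotated_back[OF A p]])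
    ultimately have "reachable (n - card (?S A)) A C" "reachable (n - card (?S A)) C A"
      using c2(2) by (auto elim: reachable_mono)
    then show ?thesis using C(1) by blast
  qed
qed

section \<open>Blocks of legless spine vertices\<close>

definition NZ :: "nat set" where
  "NZ = {i \<in> {1..n}. m i > 0}"

text \<open>Constant on each run of legless vertices and larger after every leg-bearing one. For
  \<open>l\<close> in \<open>NZ\<close>, the block just left of \<open>l\<close> has index
  \<open>bid l\<close> and the block just right of it \<open>Suc (bid l)\<close>; blocks may be
  empty.\<close>

definition bid :: "nat \<Rightarrow> nat" where
  "bid i = card {l \<in> NZ. l < i}"

definition blk :: "nat \<Rightarrow> nat set" where
  "blk q = {i \<in> {1..n}. m i = 0 \<and> bid i = q}"

lemma finite_NZ: "finite NZ" unfolding NZ_def by simp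

lemma bid_mono: "i \<le> j \<Longrightarrow> bid i \<le> bid j"
  unfolding bid_def using finite_NZ by (intro card_mono) auto

lemma bid_less: "i < j \<Longrightarrow> i \<in> NZ \<Longrightarrow> bid i < bid j"
  unfolding bid_def using finite_NZ by (intro psubset_card_mono) auto

lemma finite_blk: "finite (blk q)" unfolding blk_def by simp

lemma blk_between:
  assumes "i \<in> blk q" "j \<in> blk q" "between i k j"
  shows "k \<in> blk q"
proof -
  have r: "1 \<le> k" "k \<le> n" using assms unfolding blk_def between_def by auto
  have b: "bid i = q" "bid j = q" "m i = 0" "m j = 0" using assms unfolding blk_def by auto
  have bk: "bid k = q" using bid_mono[of i k] bid_mono[of k j] bid_mono[of j k] bid_mono[of k i] assms(3) b
    unfolding between_def by auto
  have "k \<notin> NZ"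
  proof
    assume k: "k \<in> NZ"
    then have "k \<noteq> i" "k \<noteq> j" using b unfolding NZ_def by auto
    then show False using bid_less[of k i] bid_less[of k j] k bk b assms(3) unfolding between_def by auto
  qed
  then show ?thesis using r bk unfolding blk_def NZ_def by auto
qed

lemma blk_lt:
  assumes "bid i < bid j" "k \<in> blk (bid j)" "l \<in> blk (bid i)"
  shows "l < k"
  using assms bid_mono[of k l] unfolding blk_def by (auto simp: not_less[symmetric])

end

context caterpillar
begin

section \<open>Lifting the ends of a block\<close>

definition lo :: "nat \<Rightarrow> nat" where "lo q = Min (blk q)"

definition hi :: "nat \<Rightarrow> nat" where "hi q = Max (blk q)"

definition top :: "(cat_vertex \<Rightarrow> nat) \<Rightarrow> nat \<Rightarrow> nat" where
  "top d q = arg_min_on (\<lambda>i. d (Spine i)) (blk q)"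

lemma lo_hi:
  assumes "i \<in> blk q"
  shows "lo q \<in> blk q" "lo q \<le> i" "hi q \<in> blk q" "i \<le> hi q"
proof -
  have "blk q \<noteq> {}" using assms by blast
  then show "lo q \<in> blk q" "hi q \<in> blk q" unfolding lo_def hi_def
    using Min_in[OF finite_blk] Max_in[OF finite_blk] by blast+
  show "lo q \<le> i" "i \<le> hi q" unfolding lo_def hi_def
    using Min_le[OF finite_blk assms] Max_ge[OF finite_blk assms] .
qed

lemma top_in:
  assumes "i \<in> blk q"
  shows "top d q \<in> blk q" "d (Spine (top d q)) \<le> d (Spine i)"
  using assms finite_blk arg_min_if_finite(1)[of "blk q" "\<lambda>i. d (Spine i)"]
    arg_min_least[of "blk q" i "\<lambda>i. d (Spine i)"] unfolding top_def by auto

text \<open>The ends of each block of consecutive legless spine vertices are moved up to just below the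
  topmost vertex of the block: then at most three vertices of the block have descendants outside.\<close>

definition lifted :: "(cat_vertex \<Rightarrow> nat) \<Rightarrow> cat_vertex \<Rightarrow> nat" where
  "lifted d x = (case x of Leg i j \<Rightarrow> 3 * d x
     | Spine i \<Rightarrow>
        if m i = 0 \<and> i \<noteq> top d (bid i) \<and> i = hi (bid i) then 3 * d (Spine (top d (bid i))) + 1
        else if m i = 0 \<and> i \<noteq> top d (bid i) \<and> i = lo (bid i) then 3 * d (Spine (top d (bid i))) + 2
        else 3 * d x)"

lemma zero_in_blk: "Spine i \<in> CV \<Longrightarrow> m i = 0 \<Longrightarrow> i \<in> blk (bid i)"
  unfolding blk_def by simp

lemma lifted_cases:
  assumes x: "x \<in> CV"
  obtains "lifted d x = 3 * d x"
  | i where "x = Spine i" "m i = 0" "i \<noteq> top d (bid i)" "i = hi (bid i)" "lifted d x = 3 * d (Spine (top d (bid i))) + 1"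
  | i where "x = Spine i" "m i = 0" "i \<noteq> top d (bid i)" "i = lo (bid i)" "lifted d x = 3 * d (Spine (top d (bid i))) + 2"
proof (cases x)
  case (Spine i)
  let ?a = "m i = 0 \<and> i \<noteq> top d (bid i)"
  consider "?a" "i = hi (bid i)" | "?a" "i = lo (bid i)" "i \<noteq> hi (bid i)" | "\<not> (?a \<and> (i = hi (bid i) \<or> i = lo (bid i)))"
    by blast
  then show ?thesis
  proof cases
    case 1
    then have "lifted d x = 3 * d (Spine (top d (bid i))) + 1" unfolding lifted_def Spine by simp
    then show ?thesis by (intro that(2)[OF Spine]) (use 1 in auto)
  next
    case 2
    then have "lifted d x = 3 * d (Spine (top d (bid i))) + 2" unfolding lifted_def Spine by simp
    then show ?thesis by (intro that(3)[OF Spine]) (use 2 in auto)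
  next
    case 3
    then have "lifted d x = 3 * d x" unfolding lifted_def Spine by auto
    then show ?thesis by (rule that(1))
  qed
next
  case (Leg i j)
  then show ?thesis using that(1) unfolding lifted_def by simp
qed

lemma top_less:
  assumes inj: "inj_on d CV" and i: "i \<in> blk q" "i \<noteq> top d q"
  shows "d (Spine (top d q)) < d (Spine i)"
proof -
  have "top d q \<in> blk q" by (rule top_in(1)[OF i(1)])
  then have "Spine (top d q) \<in> CV" "Spine i \<in> CV" using i(1) unfolding blk_def by auto
  then have "d (Spine (top d q)) \<noteq> d (Spine i)" using inj_onD[OF inj] i(2) by blast
  then show ?thesis using top_in(2)[OF i(1), of d] by simp
qed

lemma lifted_le:
  assumes inj: "inj_on d CV" and x: "x \<in> CV"
  shows "lifted d x \<le> 3 * d x"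
  using x
proof (cases rule: lifted_cases[where d = d])
  case (2 i)
  have "i \<in> blk (bid i)" using zero_in_blk 2(1,2) x by simp
  then show ?thesis using top_less[OF inj, of i "bid i"] 2(1,3,5) by simp
next
  case (3 i)
  have "i \<in> blk (bid i)" using zero_in_blk 3(1,2) x by simp
  then show ?thesis using top_less[OF inj, of i "bid i"] 3(1,3,5) by simp
qed simp

lemma top_blk_eq:
  assumes inj: "inj_on d CV" and "i \<in> blk p" "j \<in> blk q" "d (Spine (top d p)) = d (Spine (top d q))"
  shows "p = q"
proof -
  have t: "top d p \<in> blk p" "top d q \<in> blk q" using top_in(1) assms(2,3) by auto
  then have "Spine (top d p) \<in> CV" "Spine (top d q) \<in> CV" unfolding blk_def by auto
  then have "top d p = top d q" using inj_onD[OF inj assms(4)] by simp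
  then show ?thesis using t unfolding blk_def by auto
qed

text \<open>Tripled ranks leave two free places after each. The residue modulo 3 tells which case of
  \<open>lifted\<close> applies; for a moved vertex the quotient is the rank of the top of its
  block, which determines the block and thereby its end.\<close>

lemma lifted_inj:
  assumes inj: "inj_on d CV"
  shows "inj_on (lifted d) CV"
proof (rule inj_onI)
  fix x y assume x: "x \<in> CV" and y: "y \<in> CV" and e: "lifted d x = lifted d y"
  show "x = y"
    using x
  proof (cases rule: lifted_cases[where d = d])
    case a: 1
    show ?thesis using y
    proof (cases rule: lifted_cases[where d = d])
      case b: 1
      then have "d x = d y" using a e by simp
      then show ?thesis by (rule inj_onD[OF inj _ x y])
    next
      case b: (2 j)
      have False using a b(5) e by presburger
      then show ?thesis ..
    next
      case b: (3 j)
      have False using a b(5) e by presburger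
      then show ?thesis ..
    qed
  next
    case a: (2 i)
    show ?thesis using y
    proof (cases rule: lifted_cases[where d = d])
      case b: (2 j)
      have ij: "i \<in> blk (bid i)" "j \<in> blk (bid j)" using zero_in_blk a(1,2) b(1,2) x y by auto
      have "d (Spine (top d (bid i))) = d (Spine (top d (bid j)))" using a(5) b(5) e by simp
      then have "bid i = bid j" by (rule top_blk_eq[OF inj ij])
      then have "i = j" using a(4) b(4) by metis
      then show ?thesis using a(1) b(1) by simp
    next
      case b: 1
      have False using a(5) b e by presburger
      then show ?thesis ..
    next
      case b: (3 j)
      have False using a(5) b(5) e by presburger
      then show ?thesis ..
    qed
  next
    case a: (3 i)
    show ?thesis using y
    proof (cases rule: lifted_cases[where d = d])
      case b: (3 j)
      have ij: "i \<in> blk (bid i)" "j \<in> blk (bid j)" using zero_in_blk a(1,2) b(1,2) x y by auto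
      have "d (Spine (top d (bid i))) = d (Spine (top d (bid j)))" using a(5) b(5) e by simp
      then have "bid i = bid j" by (rule top_blk_eq[OF inj ij])
      then have "i = j" using a(4) b(4) by metis
      then show ?thesis using a(1) b(1) by simp
    next
      case b: 1
      have False using a(5) b e by presburger
      then show ?thesis ..
    next
      case b: (2 j)
      have False using a(5) b(5) e by presburger
      then show ?thesis ..
    qed
  qed
qed

text \<open>Only a moved end \<open>y\<close> can overtake an ancestor \<open>x\<close>. The top of
  its block then outranks \<open>x\<close>, so it is not between \<open>x\<close> and
  \<open>y\<close>; for a right end, \<open>x\<close> lies to the right of the top. A second right
  end further to the right is impossible, as the top of its block would lie between \<open>x\<close>
  and the first end and outrank \<open>x\<close>. So each \<open>x\<close> is overtaken by at most
  one right end and one left end.\<close>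

lemma inversions_lifted:
  assumes inj: "inj_on d CV"
  shows "card (inversions (prio d) (prio (lifted d))) \<le> 2 * card CV"
proof -
  let ?I = "inversions (prio d) (prio (lifted d))"
  define F where "F = {(x, y) \<in> ?I. \<exists>i. y = Spine i \<and> i \<in> blk (bid i) \<and> i = hi (bid i) \<and>
    top d (bid i) < foot x \<and> d (Spine (top d (bid i))) < d x}"
  define G where "G = {(x, y) \<in> ?I. \<exists>i. y = Spine i \<and> i \<in> blk (bid i) \<and> i = lo (bid i) \<and>
    foot x < top d (bid i) \<and> d (Spine (top d (bid i))) < d x}"
  have finI: "finite ?I" by (rule finite_inversions[OF prio_ao[OF inj]])
  have I: "x \<in> CV \<and> y \<in> CV \<and> d x \<le> d y \<and> lifted d y \<le> lifted d x \<and> x \<noteq> y \<and>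
     (\<forall>k. between (foot x) k (foot y) \<longrightarrow> d x \<le> d (Spine k))" if "(x, y) \<in> ?I" for x y
    using that unfolding inversions_def prio_cat_iff by blast
  have "?I \<subseteq> F \<union> G"
  proof (rule subrelI)
    fix x y assume xy: "(x, y) \<in> ?I"
    have V: "x \<in> CV" "y \<in> CV" and h: "d x \<le> d y" "lifted d y \<le> lifted d x" "x \<noteq> y"
      and pth: "\<And>k. between (foot x) k (foot y) \<Longrightarrow> d x \<le> d (Spine k)" using I[OF xy] by blast+
    have "d x \<noteq> d y" using inj_onD[OF inj _ V] h(3) by blast
    then have lt: "d x < d y" using h(1) by simp
    have ne: "lifted d y \<noteq> lifted d x" using inj_onD[OF lifted_inj[OF inj] _ V] h(3) by metis
    have lx: "lifted d y < 3 * d x" using lifted_le[OF inj V(1)] h(2) ne by simp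
    show "(x, y) \<in> F \<union> G"
      using V(2)
    proof (cases rule: lifted_cases[where d = d])
      case 1 then show ?thesis using lx lt by simp
    next
      case (2 i)
      have b: "i \<in> blk (bid i)" using zero_in_blk[of i] 2(1,2) V(2) by simp
      have dt: "d (Spine (top d (bid i))) < d x" using 2(5) lx by simp
      have "top d (bid i) \<le> i" using lo_hi(4)[OF top_in(1)[OF b, of d]] 2(4) by metis
      moreover have "\<not> between (foot x) (top d (bid i)) i" using pth dt 2(1) by fastforce
      ultimately have "top d (bid i) < foot x" unfolding between_def by auto
      then show ?thesis using xy 2 b dt unfolding F_def by blast
    next
      case (3 i)
      have b: "i \<in> blk (bid i)" using zero_in_blk[of i] 3(1,2) V(2) by simp
      have dt: "d (Spine (top d (bid i))) < d x" using 3(5) lx by simp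
      have "i \<le> top d (bid i)" using lo_hi(2)[OF top_in(1)[OF b, of d]] 3(4) by metis
      moreover have "\<not> between (foot x) (top d (bid i)) i" using pth dt 3(1) by fastforce
      ultimately have "foot x < top d (bid i)" unfolding between_def by auto
      then show ?thesis using xy 3 b dt unfolding G_def by blast
    qed
  qed
  then have "card ?I \<le> card (F \<union> G)" by (intro card_mono) (auto simp: F_def G_def intro: finite_subset[OF _ finI])
  also have "\<dots> \<le> card F + card G" by (rule card_Un_le)
  also have "card F \<le> card CV"
  proof (rule card_inj_on_le[of fst])
    have False if "(x, Spine i) \<in> F" "(x, Spine j) \<in> F" "i < j" for x i j
    proof -
      have i: "(x, Spine i) \<in> ?I" "i \<in> blk (bid i)" "i = hi (bid i)" using that(1) unfolding F_def by auto
      have j: "j \<in> blk (bid j)" "j = hi (bid j)" "top d (bid j) < foot x" "d (Spine (top d (bid j))) < d x"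
        using that(2) unfolding F_def by auto
      have "bid i \<noteq> bid j" using i(3) j(2) that(3) less_irrefl by metis
      then have "bid i < bid j" using bid_mono[of i j] that(3) by simp
      then have "i < top d (bid j)" using blk_lt i(2) top_in(1)[OF j(1)] by blast
      then have "between (foot x) (top d (bid j)) i" using j(3) unfolding between_def by simp
      then have "d x \<le> d (Spine (top d (bid j)))" using I[OF i(1)] by simp
      then show False using j(4) by simp
    qed
    then have "y = z" if "(x, y) \<in> F" "(x, z) \<in> F" for x y z
      using that unfolding F_def by (auto simp: F_def) (metis nat_neq_iff)
    then show "inj_on fst F" by (auto simp: inj_on_def)
    show "fst ` F \<subseteq> CV" using I unfolding F_def by auto
  qed (rule finite_verts)
  also have "card G \<le> card CV"
  proof (rule card_inj_on_le[of fst])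
    have False if "(x, Spine i) \<in> G" "(x, Spine j) \<in> G" "i < j" for x i j
    proof -
      have j: "(x, Spine j) \<in> ?I" "j \<in> blk (bid j)" "j = lo (bid j)" using that(2) unfolding G_def by auto
      have i: "i \<in> blk (bid i)" "i = lo (bid i)" "foot x < top d (bid i)" "d (Spine (top d (bid i))) < d x"
        using that(1) unfolding G_def by auto
      have "bid i \<noteq> bid j" using i(2) j(3) that(3) less_irrefl by metis
      then have "bid i < bid j" using bid_mono[of i j] that(3) by simp
      then have "top d (bid i) < j" using blk_lt j(2) top_in(1)[OF i(1)] by blast
      then have "between (foot x) (top d (bid i)) j" using i(3) unfolding between_def by simp
      then have "d x \<le> d (Spine (top d (bid i)))" using I[OF j(1)] by simp
      then show False using i(4) by simp
    qed
    then have "y = z" if "(x, y) \<in> G" "(x, z) \<in> G" for x y z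
      using that unfolding G_def by (auto simp: G_def) (metis nat_neq_iff)
    then show "inj_on fst G" by (auto simp: inj_on_def)
    show "fst ` G \<subseteq> CV" using I unfolding G_def by auto
  qed (rule finite_verts)
  finally show ?thesis by simp
qed

end

lemma between_ends: "between a a b" "between a b b"
  unfolding between_def by linarith+

context caterpillar
begin

lemma lifted_end_le:
  assumes i: "i \<in> blk q"
  shows "lifted d (Spine (hi q)) < 3 * d (Spine (top d q)) + 3" "lifted d (Spine (lo q)) < 3 * d (Spine (top d q)) + 3"
proof -
  have "hi q \<in> blk q" "lo q \<in> blk q" using lo_hi(1,3)[OF i] by auto
  then have "bid (hi q) = q" "m (hi q) = 0" "bid (lo q) = q" "m (lo q) = 0" unfolding blk_def by auto
  then show "lifted d (Spine (hi q)) < 3 * d (Spine (top d q)) + 3" "lifted d (Spine (lo q)) < 3 * d (Spine (top d q)) + 3"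
    unfolding lifted_def by auto
qed

text \<open>A path from the block to a leg-bearing vertex leaves through an end of the block, and
  both ends are now ranked before all other vertices of the block except the top.\<close>

lemma lifted_block_exits:
  assumes inj: "inj_on d CV" and i: "i \<in> blk q" and j: "j \<in> NZ"
    and ij: "(Spine i, Spine j) \<in> prio (lifted d)"
  shows "i \<in> {top d q, hi q, lo q}"
proof (rule ccontr)
  assume n: "i \<notin> {top d q, hi q, lo q}"
  have bi: "bid i = q" "Spine i \<in> CV" using i unfolding blk_def by auto
  have le: "lifted d (Spine i) \<le> lifted d (Spine k)" if "between i k j" for k
  proof -
    have "i \<noteq> j" using i j unfolding blk_def NZ_def by auto
    then show ?thesis using ij that unfolding prio_cat_iff by simp
  qed
  have e: "lifted d (Spine i) = 3 * d (Spine i)" using n bi(1) unfolding lifted_def by simp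
  have t: "d (Spine (top d q)) < d (Spine i)" using top_less[OF inj i] n by simp
  have "\<not> between i j (hi q)" "\<not> between (lo q) j i"
    using blk_between[OF i lo_hi(3)[OF i], of j] blk_between[OF lo_hi(1)[OF i] i, of j] j unfolding blk_def NZ_def by auto
  then have "between i (hi q) j \<or> between i (lo q) j"
    using lo_hi(2,4)[OF i] unfolding between_def by linarith
  then have "lifted d (Spine i) < 3 * d (Spine (top d q)) + 3"
    using le lifted_end_le[OF i, of d] by fastforce
  then show False using e t by simp
qed

section \<open>Inversions against a balanced target\<close>

text \<open>An inversion of a legless \<open>i\<close> with a leg-bearing \<open>j\<close> is
  charged to the first leg-bearing vertex \<open>l\<close> from \<open>i\<close> towards
  \<open>j\<close>. The value of \<open>bid l\<close> identifies the block of \<open>i\<close>, on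
  this side as well as in \<open>neighbour_left\<close>.\<close>

lemma neighbour_right:
  assumes "m i = 0" "j \<in> NZ" "i < j"
  obtains l where "l \<in> NZ" "i < l" "l \<le> j" "bid l = bid i"
proof -
  let ?S = "{l \<in> NZ. i < l}"
  have fin: "finite ?S" using finite_NZ by simp
  define l where "l = Min ?S"
  have l: "l \<in> ?S" unfolding l_def by (rule Min_in[OF fin]) (use assms in blast)
  have le: "l \<le> k" if "k \<in> ?S" for k unfolding l_def by (rule Min_le[OF fin that])
  have "{k \<in> NZ. k < l} = {k \<in> NZ. k < i}"
  proof (intro Collect_cong conj_cong refl iffI)
    fix k assume k: "k \<in> NZ" "k < l"
    have "\<not> i < k" using le[of k] k by auto
    moreover have "k \<noteq> i" using k(1) assms(1) unfolding NZ_def by auto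
    ultimately show "k < i" by simp
  next
    fix k assume "k \<in> NZ" "k < i"
    then show "k < l" using l by simp
  qed
  then have "bid l = bid i" unfolding bid_def by simp
  then show ?thesis using that[of l] l le[of j] assms by blast
qed

lemma neighbour_left:
  assumes "m i = 0" "j \<in> NZ" "j < i"
  obtains l where "l \<in> NZ" "l < i" "j \<le> l" "bid i = Suc (bid l)"
proof -
  let ?S = "{l \<in> NZ. l < i}"
  have fin: "finite ?S" using finite_NZ by simp
  define l where "l = Max ?S"
  have l: "l \<in> ?S" unfolding l_def by (rule Max_in[OF fin]) (use assms in blast)
  have le: "k \<le> l" if "k \<in> ?S" for k unfolding l_def by (rule Max_ge[OF fin that])
  have "{k \<in> NZ. k < i} = insert l {k \<in> NZ. k < l}"
    using l le by fastforce
  then have "bid i = Suc (bid l)" unfolding bid_def using finite_NZ by simp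
  then show ?thesis using that[of l] l le[of j] assms by blast
qed

text \<open>The top layer is the balanced tree, the bottom layer the legs. Within the two lower
  layers the given order \<open>e\<close> is kept, so every inversion has a leg-bearing spine vertex
  on top in the target.\<close>

definition layered :: "(nat \<Rightarrow> nat) \<Rightarrow> nat \<Rightarrow> nat \<Rightarrow> (cat_vertex \<Rightarrow> nat) \<Rightarrow> cat_vertex \<Rightarrow> nat" where
  "layered \<rho> R Q e x = (case x of Spine i \<Rightarrow> if m i > 0 then \<rho> i else R + e x | Leg i j \<Rightarrow> R + Q + e x)"

lemma layered_inj:
  assumes "inj_on \<rho> NZ" "\<forall>i\<in>NZ. \<rho> i < R" "\<forall>x\<in>CV. e x < Q" "inj_on e CV"
  shows "inj_on (layered \<rho> R Q e) CV"
proof (rule inj_onI)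
  fix x y assume xy: "x \<in> CV" "y \<in> CV" "layered \<rho> R Q e x = layered \<rho> R Q e y"
  have c: "(\<exists>i\<in>NZ. x = Spine i \<and> layered \<rho> R Q e x = \<rho> i) \<or> (R \<le> layered \<rho> R Q e x \<and> layered \<rho> R Q e x < R + Q \<and> layered \<rho> R Q e x = R + e x)
    \<or> layered \<rho> R Q e x = R + Q + e x" if "x \<in> CV" for x
    using assms(3)[rule_format, OF that] that unfolding layered_def NZ_def by (cases x) auto
  have "(\<exists>i\<in>NZ. \<exists>j\<in>NZ. x = Spine i \<and> y = Spine j \<and> \<rho> i = \<rho> j) \<or> e x = e y"
    using c[OF xy(1)] c[OF xy(2)] xy(3) assms(2) by fastforce
  then show "x = y" using inj_onD[OF assms(1)] inj_onD[OF assms(4) _ xy(1,2)] by blast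
qed

text \<open>Let \<open>D\<close> be the sum on the right. The upper vertex in the target is an
  ancestor in the binary search tree. The lower one is a leg, for at most \<open>D\<close> pairs, or
  a leg-bearing spine vertex, again at most \<open>D\<close>, or the top or an end of a block. Each
  of these last three kinds is charged to a leg-bearing neighbour on either side, at most
  \<open>2 * D\<close> pairs. The total is \<open>8 * D\<close>.\<close>

lemma inversions_layered:
  assumes inj: "inj_on d CV" and \<rho>: "\<forall>i\<in>NZ. \<rho> i < R" and Q: "\<forall>x\<in>CV. lifted d x < Q"
  shows "card (inversions (prio (lifted d)) (prio (layered \<rho> R Q (lifted d)))) \<le>
    8 * (\<Sum>i\<in>NZ. m i * card (bst_anc \<rho> NZ i))"
proof -
  let ?e = "lifted d"
  let ?b = "layered \<rho> R Q ?e"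
  let ?I = "inversions (prio ?e) (prio ?b)"
  define a where "a = bst_anc \<rho> NZ"
  have fa: "finite (a i)" for i unfolding a_def bst_anc_def using finite_NZ by simp
  define Z where "Z = (SIGMA i:NZ. a i)"
  have fZ: "finite Z" unfolding Z_def using finite_NZ fa by auto
  let ?D = "\<Sum>i\<in>NZ. m i * card (a i)"
  have cZ: "card Z \<le> ?D"
  proof -
    have "card Z = (\<Sum>i\<in>NZ. card (a i))" unfolding Z_def using finite_NZ fa by (simp add: card_SigmaI)
    also have "\<dots> \<le> ?D" by (intro sum_mono) (auto simp: NZ_def)
    finally show ?thesis .
  qed
  define Y where "Y = (SIGMA i:NZ. {1..m i} \<times> a i)"
  have cY: "finite Y" "card Y = ?D"
    unfolding Y_def using finite_NZ fa by (auto simp: card_SigmaI card_cartesian_product)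
  define f0 where "f0 = (\<lambda>(i, k, j). (Leg i k, Spine j))"
  define f1 where "f1 = (\<lambda>(i, j). (Spine i, Spine j))"
  \<comment> \<open>\<open>fr F\<close> and \<open>fl F\<close> recover the pair from its charge
    \<open>(l, j)\<close>: the legless vertex is in the block just left or just right of
    \<open>l\<close>, and \<open>F\<close> selects its top or one of its ends.\<close>
  define fr where "fr F = (\<lambda>(l, j). (Spine (F (bid l)), Spine j))" for F :: "nat \<Rightarrow> nat"
  define fl where "fl F = (\<lambda>(l, j). (Spine (F (Suc (bid l))), Spine j))" for F :: "nat \<Rightarrow> nat"
  define X where "X F = fr F ` Z \<union> fl F ` Z" for F
  have cX: "card (X F) \<le> 2 * ?D" "finite (X F)" for F
    using card_Un_le[of "fr F ` Z" "fl F ` Z"] card_image_le[OF fZ, of "fr F"] card_image_le[OF fZ, of "fl F"] cZ fZ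
    unfolding X_def by auto
  have bS: "?b (Spine i) = (if i \<in> NZ then \<rho> i else R + ?e (Spine i))" if "1 \<le> i" "i \<le> n" for i
    using that unfolding layered_def NZ_def by simp
  have anc: "j \<in> a l" if j: "j \<in> NZ" and h: "\<And>k. between i k j \<Longrightarrow> ?b (Spine j) \<le> ?b (Spine k)"
    and l: "\<And>k. between l k j \<Longrightarrow> between i k j" for i j l
  proof -
    have "\<rho> j \<le> \<rho> k" if k: "k \<in> NZ" "between l k j" for k
      using h[OF l[OF k(2)]] bS[of j] bS[of k] j k(1) unfolding NZ_def by simp
    then show ?thesis unfolding a_def bst_anc_def using j by blast
  qed
  have "?I \<subseteq> f0 ` Y \<union> (f1 ` Z \<union> (X (top d) \<union> (X hi \<union> X lo)))"
  proof (rule subrelI)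
    fix x y assume "(x, y) \<in> ?I"
    then have xy: "(x, y) \<in> prio ?e" "(y, x) \<in> prio ?b" "x \<noteq> y" unfolding inversions_def by auto
    have V: "x \<in> CV" "y \<in> CV" using xy(1) unfolding prio_cat_iff by blast+
    have pb: "?b y \<le> ?b (Spine k)" if "between (foot x) k (foot y)" for k
      using xy(2,3) that unfolding prio_cat_iff by (auto simp: between_def)
    have byx: "?b y \<le> ?b x" using xy(2) unfolding prio_cat_iff by blast
    have fy: "between (foot x) (foot y) (foot y)" "between (foot x) (foot x) (foot y)" by (rule between_ends)+
    have eq: "?e x < ?e y"
    proof -
      have "?e x \<le> ?e y" using xy(1) unfolding prio_cat_iff by blast
      moreover have "?e x \<noteq> ?e y" using inj_onD[OF lifted_inj[OF inj] _ V] xy(3) by blast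
      ultimately show ?thesis by simp
    qed
    have Rlt: "?b (Spine i) < R + Q" if "1 \<le> i" "i \<le> n" for i
      using bS[OF that] \<rho> Q that by (auto intro: trans_less_add1)
    obtain j where j: "y = Spine j"
    proof (cases y)
      case (Leg i k)
      then have "R + Q \<le> ?b y" unfolding layered_def by simp
      moreover have "?b y \<le> ?b (Spine i)" using pb[OF fy(1)] Leg by simp
      ultimately have False using Rlt[of i] V(2) Leg by simp
      then show ?thesis ..
    qed
    have jn: "1 \<le> j" "j \<le> n" using V(2) j by auto
    \<comment> \<open>If \<open>Spine j\<close> had no legs, no leg-bearing spine vertex could be on
      the path, since all of these are ranked earlier. Then \<open>x\<close> would be a legless
      spine vertex too, and the two would keep their order.\<close>
    have jNZ: "j \<in> NZ"
    proof (rule ccontr)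
      assume jz: "j \<notin> NZ"
      then have by': "?b y = R + ?e y" using bS[OF jn] j by simp
      have nz: "k \<notin> NZ" if "between (foot x) k j" for k
      proof
        assume k: "k \<in> NZ"
        then have "1 \<le> k" "k \<le> n" unfolding NZ_def by auto
        then have "?b (Spine k) < R" using bS[of k] \<rho> k by simp
        then show False using pb[of k] that j by' by simp
      qed
      show False
      proof (cases x)
        case (Spine i)
        then have "?b x = R + ?e x" using nz[of i] bS[of i] V(1) between_ends(1)[of i j] by simp
        then show False using bS by' byx eq by simp
      next
        case (Leg i k)
        then have "i \<in> NZ" using V(1) unfolding NZ_def by simp
        then show False using nz[of i] Leg between_ends(1)[of i j] by simp
      qed
    qed
    have pbj: "?b (Spine j) \<le> ?b (Spine k)" if "between (foot x) k j" for k using pb that j by simp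
    show "(x, y) \<in> f0 ` Y \<union> (f1 ` Z \<union> (X (top d) \<union> (X hi \<union> X lo)))"
    proof (cases x)
      case (Leg i k)
      then have ik: "i \<in> NZ" "k \<in> {1..m i}" using V(1) unfolding NZ_def by auto
      have "j \<in> a i" by (rule anc[OF jNZ pbj]) (use Leg in auto)
      then have "(i, k, j) \<in> Y" using ik unfolding Y_def by blast
      moreover have "(x, y) = f0 (i, k, j)" unfolding f0_def j Leg by simp
      ultimately show ?thesis by blast
    next
      case (Spine i)
      show ?thesis
      proof (cases "i \<in> NZ")
        case True
        have "j \<in> a i" by (rule anc[OF jNZ pbj]) (use Spine in auto)
        then have "(i, j) \<in> Z" using True unfolding Z_def by blast
        moreover have "(x, y) = f1 (i, j)" unfolding f1_def j Spine by simp
        ultimately show ?thesis by blast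
      next
        case False
        have mi: "m i = 0" using False V(1) Spine unfolding NZ_def by simp
        have ib: "i \<in> blk (bid i)" using zero_in_blk mi V(1) Spine by simp
        have F: "i = top d (bid i) \<or> i = hi (bid i) \<or> i = lo (bid i)"
          using lifted_block_exits[OF inj ib jNZ] xy(1) Spine j by simp
        have "(Spine i, Spine j) \<in> X F" if iF: "i = F (bid i)" for F
        proof (cases "i < j")
          case True
          obtain l where l: "l \<in> NZ" "i < l" "l \<le> j" "bid l = bid i" by (rule neighbour_right[OF mi jNZ True])
          have "j \<in> a l" by (rule anc[OF jNZ pbj]) (use l Spine in \<open>auto simp: between_def\<close>)
          then have "(l, j) \<in> Z" using l unfolding Z_def by blast
          moreover have "(Spine i, Spine j) = fr F (l, j)" unfolding fr_def using l(4) iF by simp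
          ultimately show ?thesis unfolding X_def by blast
        next
          case ge: False
          then have "j < i" using jNZ \<open>i \<notin> NZ\<close> by (metis nat_neq_iff)
          then obtain l where l: "l \<in> NZ" "l < i" "j \<le> l" "bid i = Suc (bid l)" by (rule neighbour_left[OF mi jNZ])
          have "j \<in> a l" by (rule anc[OF jNZ pbj]) (use l Spine in \<open>auto simp: between_def\<close>)
          then have "(l, j) \<in> Z" using l unfolding Z_def by blast
          moreover have "(Spine i, Spine j) = fl F (l, j)" unfolding fl_def using l(4) iF by simp
          ultimately show ?thesis unfolding X_def by blast
        qed
        then show ?thesis using F Spine j by blast
      qed
    qed
  qed
  then have "card ?I \<le> card (f0 ` Y \<union> (f1 ` Z \<union> (X (top d) \<union> (X hi \<union> X lo))))"
    using cY cX fZ by (intro card_mono) auto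
  also have "\<dots> \<le> card (f0 ` Y) + (card (f1 ` Z) + (card (X (top d)) + (card (X hi) + card (X lo))))"
    by (meson card_Un_le add_mono order_refl order_trans)
  also have "\<dots> \<le> ?D + (?D + (2 * ?D + (2 * ?D + 2 * ?D)))"
    using card_image_le[OF cY(1), of f0] card_image_le[OF fZ, of f1] cY(2) cZ cX
    by (intro add_mono) auto
  finally show ?thesis unfolding a_def by simp
qed

section \<open>Assembling the upper bound\<close>

definition entropy_bound :: nat where
  "entropy_bound = nat \<lfloor>real (num_legs n m) * (leg_entropy n m + 1)\<rfloor>"

lemma sum_NZ: "(\<Sum>i\<in>NZ. f i) = (\<Sum>i\<in>{i \<in> {1..n}. m i > 0}. f i)"
  unfolding NZ_def by simp

lemma num_legs_NZ: "num_legs n m = sum m NZ"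
  unfolding num_legs_def NZ_def by (rule sum.mono_neutral_right) auto

text \<open>Taking logarithms bounds the depth of position \<open>i\<close> by
  \<open>log 2 (?M / m i) + 1\<close>; weighted with \<open>m i\<close>, the first term sums to the
  entropy term and the second to the number of legs.\<close>

lemma bst_sum_bound:
  assumes "\<forall>i\<in>NZ. m i * 2 ^ card (bst_anc \<rho> NZ i) \<le> 2 * sum m NZ"
  shows "(\<Sum>i\<in>NZ. m i * card (bst_anc \<rho> NZ i)) \<le> entropy_bound"
proof -
  let ?M = "num_legs n m"
  have term_le: "real (m i * card (bst_anc \<rho> NZ i)) \<le> real (m i) * (log 2 (real ?M / real (m i)) + 1)" if i: "i \<in> NZ" for i
  proof -
    let ?c = "card (bst_anc \<rho> NZ i)"
    have mi: "real (m i) > 0" using i unfolding NZ_def by simp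
    have "real (m i * 2 ^ ?c) \<le> real (2 * ?M)"
      using assms i unfolding num_legs_NZ of_nat_le_iff by blast
    then have le: "2 ^ ?c \<le> 2 * (real ?M / real (m i))" using mi by (simp add: field_simps)
    have "m i \<le> ?M" unfolding num_legs_NZ using i finite_NZ by (intro member_le_sum) auto
    then have pos: "real ?M / real (m i) > 0" using mi by simp
    have "real ?c = log 2 (2 ^ ?c)" by simp
    also have "\<dots> \<le> log 2 (2 * (real ?M / real (m i)))" using le by (intro log_mono) auto
    also have "\<dots> = log 2 (real ?M / real (m i)) + 1" using pos mi by (subst log_mult) auto
    finally show ?thesis using mi by (simp add: mult_left_mono)
  qed
  have "real (\<Sum>i\<in>NZ. m i * card (bst_anc \<rho> NZ i)) \<le> (\<Sum>i\<in>NZ. real (m i) * (log 2 (real ?M / real (m i)) + 1))"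
    unfolding of_nat_sum by (rule sum_mono[OF term_le])
  also have "\<dots> = (\<Sum>i\<in>NZ. real (m i) * log 2 (real ?M / real (m i))) + real ?M"
    unfolding num_legs_NZ by (simp add: distrib_left sum.distrib)
  also have "(\<Sum>i\<in>NZ. real (m i) * log 2 (real ?M / real (m i))) = real ?M * leg_entropy n m"
  proof (cases "?M = 0")
    case True
    then have "m i = 0" if "i \<in> NZ" for i using that finite_NZ unfolding num_legs_NZ by simp
    then show ?thesis using True by simp
  next
    case False
    then show ?thesis unfolding leg_entropy_def sum_NZ[symmetric] sum_distrib_left by (intro sum.cong) auto
  qed
  finally have "real (\<Sum>i\<in>NZ. m i * card (bst_anc \<rho> NZ i)) \<le> real ?M * (leg_entropy n m + 1)"
    by (simp add: algebra_simps)
  then show ?thesis unfolding entropy_bound_def by (simp add: le_nat_floor)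
qed

text \<open>Every position is its own ancestor, so the weighted sum of depths is at least the number
  of legs. This absorbs the leg part of the cost of lifting.\<close>

lemma num_legs_le_entropy_bound: "num_legs n m \<le> entropy_bound"
proof -
  obtain \<rho> :: "nat \<Rightarrow> nat" where \<rho>: "inj_on \<rho> NZ" "\<forall>i\<in>NZ. m i * 2 ^ card (bst_anc \<rho> NZ i) \<le> 2 * sum m NZ"
    using median_bst[OF finite_NZ, of m] unfolding NZ_def by auto
  have "m i \<le> m i * card (bst_anc \<rho> NZ i)" if "i \<in> NZ" for i
  proof -
    have "i \<in> bst_anc \<rho> NZ i" using that unfolding bst_anc_def by (auto simp: between_def)
    moreover have "finite (bst_anc \<rho> NZ i)" unfolding bst_anc_def using finite_NZ by simp
    ultimately have "card (bst_anc \<rho> NZ i) > 0" using card_gt_0_iff by blast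
    then show ?thesis by simp
  qed
  then have "num_legs n m \<le> (\<Sum>i\<in>NZ. m i * card (bst_anc \<rho> NZ i))"
    unfolding num_legs_NZ by (rule sum_mono)
  then show ?thesis using bst_sum_bound[OF \<rho>(2)] by simp
qed

text \<open>Lifting costs \<open>2 * (n + entropy_bound)\<close>, reaching the balanced target
  \<open>8 * entropy_bound\<close>, and straightening the spine at most \<open>n\<close>. Both
  directions are recorded, so that one tree can be led to the meeting point and the other back from
  it.\<close>

lemma reach_spine_path_all:
  assumes A: "anc_order CV A"
  defines "k \<equiv> 3 * n + 10 * entropy_bound"
  shows "\<exists>C. spine_path C \<and> reachable k A C \<and> reachable k C A"
proof -
  obtain d :: "cat_vertex \<Rightarrow> nat" where d: "inj_on d CV" "A = prio d" using ao_is_prio[OF A] by metis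
  obtain \<rho> :: "nat \<Rightarrow> nat" where \<rho>: "inj_on \<rho> NZ" "\<forall>i\<in>NZ. m i * 2 ^ card (bst_anc \<rho> NZ i) \<le> 2 * sum m NZ"
    using median_bst[OF finite_NZ, of m] unfolding NZ_def by auto
  obtain R where R: "\<forall>i\<in>NZ. \<rho> i < R"
    using finite_nat_set_iff_bounded[of "\<rho> ` NZ"] finite_NZ by auto
  obtain Q where Q: "\<forall>x\<in>CV. lifted d x < Q"
    using finite_nat_set_iff_bounded[of "lifted d ` CV"] finite_verts by auto
  let ?T = "prio (lifted d)" and ?B = "prio (layered \<rho> R Q (lifted d))"
  have T: "anc_order CV ?T" by (rule prio_ao[OF lifted_inj[OF d(1)]])
  have B: "anc_order CV ?B" by (rule prio_ao[OF layered_inj[OF \<rho>(1) R Q lifted_inj[OF d(1)]]])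
  have c1: "card (inversions A ?T) \<le> 2 * (n + entropy_bound)"
    using inversions_lifted[OF d(1)] num_legs_le_entropy_bound unfolding d(2) card_cat_verts by simp
  have c2: "card (inversions ?T ?B) \<le> 8 * entropy_bound"
    using inversions_layered[OF d(1) R Q] bst_sum_bound[OF \<rho>(2)] by linarith
  have r1: "reachable (2 * (n + entropy_bound)) A ?T" "reachable (2 * (n + entropy_bound)) ?T A"
    using reachable_inversions[OF A T] reachable_inversions[OF T A] c1 reachable_mono
    unfolding card_inversions_sym[of ?T A] by blast+
  have r2: "reachable (8 * entropy_bound) ?T ?B" "reachable (8 * entropy_bound) ?B ?T"
    using reachable_inversions[OF T B] reachable_inversions[OF B T] c2 reachable_mono
    unfolding card_inversions_sym[of ?B ?T] by blast+
  have "legs_low ?B"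
    unfolding legs_low_def
  proof (intro allI impI)
    fix i j y assume h: "(Leg i j, y) \<in> ?B"
    show "y = Leg i j"
    proof (rule ccontr)
      assume n: "y \<noteq> Leg i j"
      have V: "1 \<le> i" "i \<le> n" "m i > 0" using h unfolding prio_cat_iff by auto
      have "between i i (foot y)" by (rule between_ends)
      then have "layered \<rho> R Q (lifted d) (Leg i j) \<le> layered \<rho> R Q (lifted d) (Spine i)"
        using h n unfolding prio_cat_iff by auto
      moreover have "\<rho> i < R" using R V unfolding NZ_def by simp
      ultimately show False unfolding layered_def using V(3) by simp
    qed
  qed
  from reach_spine_path[OF B this] obtain C j where C: "spine_path C" "j \<le> n" "reachable j ?B C" "reachable j C ?B"
    using diff_le_self by blast
  have "reachable (2 * (n + entropy_bound) + 8 * entropy_bound + j) A C"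
    by (rule reachable_trans[OF reachable_trans[OF r1(1) r2(1)] C(3)])
  moreover have "reachable (j + 8 * entropy_bound + 2 * (n + entropy_bound)) C A"
    by (rule reachable_trans[OF reachable_trans[OF C(4) r2(2)] r1(2)])
  moreover have "2 * (n + entropy_bound) + 8 * entropy_bound + j \<le> k" "j + 8 * entropy_bound + 2 * (n + entropy_bound) \<le> k"
    unfolding k_def using C(2) by auto
  ultimately show ?thesis using C(1) reachable_mono by blast
qed

lemma upper_bound:
  "cat_diameter n m \<le> enat (6 * n + 20 * entropy_bound)"
proof (rule cat_diameter_le)
  fix A B assume A: "anc_order CV A" and B: "anc_order CV B"
  let ?k = "3 * n + 10 * entropy_bound"
  obtain C where C: "spine_path C" "reachable ?k A C" using reach_spine_path_all[OF A] by blast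
  obtain D where D: "spine_path D" "reachable ?k D B" using reach_spine_path_all[OF B] by blast
  have "reachable (?k + ?k) A B"
    using reachable_trans[OF C(2)] D(2) spine_path_unique[OF C(1) D(1)] by blast
  moreover have "?k + ?k = 6 * n + 20 * entropy_bound" by simp
  ultimately show "reachable (6 * n + 20 * entropy_bound) A B" by simp
qed

text \<open>\<open>nat\<close> truncates at zero, so the real number must be seen to be nonnegative;
  with legs present this follows because its truncation is positive.\<close>

lemma real_entropy_bound: "real entropy_bound \<le> real (num_legs n m) * (leg_entropy n m + 1)"
proof (cases "num_legs n m = 0")
  case True then show ?thesis unfolding entropy_bound_def by simp
next
  case False
  have "entropy_bound > 0" using num_legs_le_entropy_bound False by simp
  then have "real (num_legs n m) * (leg_entropy n m + 1) \<ge> 0"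
    unfolding entropy_bound_def by linarith
  then show ?thesis unfolding entropy_bound_def by simp
qed

end

theorem theorem1:
  shows "\<exists>c\<^sub>1 c\<^sub>2 :: real. c\<^sub>1 > 0 \<and> c\<^sub>2 > 0 \<and>
    (\<forall>(n::nat) (m :: nat \<Rightarrow> nat). n \<ge> 1 \<longrightarrow>
      (\<exists>\<delta>::nat. cat_diameter n m = enat \<delta> \<and>
        (n + num_legs n m \<ge> 2 \<longrightarrow>
          c\<^sub>1 * (real n + real (num_legs n m) * (leg_entropy n m + 1)) \<le> real \<delta>) \<and>
        real \<delta> \<le> c\<^sub>2 * (real n + real (num_legs n m) * (leg_entropy n m + 1))))"
proof (rule exI[of _ "1 / 18"], rule exI[of _ 20], intro conjI allI impI)
  fix n :: nat and m :: "nat \<Rightarrow> nat" assume "n \<ge> 1"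
  then interpret caterpillar n m by unfold_locales
  define X where "X = real (num_legs n m) * (leg_entropy n m + 1)"
  obtain \<delta> where \<delta>: "cat_diameter n m = enat \<delta>"
    using upper_bound by (cases "cat_diameter n m") auto
  have "\<delta> \<le> 6 * n + 20 * entropy_bound" using upper_bound unfolding \<delta> by simp
  then have "real \<delta> \<le> 6 * real n + 20 * real entropy_bound" by linarith
  moreover have "real entropy_bound \<le> X" unfolding X_def by (rule real_entropy_bound)
  ultimately have "real \<delta> \<le> 20 * (real n + X)" by simp
  then show "\<exists>\<delta>::nat. cat_diameter n m = enat \<delta> \<and>
        (n + num_legs n m \<ge> 2 \<longrightarrow>
          1 / 18 * (real n + real (num_legs n m) * (leg_entropy n m + 1)) \<le> real \<delta>) \<and>
        real \<delta> \<le> 20 * (real n + real (num_legs n m) * (leg_entropy n m + 1))"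
    unfolding X_def using \<delta> lower_bound by blast
qed simp_all

end
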